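(* Let $\mathbf{k}$ be a commutative unitary ring, $\lambda\in\mathbf{k}$, and let $M$ be a $\mathbf{k}$-module. Let $\mathrm{Sh}^{NC,0}(M)=\bigoplus_{F\in\mathcal{F}^0}M^{\otimes F}$, where $\mathcal{F}^0$ is the set of ladder-free planar rooted forests, with the product $\overline{\diamond}$, the linear operator $P_M$ and the module map $j_M:M\to \mathrm{Sh}^{NC,0}(M)$ defined in the context. Then: (a) The pair $(\mathrm{Sh}^{NC,0}(M),\overline{\diamond})$ is a nonunitary associative algebra. (b) The triple $(\mathrm{Sh}^{NC,0}(M),\overline{\diamond},P_M)$ is a nonunitary Rota--Baxter algebra of weight $\lambda$. (c) The quadruple $(\mathrm{Sh}^{NC,0}(M),\overline{\diamond},P_M,j_M)$ is the free nonunitary Rota--Baxter algebra of weight $\lambda$ on the $\mathbf{k}$-module $M$; that is, for any nonunitary Rota--Baxter algebra $(R,P)$ of weight $\lambda$ and any $\mathbf{k}$-module morphism $f:M\to R$, there is a unique nonunitary Rota--Baxter algebra morphism $\bar f:\mathrm{Sh}^{NC,0}(M)\to R$ such that $f=\bar f\circ j_M$.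
   Context: Nonunitary Rota--Baxter algebra of weight $\lambda$: an associative $\mathbf{k}$-algebra $R$, not required to have an identity, with a $\mathbf{k}$-linear map $P:R\to R$ such that $P(x)P(y)=P\big(P(x)y+xP(y)+\lambda xy\big)$ for all $x,y\in R$. A morphism of nonunitary Rota--Baxter algebras is a $\mathbf{k}$-linear multiplicative map commuting with the operators. Forests: $\mathcal{T}$ is the set of planar rooted trees; $\bullet$ is the tree with a single vertex. $\mathcal{F}$ is the free semigroup generated by $\mathcal{T}$, with product (concatenation) denoted $\sqcup$; its elements $T_1\sqcup\cdots\sqcup T_b$ ($b\ge 1$, $T_i\in\mathcal{T}$) are called planar rooted forests. The grafting $\lfloor T_1\sqcup\cdots\sqcup T_b\rfloor$ is the tree obtained by adding a new root together with an edge from the new root to the root of each $T_i$ (keeping the order). Every tree is either $\bullet$ or of the form $\lfloor \overline{F}\rfloor$ for a unique forest $\overline{F}$. The depth of a tree is the length of the longest path from its root to a leaf; the depth $\mathrm{d}(F)$ of a forest is the maximal depth of its trees. $\ell(F)$ denotes the number of leaves of $F$ (with $\ell(\bullet)=1$). The product $\sqcup$ and the grafting $\lfloor\ \rfloor$ are extended (bi)linearly to $\mathbf{k}\,\mathcal{F}$, the free $\mathbf{k}$-module on $\mathcal F$. Ladder-free forests: $\mathcal{F}^0$ is the set of forests $F\in\mathcal{F}$ with $F\ne\bullet$ such that $F$ does not contain the subtree $\lfloor\bullet\rfloor$, i.e. none of the brackets $\lfloor B\rfloor$ occurring in $F$ is $\lfloor\bullet\rfloor$ (equivalently, no vertex of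 $F$ has exactly one child with that child a leaf). Product $\diamond$ on $\mathbf{k}\,\mathcal{F}$: defined on $\mathcal{F}\times\mathcal{F}$ by induction on $\mathrm{d}(F)+\mathrm{d}(F')$ and extended bilinearly. For trees $F,F'$: $F\diamond\bullet=F$, $\bullet\diamond F'=F'$, and if $F=\lfloor\overline{F}\rfloor$, $F'=\lfloor\overline{F}'\rfloor$ then $$F\diamond F'=\lfloor\lfloor\overline{F}\rfloor\diamond\overline{F}'\rfloor+\lfloor\overline{F}\diamond\lfloor\overline{F}'\rfloor\rfloor+\lambda\lfloor\overline{F}\diamond\overline{F}'\rfloor .$$ For forests $F=T_1\sqcup\cdots\sqcup T_b$ and $F'=T'_1\sqcup\cdots\sqcup T'_{b'}$, $F\diamond F'=T_1\sqcup\cdots\sqcup T_{b-1}\sqcup(T_b\diamond T'_1)\sqcup T'_2\sqcup\cdots\sqcup T'_{b'}$. The element $F\diamond F'$ is a linear combination of forests each having $\ell(F)+\ell(F')-1$ leaves; $\mathbf{k}\,\mathcal{F}^0$ is closed under $\diamond$ and under grafting. Decorated forests: for $F\in\mathcal{F}$, $M^{\otimes F}=\{(F;\mathfrak m)\mid \mathfrak m\in M^{\otimes(\ell(F)-1)}\}$ is a copy of the $\mathbf{k}$-module $M^{\otimes(\ell(F)-1)}$ labelled by $F$, with $M^{\otimes 0}=\mathbf{k}$. If $\sum_i c_iF_i\in\mathbf{k}\,\mathcal F$ with all $F_i$ having the same number $\ell$ of leaves and $\mathfrak m\in M^{\otimes(\ell-1)}$, then $(\sum_i c_iF_i;\mathfrak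 m):=\sum_i c_i(F_i;\mathfrak m)$. Product: $(F;\mathfrak m)\,\overline{\diamond}\,(F';\mathfrak m')=(F\diamond F';\mathfrak m\,\overline{\otimes}\,\mathfrak m')$ for $F,F'\in\mathcal{F}^0$, extended biadditively, where $\overline{\otimes}$ is the product of the tensor algebra $T(M)=\bigoplus_{n\ge0}M^{\otimes n}$. Operator: $P_M(F;\mathfrak m)=(\lfloor F\rfloor;\mathfrak m)$ (note $\ell(\lfloor F\rfloor)=\ell(F)$), extended additively. The map $j_M$ is $a\mapsto(\bullet\sqcup\bullet;a)$. *)

theory Defs
  imports "HOL-Algebra.Module" "HOL-Algebra.AbelCoset" "HOL-Library.FuncSet"
begin

section \<open>Nonunitary Rota--Baxter algebras\<close>

text \<open>
  Algebras without identity are \<open>module\<close> records; the field \<open>one\<close> of the record is ignored.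
\<close>

locale nonunital_algebra = module K A for K (structure) and A (structure) +
  assumes mult_closed:
      "\<lbrakk>x \<in> carrier A; y \<in> carrier A\<rbrakk> \<Longrightarrow> x \<otimes>\<^bsub>A\<^esub> y \<in> carrier A"
    and mult_assoc:
      "\<lbrakk>x \<in> carrier A; y \<in> carrier A; z \<in> carrier A\<rbrakk> \<Longrightarrow>
        (x \<otimes>\<^bsub>A\<^esub> y) \<otimes>\<^bsub>A\<^esub> z = x \<otimes>\<^bsub>A\<^esub> (y \<otimes>\<^bsub>A\<^esub> z)"
    and distrib_left:
      "\<lbrakk>x \<in> carrier A; y \<in> carrier A; z \<in> carrier A\<rbrakk> \<Longrightarrow>
        x \<otimes>\<^bsub>A\<^esub> (y \<oplus>\<^bsub>A\<^esub> z) = x \<otimes>\<^bsub>A\<^esub> y \<oplus>\<^bsub>A\<^esub> x \<otimes>\<^bsub>A\<^esub> z"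
    and distrib_right:
      "\<lbrakk>x \<in> carrier A; y \<in> carrier A; z \<in> carrier A\<rbrakk> \<Longrightarrow>
        (x \<oplus>\<^bsub>A\<^esub> y) \<otimes>\<^bsub>A\<^esub> z = x \<otimes>\<^bsub>A\<^esub> z \<oplus>\<^bsub>A\<^esub> y \<otimes>\<^bsub>A\<^esub> z"
    and smult_mult_left:
      "\<lbrakk>c \<in> carrier K; x \<in> carrier A; y \<in> carrier A\<rbrakk> \<Longrightarrow>
        (c \<odot>\<^bsub>A\<^esub> x) \<otimes>\<^bsub>A\<^esub> y = c \<odot>\<^bsub>A\<^esub> (x \<otimes>\<^bsub>A\<^esub> y)"
    and smult_mult_right:
      "\<lbrakk>c \<in> carrier K; x \<in> carrier A; y \<in> carrier A\<rbrakk> \<Longrightarrow>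
        x \<otimes>\<^bsub>A\<^esub> (c \<odot>\<^bsub>A\<^esub> y) = c \<odot>\<^bsub>A\<^esub> (x \<otimes>\<^bsub>A\<^esub> y)"

definition linear_maps ::
    "('k, 'c) ring_scheme \<Rightarrow> ('k, 'a, 'x) module_scheme \<Rightarrow> ('k, 'b, 'y) module_scheme \<Rightarrow> ('a \<Rightarrow> 'b) set"
  where "linear_maps K A B =
    {h \<in> carrier A \<rightarrow> carrier B.
      (\<forall>x\<in>carrier A. \<forall>y\<in>carrier A. h (x \<oplus>\<^bsub>A\<^esub> y) = h x \<oplus>\<^bsub>B\<^esub> h y) \<and>
      (\<forall>c\<in>carrier K. \<forall>x\<in>carrier A. h (c \<odot>\<^bsub>A\<^esub> x) = c \<odot>\<^bsub>B\<^esub> h x)}"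

locale nonunital_rota_baxter = nonunital_algebra K A for K (structure) and A (structure) +
  fixes wt and P
  assumes weight_closed: "wt \<in> carrier K"
    and operator_linear: "P \<in> linear_maps K A A"
    and rota_baxter:
      "\<lbrakk>x \<in> carrier A; y \<in> carrier A\<rbrakk> \<Longrightarrow>
        P x \<otimes>\<^bsub>A\<^esub> P y = P (P x \<otimes>\<^bsub>A\<^esub> y \<oplus>\<^bsub>A\<^esub> x \<otimes>\<^bsub>A\<^esub> P y \<oplus>\<^bsub>A\<^esub> wt \<odot>\<^bsub>A\<^esub> (x \<otimes>\<^bsub>A\<^esub> y))"

definition rota_baxter_homs ::
    "('k, 'c) ring_scheme \<Rightarrow> ('k, 'a, 'x) module_scheme \<Rightarrow> ('a \<Rightarrow> 'a) \<Rightarrow>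
      ('k, 'b, 'y) module_scheme \<Rightarrow> ('b \<Rightarrow> 'b) \<Rightarrow> ('a \<Rightarrow> 'b) set"
  where "rota_baxter_homs K A P B Q =
    {h \<in> linear_maps K A B.
      (\<forall>x\<in>carrier A. \<forall>y\<in>carrier A. h (x \<otimes>\<^bsub>A\<^esub> y) = h x \<otimes>\<^bsub>B\<^esub> h y) \<and>
      (\<forall>x\<in>carrier A. h (P x) = Q (h x))}"


section \<open>Direct sums, free modules and quotients\<close>

text \<open>
  The fields \<open>mult\<close> and \<open>one\<close> play no role for modules and are left unspecified.
  Direct sums consist of finitely supported families, \<open>undefined\<close> outside the index set.
\<close>

definition direct_sum :: "'i set \<Rightarrow> ('i \<Rightarrow> ('k, 'a, 'x) module_scheme) \<Rightarrow> ('k, 'i \<Rightarrow> 'a) module"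
  where "direct_sum I N =
    \<lparr>carrier = {u \<in> \<Pi>\<^sub>E i\<in>I. carrier (N i). finite {i \<in> I. u i \<noteq> \<zero>\<^bsub>N i\<^esub>}},
     mult = undefined,
     one = undefined,
     zero = (\<lambda>i\<in>I. \<zero>\<^bsub>N i\<^esub>),
     add = (\<lambda>u v. \<lambda>i\<in>I. u i \<oplus>\<^bsub>N i\<^esub> v i),
     smult = (\<lambda>c u. \<lambda>i\<in>I. c \<odot>\<^bsub>N i\<^esub> u i)\<rparr>"

definition summand :: "'i set \<Rightarrow> ('i \<Rightarrow> ('k, 'a, 'x) module_scheme) \<Rightarrow> 'i \<Rightarrow> 'a \<Rightarrow> 'i \<Rightarrow> 'a"
  where "summand I N i m = (\<lambda>j\<in>I. if j = i then m else \<zero>\<^bsub>N j\<^esub>)"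

definition ring_module :: "('k, 'c) ring_scheme \<Rightarrow> ('k, 'k) module"
  where "ring_module K =
    \<lparr>carrier = carrier K, mult = mult K, one = one K, zero = zero K, add = add K, smult = mult K\<rparr>"

definition free_module :: "('k, 'c) ring_scheme \<Rightarrow> 's set \<Rightarrow> ('k, 's \<Rightarrow> 'k) module"
  where "free_module K S = direct_sum S (\<lambda>_. ring_module K)"

definition basis :: "('k, 'c) ring_scheme \<Rightarrow> 's set \<Rightarrow> 's \<Rightarrow> 's \<Rightarrow> 'k"
  where "basis K S s = summand S (\<lambda>_. ring_module K) s \<one>\<^bsub>K\<^esub>"

definition linear_extension ::
    "('k, 'c) ring_scheme \<Rightarrow> 's set \<Rightarrow> ('k, 'a, 'x) module_scheme \<Rightarrow> ('s \<Rightarrow> 'a) \<Rightarrow> ('s \<Rightarrow> 'k) \<Rightarrow> 'a"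
  where "linear_extension K S N \<phi> x = (\<Oplus>\<^bsub>N\<^esub>s\<in>{s \<in> S. x s \<noteq> \<zero>\<^bsub>K\<^esub>}. x s \<odot>\<^bsub>N\<^esub> \<phi> s)"

definition quotient_module :: "('k, 'a, 'x) module_scheme \<Rightarrow> 'a set \<Rightarrow> ('k, 'a set) module"
  where "quotient_module N H =
    \<lparr>carrier = a_rcosets\<^bsub>N\<^esub> H,
     mult = undefined,
     one = undefined,
     zero = H,
     add = set_add N,
     smult = (\<lambda>c X. \<Union>x\<in>X. H +>\<^bsub>N\<^esub> (c \<odot>\<^bsub>N\<^esub> x))\<rparr>"

definition submodule_span ::
    "('k, 'c) ring_scheme \<Rightarrow> ('k, 'a, 'x) module_scheme \<Rightarrow> 'a set \<Rightarrow> 'a set"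
  where "submodule_span K N S = \<Inter>{H. submodule H K N \<and> S \<subseteq> H}"


section \<open>Tensor powers\<close>

text \<open>
  The \<open>n\<close>-th tensor power is the free module on \<open>n\<close>-tuples modulo the multilinearity relations.
  For \<open>n = 0\<close> there are no relations and the empty tuple spans a copy of the ground ring.
\<close>

definition tuples :: "('k, 'm, 'x) module_scheme \<Rightarrow> nat \<Rightarrow> 'm list set"
  where "tuples M n = {xs. length xs = n \<and> set xs \<subseteq> carrier M}"

definition multilinearity_relations ::
    "('k, 'c) ring_scheme \<Rightarrow> ('k, 'm, 'x) module_scheme \<Rightarrow> nat \<Rightarrow> ('m list \<Rightarrow> 'k) set"
  where "multilinearity_relations K M n =
    (let N = free_module K (tuples M n); e = basis K (tuples M n) in
      {e (xs @ [a \<oplus>\<^bsub>M\<^esub> b] @ ys) \<ominus>\<^bsub>N\<^esub> (e (xs @ [a] @ ys) \<oplus>\<^bsub>N\<^esub> e (xs @ [b] @ ys)) | xs a b ys.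
        set xs \<subseteq> carrier M \<and> a \<in> carrier M \<and> b \<in> carrier M \<and> set ys \<subseteq> carrier M \<and>
        length xs + 1 + length ys = n} \<union>
      {e (xs @ [c \<odot>\<^bsub>M\<^esub> a] @ ys) \<ominus>\<^bsub>N\<^esub> c \<odot>\<^bsub>N\<^esub> e (xs @ [a] @ ys) | xs c a ys.
        set xs \<subseteq> carrier M \<and> c \<in> carrier K \<and> a \<in> carrier M \<and> set ys \<subseteq> carrier M \<and>
        length xs + 1 + length ys = n})"

definition tensor_null ::
    "('k, 'c) ring_scheme \<Rightarrow> ('k, 'm, 'x) module_scheme \<Rightarrow> nat \<Rightarrow> ('m list \<Rightarrow> 'k) set"
  where "tensor_null K M n =
    submodule_span K (free_module K (tuples M n)) (multilinearity_relations K M n)"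

definition tensor_power ::
    "('k, 'c) ring_scheme \<Rightarrow> ('k, 'm, 'x) module_scheme \<Rightarrow> nat \<Rightarrow> ('k, ('m list \<Rightarrow> 'k) set) module"
  where "tensor_power K M n = quotient_module (free_module K (tuples M n)) (tensor_null K M n)"

definition pure_tensor ::
    "('k, 'c) ring_scheme \<Rightarrow> ('k, 'm, 'x) module_scheme \<Rightarrow> 'm list \<Rightarrow> ('m list \<Rightarrow> 'k) set"
  where "pure_tensor K M xs =
    tensor_null K M (length xs)
      +>\<^bsub>free_module K (tuples M (length xs))\<^esub> basis K (tuples M (length xs)) xs"

text \<open>
  The product of the tensor algebra, in degrees \<open>p\<close> and \<open>q\<close>: the bilinear extension of
  concatenation of tuples, taken on all representatives of the two classes.
\<close>

definition concat_ext ::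
    "('k, 'c) ring_scheme \<Rightarrow> ('k, 'm, 'x) module_scheme \<Rightarrow> nat \<Rightarrow> nat \<Rightarrow>
      ('m list \<Rightarrow> 'k) \<Rightarrow> ('m list \<Rightarrow> 'k) \<Rightarrow> 'm list \<Rightarrow> 'k"
  where "concat_ext K M p q x y =
    (let N = free_module K (tuples M (p + q)) in
      linear_extension K (tuples M p) N
        (\<lambda>xs. linear_extension K (tuples M q) N (\<lambda>ys. basis K (tuples M (p + q)) (xs @ ys)) y) x)"

definition tensor_mult ::
    "('k, 'c) ring_scheme \<Rightarrow> ('k, 'm, 'x) module_scheme \<Rightarrow> nat \<Rightarrow> nat \<Rightarrow>
      ('m list \<Rightarrow> 'k) set \<Rightarrow> ('m list \<Rightarrow> 'k) set \<Rightarrow> ('m list \<Rightarrow> 'k) set"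
  where "tensor_mult K M p q X Y =
    (\<Union>x\<in>X. \<Union>y\<in>Y.
      tensor_null K M (p + q) +>\<^bsub>free_module K (tuples M (p + q))\<^esub> concat_ext K M p q x y)"


section \<open>Planar rooted forests\<close>

text \<open>
  A vertex is given by the list of its children, so that \<open>Node\<close> applied to a nonempty
  list is grafting.  The free semigroup on the trees is the set of nonempty lists.
\<close>

datatype ptree = Node "ptree list"

type_synonym forest = "ptree list"

abbreviation bullet :: ptree
  where "bullet \<equiv> Node []"

definition forests :: "forest set"
  where "forests = {F. F \<noteq> []}"

primrec tree_leaves :: "ptree \<Rightarrow> nat"
  where "tree_leaves (Node F) = (if F = [] then 1 else sum_list (map tree_leaves F))"

definition leaves :: "forest \<Rightarrow> nat"
  where "leaves F = sum_list (map tree_leaves F)"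

primrec subtrees :: "ptree \<Rightarrow> ptree set"
  where "subtrees (Node F) = insert (Node F) (\<Union>(set (map subtrees F)))"

definition ladder_free_forests :: "forest set"
  where "ladder_free_forests =
    {F \<in> forests. F \<noteq> [bullet] \<and> (\<forall>T\<in>set F. Node [bullet] \<notin> subtrees T)}"

definition forest_module :: "('k, 'c) ring_scheme \<Rightarrow> ('k, forest \<Rightarrow> 'k) module"
  where "forest_module K = free_module K forests"

definition graft_ext :: "('k, 'c) ring_scheme \<Rightarrow> (forest \<Rightarrow> 'k) \<Rightarrow> forest \<Rightarrow> 'k"
  where "graft_ext K =
    linear_extension K forests (forest_module K) (\<lambda>F. basis K forests [Node F])"

text \<open>
  \<open>between_ext K A x B\<close> is the concatenation of \<open>A\<close>, \<open>x\<close> and \<open>B\<close>, linear in \<open>x\<close>; the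
  lists \<open>A\<close> and \<open>B\<close> may be empty.
\<close>

definition between_ext ::
    "('k, 'c) ring_scheme \<Rightarrow> forest \<Rightarrow> (forest \<Rightarrow> 'k) \<Rightarrow> forest \<Rightarrow> forest \<Rightarrow> 'k"
  where "between_ext K A x B =
    linear_extension K forests (forest_module K) (\<lambda>F. basis K forests (A @ F @ B)) x"

primrec vertices :: "ptree \<Rightarrow> nat"
  where "vertices (Node F) = Suc (sum_list (map vertices F))"

lemma vertices_last_hd_le:
  assumes "\<not> (F = [] \<or> F' = [])"
  shows "vertices (last F) + vertices (hd F') \<le> sum_list (map vertices F) + sum_list (map vertices F')"
proof -
  have "vertices (last F) \<le> sum_list (map vertices F)"
    using assms by (induction F) auto
  moreover have "vertices (hd F') \<le> sum_list (map vertices F')"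
    using assms by (cases F') auto
  ultimately show ?thesis by simp
qed

text \<open>
  The product of two basis forests, of weight \<open>wt\<close>.  The value at an empty list, which is not a
  forest, is a dummy.
\<close>

function (sequential)
  tree_diamond :: "('k, 'c) ring_scheme \<Rightarrow> 'k \<Rightarrow> ptree \<Rightarrow> ptree \<Rightarrow> forest \<Rightarrow> 'k" and
  diamond :: "('k, 'c) ring_scheme \<Rightarrow> 'k \<Rightarrow> forest \<Rightarrow> forest \<Rightarrow> forest \<Rightarrow> 'k"
  where
    "tree_diamond K wt (Node F) (Node F') =
      (if F' = [] then basis K forests [Node F]
       else if F = [] then basis K forests [Node F']
       else graft_ext K (diamond K wt [Node F] F')
         \<oplus>\<^bsub>forest_module K\<^esub> graft_ext K (diamond K wt F [Node F'])
         \<oplus>\<^bsub>forest_module K\<^esub> wt \<odot>\<^bsub>forest_module K\<^esub> graft_ext K (diamond K wt F F'))"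
  | "diamond K wt F F' =
      (if F = [] \<or> F' = [] then \<zero>\<^bsub>forest_module K\<^esub>
       else between_ext K (butlast F) (tree_diamond K wt (last F) (hd F')) (tl F'))"
  by pat_completeness auto
termination
proof (relation "measure (\<lambda>s. case s of
      Inl (K, wt, T, T') \<Rightarrow> 2 * (vertices T + vertices T')
    | Inr (K, wt, F, F') \<Rightarrow> 2 * (sum_list (map vertices F) + sum_list (map vertices F')) + 1)",
    goal_cases)
  case (5 K wt F F')
  then show ?case
    using vertices_last_hd_le[of F F'] by simp
qed simp_all


section \<open>The algebra of decorated ladder-free forests\<close>

definition decorations ::
    "('k, 'c) ring_scheme \<Rightarrow> ('k, 'm, 'x) module_scheme \<Rightarrow> forest \<Rightarrow> ('k, ('m list \<Rightarrow> 'k) set) module"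
  where "decorations K M F = tensor_power K M (leaves F - 1)"

definition ShNC0_module ::
    "('k, 'c) ring_scheme \<Rightarrow> ('k, 'm, 'x) module_scheme \<Rightarrow>
      ('k, forest \<Rightarrow> ('m list \<Rightarrow> 'k) set) module"
  where "ShNC0_module K M = direct_sum ladder_free_forests (decorations K M)"

text \<open>
  \<open>decorated K M F m\<close> is the element \<open>(F; m)\<close>.  It is meant for ladder-free \<open>F\<close> only, and
  \<open>decorated_ext\<close>, which extends it linearly in the forest, for combinations of ladder-free
  forests with the same number of leaves.
\<close>

definition decorated ::
    "('k, 'c) ring_scheme \<Rightarrow> ('k, 'm, 'x) module_scheme \<Rightarrow> forest \<Rightarrow> ('m list \<Rightarrow> 'k) set \<Rightarrow>
      forest \<Rightarrow> ('m list \<Rightarrow> 'k) set"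
  where "decorated K M = summand ladder_free_forests (decorations K M)"

definition decorated_ext ::
    "('k, 'c) ring_scheme \<Rightarrow> ('k, 'm, 'x) module_scheme \<Rightarrow> (forest \<Rightarrow> 'k) \<Rightarrow> ('m list \<Rightarrow> 'k) set \<Rightarrow>
      forest \<Rightarrow> ('m list \<Rightarrow> 'k) set"
  where "decorated_ext K M x m =
    linear_extension K forests (ShNC0_module K M) (\<lambda>F. decorated K M F m) x"

definition decorated_support ::
    "('k, 'c) ring_scheme \<Rightarrow> ('k, 'm, 'x) module_scheme \<Rightarrow>
      (forest \<Rightarrow> ('m list \<Rightarrow> 'k) set) \<Rightarrow> forest set"
  where "decorated_support K M u = {F \<in> ladder_free_forests. u F \<noteq> \<zero>\<^bsub>decorations K M F\<^esub>}"

definition ShNC0_mult ::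
    "('k, 'c) ring_scheme \<Rightarrow> 'k \<Rightarrow> ('k, 'm, 'x) module_scheme \<Rightarrow>
      (forest \<Rightarrow> ('m list \<Rightarrow> 'k) set) \<Rightarrow> (forest \<Rightarrow> ('m list \<Rightarrow> 'k) set) \<Rightarrow>
      forest \<Rightarrow> ('m list \<Rightarrow> 'k) set"
  where "ShNC0_mult K wt M u v =
    (\<Oplus>\<^bsub>ShNC0_module K M\<^esub>F\<in>decorated_support K M u.
      \<Oplus>\<^bsub>ShNC0_module K M\<^esub>F'\<in>decorated_support K M v.
        decorated_ext K M (diamond K wt F F')
          (tensor_mult K M (leaves F - 1) (leaves F' - 1) (u F) (v F')))"

definition ShNC0 ::
    "('k, 'c) ring_scheme \<Rightarrow> 'k \<Rightarrow> ('k, 'm, 'x) module_scheme \<Rightarrow>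
      ('k, forest \<Rightarrow> ('m list \<Rightarrow> 'k) set) module"
  where "ShNC0 K wt M = (ShNC0_module K M)\<lparr>mult := ShNC0_mult K wt M\<rparr>"

definition ShNC0_operator ::
    "('k, 'c) ring_scheme \<Rightarrow> ('k, 'm, 'x) module_scheme \<Rightarrow>
      (forest \<Rightarrow> ('m list \<Rightarrow> 'k) set) \<Rightarrow> forest \<Rightarrow> ('m list \<Rightarrow> 'k) set"
  where "ShNC0_operator K M u =
    (\<Oplus>\<^bsub>ShNC0_module K M\<^esub>F\<in>decorated_support K M u. decorated K M [Node F] (u F))"

definition ShNC0_embed ::
    "('k, 'c) ring_scheme \<Rightarrow> ('k, 'm, 'x) module_scheme \<Rightarrow> 'm \<Rightarrow> forest \<Rightarrow> ('m list \<Rightarrow> 'k) set"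
  where "ShNC0_embed K M a = decorated K M [bullet, bullet] (pure_tensor K M [a])"

end

theory Submission
  imports Defs "HOL-Library.Multiset"
begin

text \<open>
  The underlying module is a direct sum of tensor powers, so it is generated by the elements
  \<open>(F; a\<^sub>1 \<otimes> \<dots> \<otimes> a\<^sub>n)\<close> with a pure tensor as decoration, and a linear map on it is a family of
  multilinear maps in the decorations.  All products and operators are (bi)linear; hence every
  identity has to be checked on these generators only (\<open>linear_maps_agree\<close>, \<open>bilinear_agree\<close>), and
  every map has to be given on them only (\<open>Sh_lift\<close>).

  On generators, decorations are concatenated and the forests are multiplied (\<open>mult_dec\<close>).  The
  coefficients of a product of forests are sums of powers of the weight, so the product is recorded
  by a multiset of forests with exponents of the weight (\<open>forest_prod\<close>, \<open>diamond_eq_wsum\<close>).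
  Associativity becomes an equation between such multisets, proved by induction on the number of
  vertices (\<open>tree_prod_assoc\<close>).  The Rota--Baxter identity is the recursive definition of the product
  of two grafted trees (\<open>rota_baxter_dec\<close>).

  For the universal property, a decorated forest is evaluated in a Rota--Baxter algebra \<open>(R, P)\<close> by
  reading it as a bracketed word in the elements \<open>f a\<close> (\<open>tree_word\<close>): grafting is the operator \<open>P\<close>,
  juxtaposition is the product, and the tree \<open>bullet\<close> stands for the absent identity.  The word of a
  forest is nonempty unless the forest is \<open>bullet\<close> itself (\<open>forest_word_nonempty\<close>); since ladder-free
  forests are different from \<open>bullet\<close> and never graft it, their evaluation needs no identity in \<open>R\<close>.
  Evaluation is multiplicative because the product of forests was defined so as to mimic the
  Rota--Baxter identity in \<open>R\<close> (\<open>evaluate_mult\<close>).  It is the only homomorphism extending \<open>f\<close> because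
  every generator arises from those of the form \<open>([bullet, bullet]; a)\<close> by grafting and products
  (\<open>hom_dec\<close>).
\<close>

section \<open>Linear maps and generating sets\<close>

lemma linear_mapsI:
  assumes "\<And>x. x \<in> carrier A \<Longrightarrow> h x \<in> carrier B"
    and "\<And>x y. \<lbrakk>x \<in> carrier A; y \<in> carrier A\<rbrakk> \<Longrightarrow> h (x \<oplus>\<^bsub>A\<^esub> y) = h x \<oplus>\<^bsub>B\<^esub> h y"
    and "\<And>c x. \<lbrakk>c \<in> carrier K; x \<in> carrier A\<rbrakk> \<Longrightarrow> h (c \<odot>\<^bsub>A\<^esub> x) = c \<odot>\<^bsub>B\<^esub> h x"
  shows "h \<in> linear_maps K A B"
  using assms by (simp add: linear_maps_def)

lemma linear_maps_closed: "\<lbrakk>h \<in> linear_maps K A B; x \<in> carrier A\<rbrakk> \<Longrightarrow> h x \<in> carrier B"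
  by (auto simp: linear_maps_def)

lemma linear_maps_add:
  "\<lbrakk>h \<in> linear_maps K A B; x \<in> carrier A; y \<in> carrier A\<rbrakk> \<Longrightarrow> h (x \<oplus>\<^bsub>A\<^esub> y) = h x \<oplus>\<^bsub>B\<^esub> h y"
  by (auto simp: linear_maps_def)

lemma linear_maps_smult:
  "\<lbrakk>h \<in> linear_maps K A B; c \<in> carrier K; x \<in> carrier A\<rbrakk> \<Longrightarrow> h (c \<odot>\<^bsub>A\<^esub> x) = c \<odot>\<^bsub>B\<^esub> h x"
  by (auto simp: linear_maps_def)

lemma linear_maps_zero:
  assumes "module K A" "module K B" "h \<in> linear_maps K A B"
  shows "h \<zero>\<^bsub>A\<^esub> = \<zero>\<^bsub>B\<^esub>"
proof -
  interpret A: module K A by fact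
  interpret B: module K B by fact
  have "h \<zero>\<^bsub>A\<^esub> = h (\<zero>\<^bsub>K\<^esub> \<odot>\<^bsub>A\<^esub> \<zero>\<^bsub>A\<^esub>)" by simp
  also have "\<dots> = \<zero>\<^bsub>K\<^esub> \<odot>\<^bsub>B\<^esub> h \<zero>\<^bsub>A\<^esub>"
    by (rule linear_maps_smult[OF assms(3)]) simp_all
  also have "\<dots> = \<zero>\<^bsub>B\<^esub>"
    by (simp add: linear_maps_closed[OF assms(3)])
  finally show ?thesis .
qed

lemma module_minus_eq_smult:
  assumes "module K A" "x \<in> carrier A"
  shows "\<ominus>\<^bsub>A\<^esub> x = (\<ominus>\<^bsub>K\<^esub> \<one>\<^bsub>K\<^esub>) \<odot>\<^bsub>A\<^esub> x"
proof -
  interpret A: module K A by fact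
  show ?thesis using assms(2) by (simp add: A.smult_l_minus)
qed

lemma linear_maps_minus:
  assumes "module K A" "module K B" "h \<in> linear_maps K A B" "x \<in> carrier A" "y \<in> carrier A"
  shows "h (x \<ominus>\<^bsub>A\<^esub> y) = h x \<ominus>\<^bsub>B\<^esub> h y"
proof -
  interpret A: module K A by fact
  interpret B: module K B by fact
  note cl = linear_maps_closed[OF assms(3)]
  have "h (x \<ominus>\<^bsub>A\<^esub> y) = h (x \<oplus>\<^bsub>A\<^esub> (\<ominus>\<^bsub>K\<^esub> \<one>\<^bsub>K\<^esub>) \<odot>\<^bsub>A\<^esub> y)"
    unfolding a_minus_def using module_minus_eq_smult[OF assms(1,5)] by simp
  also have "\<dots> = h x \<oplus>\<^bsub>B\<^esub> (\<ominus>\<^bsub>K\<^esub> \<one>\<^bsub>K\<^esub>) \<odot>\<^bsub>B\<^esub> h y"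
    using assms(4,5) by (simp add: linear_maps_add[OF assms(3)] linear_maps_smult[OF assms(3)])
  also have "\<dots> = h x \<ominus>\<^bsub>B\<^esub> h y"
    unfolding a_minus_def using module_minus_eq_smult[OF assms(2)] cl assms(5) by simp
  finally show ?thesis .
qed

lemma linear_maps_compose:
  assumes "h \<in> linear_maps K A B" "g \<in> linear_maps K B C"
  shows "(\<lambda>x. g (h x)) \<in> linear_maps K A C"
  using assms by (auto simp: linear_maps_def Pi_iff)

lemma linear_maps_id: "(\<lambda>x. x) \<in> linear_maps K A A"
  by (simp add: linear_maps_def)

lemma linear_maps_zero_map:
  assumes "module K B"
  shows "(\<lambda>x. \<zero>\<^bsub>B\<^esub>) \<in> linear_maps K A B"
proof -
  interpret B: module K B by fact
  show ?thesis by (rule linear_mapsI) simp_all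
qed

lemma linear_maps_plus:
  assumes "module K B" "h \<in> linear_maps K A B" "g \<in> linear_maps K A B"
  shows "(\<lambda>x. h x \<oplus>\<^bsub>B\<^esub> g x) \<in> linear_maps K A B"
proof -
  interpret B: module K B by fact
  show ?thesis
    by (rule linear_mapsI)
      (simp_all add: linear_maps_closed[OF assms(2)] linear_maps_closed[OF assms(3)]
        linear_maps_add[OF assms(2)] linear_maps_add[OF assms(3)]
        linear_maps_smult[OF assms(2)] linear_maps_smult[OF assms(3)] B.smult_r_distr B.a_ac)
qed

lemma linear_maps_scale:
  assumes "module K B" "c \<in> carrier K" "h \<in> linear_maps K A B"
  shows "(\<lambda>x. c \<odot>\<^bsub>B\<^esub> h x) \<in> linear_maps K A B"
proof -
  interpret B: module K B by fact
  have *: "c \<odot>\<^bsub>B\<^esub> (d \<odot>\<^bsub>B\<^esub> y) = d \<odot>\<^bsub>B\<^esub> (c \<odot>\<^bsub>B\<^esub> y)" if "d \<in> carrier K" "y \<in> carrier B" for d y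
    using that assms(2) by (simp flip: B.smult_assoc1 add: B.R.m_comm)
  show ?thesis
    by (rule linear_mapsI)
      (simp_all add: linear_maps_closed[OF assms(3)] linear_maps_add[OF assms(3)]
        linear_maps_smult[OF assms(3)] B.smult_r_distr assms(2) *)
qed

lemma linear_maps_finsum:
  assumes "module K B" "finite J" "\<And>i. i \<in> J \<Longrightarrow> h i \<in> linear_maps K A B"
  shows "(\<lambda>x. \<Oplus>\<^bsub>B\<^esub>i\<in>J. h i x) \<in> linear_maps K A B"
proof -
  interpret B: module K B by fact
  show ?thesis
  proof (rule linear_mapsI)
    fix x y assume "x \<in> carrier A" "y \<in> carrier A"
    then have c: "h i x \<in> carrier B" "h i y \<in> carrier B" if "i \<in> J" for i
      using assms(3)[OF that] that by (auto intro: linear_maps_closed)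
    have "(\<Oplus>\<^bsub>B\<^esub>i\<in>J. h i (x \<oplus>\<^bsub>A\<^esub> y)) = (\<Oplus>\<^bsub>B\<^esub>i\<in>J. h i x \<oplus>\<^bsub>B\<^esub> h i y)"
      using \<open>x \<in> carrier A\<close> \<open>y \<in> carrier A\<close> c
      by (intro B.finsum_cong') (auto simp: linear_maps_add[OF assms(3)])
    then show "(\<Oplus>\<^bsub>B\<^esub>i\<in>J. h i (x \<oplus>\<^bsub>A\<^esub> y)) = (\<Oplus>\<^bsub>B\<^esub>i\<in>J. h i x) \<oplus>\<^bsub>B\<^esub> (\<Oplus>\<^bsub>B\<^esub>i\<in>J. h i y)"
      using c by (simp add: B.finsum_addf Pi_iff)
  next
    fix x c assume "x \<in> carrier A" "c \<in> carrier K"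
    then have c: "h i x \<in> carrier B" if "i \<in> J" for i
      using assms(3)[OF that] that by (auto intro: linear_maps_closed)
    have "(\<Oplus>\<^bsub>B\<^esub>i\<in>J. h i (c \<odot>\<^bsub>A\<^esub> x)) = (\<Oplus>\<^bsub>B\<^esub>i\<in>J. c \<odot>\<^bsub>B\<^esub> h i x)"
      using \<open>x \<in> carrier A\<close> \<open>c \<in> carrier K\<close> c
      by (intro B.finsum_cong') (auto simp: linear_maps_smult[OF assms(3)])
    then show "(\<Oplus>\<^bsub>B\<^esub>i\<in>J. h i (c \<odot>\<^bsub>A\<^esub> x)) = c \<odot>\<^bsub>B\<^esub> (\<Oplus>\<^bsub>B\<^esub>i\<in>J. h i x)"
      using c assms(2) \<open>c \<in> carrier K\<close> by (simp add: B.finsum_smult_ldistr Pi_iff)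
  next
    fix x assume "x \<in> carrier A"
    then show "(\<Oplus>\<^bsub>B\<^esub>i\<in>J. h i x) \<in> carrier B"
      using linear_maps_closed[OF assms(3)] by (intro B.finsum_closed) auto
  qed
qed

lemma linear_maps_cong:
  assumes "module K A" "h \<in> linear_maps K A B" "\<And>x. x \<in> carrier A \<Longrightarrow> g x = h x"
  shows "g \<in> linear_maps K A B"
proof -
  interpret A: module K A by fact
  show ?thesis
    using assms(2,3) by (auto simp: linear_maps_def Pi_iff)
qed

text \<open>
  Generation is stated through submodules instead of linear combinations: this turns it directly
  into an induction principle, and no sums have to be manipulated.
\<close>

definition generates ::
    "('k, 'c) ring_scheme \<Rightarrow> ('k, 'a, 'x) module_scheme \<Rightarrow> 'a set \<Rightarrow> bool"
  where "generates K N S \<longleftrightarrow>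
    S \<subseteq> carrier N \<and> (\<forall>H. submodule H K N \<and> S \<subseteq> H \<longrightarrow> carrier N \<subseteq> H)"

lemma generates_closed: "\<lbrakk>generates K N S; s \<in> S\<rbrakk> \<Longrightarrow> s \<in> carrier N"
  by (auto simp: generates_def)

lemma generatesD: "\<lbrakk>generates K N S; submodule H K N; S \<subseteq> H\<rbrakk> \<Longrightarrow> carrier N \<subseteq> H"
  by (simp add: generates_def)

lemma generates_induct [consumes 3, case_names zero gen add smult]:
  assumes N: "module K N" and S: "generates K N S" and x: "x \<in> carrier N"
    and z: "Q \<zero>\<^bsub>N\<^esub>"
    and g: "\<And>s. s \<in> S \<Longrightarrow> Q s"
    and a: "\<And>x y. \<lbrakk>x \<in> carrier N; y \<in> carrier N; Q x; Q y\<rbrakk> \<Longrightarrow> Q (x \<oplus>\<^bsub>N\<^esub> y)"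
    and c: "\<And>c x. \<lbrakk>c \<in> carrier K; x \<in> carrier N; Q x\<rbrakk> \<Longrightarrow> Q (c \<odot>\<^bsub>N\<^esub> x)"
  shows "Q x"
proof -
  interpret N: module K N by fact
  \<comment> \<open>Closure under negation comes from multiplication by \<open>-1\<close>.\<close>
  have "submodule {x \<in> carrier N. Q x} K N"
    using z a c by (intro N.submoduleI) (auto simp: module_minus_eq_smult[OF N])
  then have "carrier N \<subseteq> {x \<in> carrier N. Q x}"
    using S g by (auto simp: generates_def)
  then show ?thesis using x by auto
qed

lemma linear_maps_agree:
  assumes "module K N" "generates K N S" "module K B"
    and "h \<in> linear_maps K N B" "g \<in> linear_maps K N B"
    and "\<And>s. s \<in> S \<Longrightarrow> h s = g s" and "x \<in> carrier N"
  shows "h x = g x"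
  using assms(1,2,7)
proof (induction x rule: generates_induct)
  case zero then show ?case
    by (simp add: linear_maps_zero[OF assms(1,3,4)] linear_maps_zero[OF assms(1,3,5)])
next
  case add then show ?case
    by (simp add: linear_maps_add[OF assms(4)] linear_maps_add[OF assms(5)])
next
  case smult then show ?case
    by (simp add: linear_maps_smult[OF assms(4)] linear_maps_smult[OF assms(5)])
qed (fact assms(6))

text \<open>
  Every identity in the algebra of decorated forests is obtained from its values on generators in
  this way, one variable after the other.
\<close>

lemma bilinear_agree:
  assumes A: "module K A" "generates K A S" and B: "module K B" "generates K B T"
    and C: "module K C"
    and hl: "\<And>y. y \<in> carrier B \<Longrightarrow> (\<lambda>x. h x y) \<in> linear_maps K A C"
    and hr: "\<And>x. x \<in> carrier A \<Longrightarrow> h x \<in> linear_maps K B C"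
    and gl: "\<And>y. y \<in> carrier B \<Longrightarrow> (\<lambda>x. g x y) \<in> linear_maps K A C"
    and gr: "\<And>x. x \<in> carrier A \<Longrightarrow> g x \<in> linear_maps K B C"
    and eq: "\<And>s t. \<lbrakk>s \<in> S; t \<in> T\<rbrakk> \<Longrightarrow> h s t = g s t"
    and x: "x \<in> carrier A" and y: "y \<in> carrier B"
  shows "h x y = g x y"
proof (rule linear_maps_agree[OF A C hl gl _ x])
  fix s assume s: "s \<in> S"
  show "h s y = g s y"
    by (rule linear_maps_agree[OF B C hr gr eq y]) (use s A(2) in \<open>auto dest: generates_closed\<close>)
qed (fact y)+

lemma linear_preimage_submodule:
  assumes A: "module K A" and B: "module K B" and h: "h \<in> linear_maps K A B" and H: "submodule H K B"
  shows "submodule {x \<in> carrier A. h x \<in> H} K A"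
proof -
  interpret A: module K A by fact
  interpret B: module K B by fact
  note HE = B.submoduleE[OF H]
  show ?thesis
  proof (rule A.submoduleI)
    show "\<zero>\<^bsub>A\<^esub> \<in> {x \<in> carrier A. h x \<in> H}"
      using subgroup.one_closed[OF submodule.axioms(1)[OF H]] linear_maps_zero[OF A B h] by simp
    fix x assume "x \<in> {x \<in> carrier A. h x \<in> H}"
    then show "\<ominus>\<^bsub>A\<^esub> x \<in> {x \<in> carrier A. h x \<in> H}"
      using HE(4) by (auto simp: module_minus_eq_smult[OF A] linear_maps_smult[OF h])
  qed (use HE in \<open>auto simp: linear_maps_add[OF h] linear_maps_smult[OF h]\<close>)
qed

lemma generates_image:
  assumes A: "module K A" "generates K A S" and B: "module K B"
    and h: "h \<in> linear_maps K A B" and surj: "carrier B \<subseteq> h ` carrier A"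
  shows "generates K B (h ` S)"
  unfolding generates_def
proof (intro conjI allI impI)
  show "h ` S \<subseteq> carrier B"
    using linear_maps_closed[OF h] generates_closed[OF A(2)] by auto
  fix H assume H: "submodule H K B \<and> h ` S \<subseteq> H"
  then have "carrier A \<subseteq> {x \<in> carrier A. h x \<in> H}"
    using linear_preimage_submodule[OF A(1) B h, of H] A(2) unfolding generates_def by blast
  then show "carrier B \<subseteq> H" using surj by blast
qed

section \<open>Direct sums\<close>

lemma direct_sum_simps [simp]:
  "carrier (direct_sum I N) = {u \<in> \<Pi>\<^sub>E i\<in>I. carrier (N i). finite {i \<in> I. u i \<noteq> \<zero>\<^bsub>N i\<^esub>}}"
  "zero (direct_sum I N) = (\<lambda>i\<in>I. \<zero>\<^bsub>N i\<^esub>)"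
  "add (direct_sum I N) u v = (\<lambda>i\<in>I. u i \<oplus>\<^bsub>N i\<^esub> v i)"
  "smult (direct_sum I N) c u = (\<lambda>i\<in>I. c \<odot>\<^bsub>N i\<^esub> u i)"
  by (simp_all add: direct_sum_def)

context
  fixes K :: "('k, 'c) ring_scheme" and I :: "'i set" and N :: "'i \<Rightarrow> ('k, 'a, 'x) module_scheme"
  assumes K: "cring K" and N: "\<And>i. i \<in> I \<Longrightarrow> module K (N i)"
begin

abbreviation (input) "DS \<equiv> direct_sum I N"

lemma direct_sum_add_closed:
  assumes "u \<in> carrier DS" "v \<in> carrier DS"
  shows "u \<oplus>\<^bsub>DS\<^esub> v \<in> carrier DS"
proof -
  have "finite {i \<in> I. u i \<oplus>\<^bsub>N i\<^esub> v i \<noteq> \<zero>\<^bsub>N i\<^esub>}"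
  proof (rule finite_subset)
    show "{i \<in> I. u i \<oplus>\<^bsub>N i\<^esub> v i \<noteq> \<zero>\<^bsub>N i\<^esub>} \<subseteq> {i \<in> I. u i \<noteq> \<zero>\<^bsub>N i\<^esub>} \<union> {i \<in> I. v i \<noteq> \<zero>\<^bsub>N i\<^esub>}"
    proof safe
      fix i assume i: "i \<in> I" "u i \<oplus>\<^bsub>N i\<^esub> v i \<noteq> \<zero>\<^bsub>N i\<^esub>" "v i = \<zero>\<^bsub>N i\<^esub>" "u i = \<zero>\<^bsub>N i\<^esub>"
      interpret module K "N i" by (rule N) fact
      show False using i by simp
    qed
  qed (use assms in auto)
  moreover have "u i \<oplus>\<^bsub>N i\<^esub> v i \<in> carrier (N i)" if "i \<in> I" for i
  proof -
    interpret module K "N i" by (rule N) fact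
    show ?thesis using assms that by (auto simp: PiE_iff)
  qed
  ultimately show ?thesis by (simp cong: conj_cong)
qed

lemma direct_sum_smult_closed:
  assumes "c \<in> carrier K" "u \<in> carrier DS"
  shows "c \<odot>\<^bsub>DS\<^esub> u \<in> carrier DS"
proof -
  have "finite {i \<in> I. c \<odot>\<^bsub>N i\<^esub> u i \<noteq> \<zero>\<^bsub>N i\<^esub>}"
  proof (rule finite_subset)
    show "{i \<in> I. c \<odot>\<^bsub>N i\<^esub> u i \<noteq> \<zero>\<^bsub>N i\<^esub>} \<subseteq> {i \<in> I. u i \<noteq> \<zero>\<^bsub>N i\<^esub>}"
    proof safe
      fix i assume i: "i \<in> I" "c \<odot>\<^bsub>N i\<^esub> u i \<noteq> \<zero>\<^bsub>N i\<^esub>" "u i = \<zero>\<^bsub>N i\<^esub>"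
      interpret module K "N i" by (rule N) fact
      show False using i assms by simp
    qed
  qed (use assms in auto)
  moreover have "c \<odot>\<^bsub>N i\<^esub> u i \<in> carrier (N i)" if "i \<in> I" for i
  proof -
    interpret module K "N i" by (rule N) fact
    show ?thesis using assms that by (auto simp: PiE_iff)
  qed
  ultimately show ?thesis by (simp cong: conj_cong)
qed

lemma direct_sum_module: "module K DS"
proof -
  have zero: "\<zero>\<^bsub>DS\<^esub> \<in> carrier DS"
  proof -
    have "\<zero>\<^bsub>N i\<^esub> \<in> carrier (N i)" if "i \<in> I" for i
    proof -
      interpret module K "N i" by (rule N) fact
      show ?thesis by simp
    qed
    then show ?thesis by (simp cong: conj_cong)
  qed
  show ?thesis
  proof (rule moduleI[OF K abelian_groupI])
    fix u v w assume "u \<in> carrier DS" "v \<in> carrier DS"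
      "w \<in> carrier DS"
    then have c: "u i \<in> carrier (N i)" "v i \<in> carrier (N i)" "w i \<in> carrier (N i)" if "i \<in> I" for i
      using that by auto
    show "u \<oplus>\<^bsub>DS\<^esub> v \<oplus>\<^bsub>DS\<^esub> w =
        u \<oplus>\<^bsub>DS\<^esub> (v \<oplus>\<^bsub>DS\<^esub> w)"
      using c by (auto simp: restrict_def fun_eq_iff abelian_monoid.a_assoc[OF
            abelian_group.axioms(1)[OF module.axioms(2)[OF N]]])
  next
    fix u v assume "u \<in> carrier DS" "v \<in> carrier DS"
    then have c: "u i \<in> carrier (N i)" "v i \<in> carrier (N i)" if "i \<in> I" for i
      using that by auto
    show "u \<oplus>\<^bsub>DS\<^esub> v = v \<oplus>\<^bsub>DS\<^esub> u"
      using c by (auto simp: restrict_def fun_eq_iff abelian_monoid.a_comm[OF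
            abelian_group.axioms(1)[OF module.axioms(2)[OF N]]])
  next
    fix u assume u: "u \<in> carrier DS"
    show "\<zero>\<^bsub>DS\<^esub> \<oplus>\<^bsub>DS\<^esub> u = u"
    proof (rule ext)
      fix i show "(\<zero>\<^bsub>DS\<^esub> \<oplus>\<^bsub>DS\<^esub> u) i = u i"
        using u N[of i] by (cases "i \<in> I") (auto simp: PiE_iff extensional_def
            abelian_monoid.l_zero[OF abelian_group.axioms(1)[OF module.axioms(2)]])
    qed
    have "(\<ominus>\<^bsub>K\<^esub> \<one>\<^bsub>K\<^esub>) \<odot>\<^bsub>DS\<^esub> u \<oplus>\<^bsub>DS\<^esub> u = \<zero>\<^bsub>DS\<^esub>"
    proof (rule ext)
      fix i show "((\<ominus>\<^bsub>K\<^esub> \<one>\<^bsub>K\<^esub>) \<odot>\<^bsub>DS\<^esub> u \<oplus>\<^bsub>DS\<^esub> u) i = \<zero>\<^bsub>DS\<^esub> i"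
      proof (cases "i \<in> I")
        case True
        interpret module K "N i" by (rule N) fact
        have "u i \<in> carrier (N i)" using u True by auto
        then show ?thesis using True by (simp add: smult_l_minus M.l_neg)
      qed simp
    qed
    moreover have "(\<ominus>\<^bsub>K\<^esub> \<one>\<^bsub>K\<^esub>) \<odot>\<^bsub>DS\<^esub> u \<in> carrier DS"
    proof -
      interpret cring K by (rule K)
      show ?thesis by (rule direct_sum_smult_closed) (use u in auto)
    qed
    ultimately show "\<exists>y\<in>carrier DS. y \<oplus>\<^bsub>DS\<^esub> u = \<zero>\<^bsub>DS\<^esub>"
      by blast
    show "\<one>\<^bsub>K\<^esub> \<odot>\<^bsub>DS\<^esub> u = u"
    proof (rule ext)
      fix i show "(\<one>\<^bsub>K\<^esub> \<odot>\<^bsub>DS\<^esub> u) i = u i"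
        using u N[of i] by (cases "i \<in> I") (auto simp: PiE_iff extensional_def module.smult_one)
    qed
  next
    fix a b u assume ab: "a \<in> carrier K" "b \<in> carrier K" and "u \<in> carrier DS"
    then have c: "u i \<in> carrier (N i)" if "i \<in> I" for i
      using that by auto
    show "(a \<oplus>\<^bsub>K\<^esub> b) \<odot>\<^bsub>DS\<^esub> u =
        a \<odot>\<^bsub>DS\<^esub> u \<oplus>\<^bsub>DS\<^esub> b \<odot>\<^bsub>DS\<^esub> u"
      using ab c by (auto simp: restrict_def fun_eq_iff module.smult_l_distr[OF N])
    show "(a \<otimes>\<^bsub>K\<^esub> b) \<odot>\<^bsub>DS\<^esub> u = a \<odot>\<^bsub>DS\<^esub> (b \<odot>\<^bsub>DS\<^esub> u)"
      using ab c by (auto simp: restrict_def fun_eq_iff module.smult_assoc1[OF N])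
  next
    fix a u v assume ab: "a \<in> carrier K" and "u \<in> carrier DS"
      "v \<in> carrier DS"
    then have c: "u i \<in> carrier (N i)" "v i \<in> carrier (N i)" if "i \<in> I" for i
      using that by auto
    show "a \<odot>\<^bsub>DS\<^esub> (u \<oplus>\<^bsub>DS\<^esub> v) =
        a \<odot>\<^bsub>DS\<^esub> u \<oplus>\<^bsub>DS\<^esub> a \<odot>\<^bsub>DS\<^esub> v"
      using ab c by (auto simp: restrict_def fun_eq_iff module.smult_r_distr[OF N])
  qed (use zero direct_sum_add_closed direct_sum_smult_closed in auto)
qed

lemma summand_linear:
  assumes i: "i \<in> I"
  shows "summand I N i \<in> linear_maps K (N i) DS"
proof (rule linear_mapsI)
  interpret Ni: module K "N i" by (rule N) fact
  have z: "\<zero>\<^bsub>N j\<^esub> \<in> carrier (N j)" "\<zero>\<^bsub>N j\<^esub> \<oplus>\<^bsub>N j\<^esub> \<zero>\<^bsub>N j\<^esub> = \<zero>\<^bsub>N j\<^esub>"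
    "\<And>c. c \<in> carrier K \<Longrightarrow> c \<odot>\<^bsub>N j\<^esub> \<zero>\<^bsub>N j\<^esub> = \<zero>\<^bsub>N j\<^esub>" if "j \<in> I" for j
  proof -
    interpret module K "N j" by (rule N) fact
    show "\<zero>\<^bsub>N j\<^esub> \<in> carrier (N j)" "\<zero>\<^bsub>N j\<^esub> \<oplus>\<^bsub>N j\<^esub> \<zero>\<^bsub>N j\<^esub> = \<zero>\<^bsub>N j\<^esub>"
      "\<And>c. c \<in> carrier K \<Longrightarrow> c \<odot>\<^bsub>N j\<^esub> \<zero>\<^bsub>N j\<^esub> = \<zero>\<^bsub>N j\<^esub>" by auto
  qed
  fix x assume x: "x \<in> carrier (N i)"
  have "{j \<in> I. summand I N i x j \<noteq> \<zero>\<^bsub>N j\<^esub>} \<subseteq> {i}" by (auto simp: summand_def split: if_splits)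
  then have "finite {j \<in> I. summand I N i x j \<noteq> \<zero>\<^bsub>N j\<^esub>}" by (rule finite_subset) simp
  then show "summand I N i x \<in> carrier DS"
    using x z by (auto simp: summand_def)
  fix y assume y: "y \<in> carrier (N i)"
  show "summand I N i (x \<oplus>\<^bsub>N i\<^esub> y) = summand I N i x \<oplus>\<^bsub>DS\<^esub> summand I N i y"
    using z by (auto simp: summand_def fun_eq_iff)
next
  have z: "\<And>c. c \<in> carrier K \<Longrightarrow> c \<odot>\<^bsub>N j\<^esub> \<zero>\<^bsub>N j\<^esub> = \<zero>\<^bsub>N j\<^esub>" if "j \<in> I" for j
  proof -
    interpret module K "N j" by (rule N) fact
    show "\<And>c. c \<in> carrier K \<Longrightarrow> c \<odot>\<^bsub>N j\<^esub> \<zero>\<^bsub>N j\<^esub> = \<zero>\<^bsub>N j\<^esub>" by auto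
  qed
  fix c x assume "c \<in> carrier K" "x \<in> carrier (N i)"
  then show "summand I N i (c \<odot>\<^bsub>N i\<^esub> x) = c \<odot>\<^bsub>DS\<^esub> summand I N i x"
    using z by (auto simp: summand_def fun_eq_iff)
qed

text \<open>
  Splitting off one component at a time shrinks the finite support until nothing is left.
\<close>

lemma direct_sum_induct:
  assumes u: "u \<in> carrier DS"
    and z: "Q \<zero>\<^bsub>DS\<^esub>"
    and s: "\<And>i m. \<lbrakk>i \<in> I; m \<in> carrier (N i)\<rbrakk> \<Longrightarrow> Q (summand I N i m)"
    and a: "\<And>u v. \<lbrakk>u \<in> carrier DS; v \<in> carrier DS; Q u; Q v\<rbrakk> \<Longrightarrow>
      Q (u \<oplus>\<^bsub>DS\<^esub> v)"
  shows "Q u"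
proof -
  have "finite {i \<in> I. u i \<noteq> \<zero>\<^bsub>N i\<^esub>}" using u by simp
  then obtain J where "finite J" and "{i \<in> I. u i \<noteq> \<zero>\<^bsub>N i\<^esub>} = J" by blast
  then show ?thesis using u
  proof (induction J arbitrary: u rule: finite_induct)
    case empty
    have "u = \<zero>\<^bsub>DS\<^esub>"
      using empty by (auto simp: PiE_iff extensional_def fun_eq_iff)
    then show ?case using z by (simp only:)
  next
    case (insert i J)
    have i: "i \<in> I" using insert.prems(1) by blast
    interpret Ni: module K "N i" by (rule N) fact
    define v where "v = (\<lambda>j. if j = i then \<zero>\<^bsub>N i\<^esub> else u j)"
    have sv: "{j \<in> I. v j \<noteq> \<zero>\<^bsub>N j\<^esub>} = J"
      using insert.prems(1) insert.hyps(2) by (auto simp: v_def split: if_splits)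
    have vc: "v \<in> carrier DS"
      using insert.prems(2) sv insert.hyps(1) i by (auto simp: v_def PiE_iff extensional_def)
    have uc: "u j \<in> carrier (N j)" if "j \<in> I" for j
      using insert.prems(2) that by auto
    have "u = summand I N i (u i) \<oplus>\<^bsub>DS\<^esub> v"
    proof (rule ext)
      fix j show "u j = (summand I N i (u i) \<oplus>\<^bsub>DS\<^esub> v) j"
      proof (cases "j \<in> I")
        case True
        interpret Nj: module K "N j" by (rule N) fact
        show ?thesis using True uc[OF True] by (auto simp: summand_def v_def)
      next
        case False
        then show ?thesis using insert.prems(2) by (auto simp: PiE_iff extensional_def)
      qed
    qed
    moreover have "Q (summand I N i (u i) \<oplus>\<^bsub>DS\<^esub> v)"
      by (intro a s insert.IH sv vc i uc linear_maps_closed[OF summand_linear])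
    ultimately show ?case by simp
  qed
qed

lemma direct_sum_generates:
  assumes S: "\<And>i. i \<in> I \<Longrightarrow> generates K (N i) (S i)"
  shows "generates K DS (\<Union>i\<in>I. summand I N i ` S i)"
  unfolding generates_def
proof (intro conjI allI impI subsetI)
  show "x \<in> carrier DS" if "x \<in> (\<Union>i\<in>I. summand I N i ` S i)" for x
    using that generates_closed[OF S] linear_maps_closed[OF summand_linear] by blast
  fix H u assume H: "submodule H K DS \<and> (\<Union>i\<in>I. summand I N i ` S i) \<subseteq> H"
    and u: "u \<in> carrier DS"
  interpret D: module K DS by (rule direct_sum_module)
  show "u \<in> H"
  proof (rule direct_sum_induct[OF u])
    show "\<zero>\<^bsub>DS\<^esub> \<in> H"
      using subgroup.one_closed[OF submodule.axioms(1)[OF conjunct1[OF H]]] by simp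
    fix i m assume i: "i \<in> I" and m: "m \<in> carrier (N i)"
    have "S i \<subseteq> {m \<in> carrier (N i). summand I N i m \<in> H}"
      using H i generates_closed[OF S[OF i]] by auto
    then have "carrier (N i) \<subseteq> {m \<in> carrier (N i). summand I N i m \<in> H}"
      using H by (intro generatesD[OF S[OF i]] linear_preimage_submodule[OF N[OF i] direct_sum_module
            summand_linear[OF i]]) auto
    then show "summand I N i m \<in> H" using m by blast
  qed (use D.submoduleE(5)[of H] H in blast)
qed

text \<open>
  The existence half of the universal property of the direct sum.  The lift is written as a sum
  over the support because linear extensions, the operator and the product of decorated forests
  all have this form.
\<close>

lemma direct_sum_lift:
  assumes B: "module K B" and h: "\<And>i. i \<in> I \<Longrightarrow> h i \<in> linear_maps K (N i) B"
  shows "(\<lambda>u. \<Oplus>\<^bsub>B\<^esub>i\<in>{i \<in> I. u i \<noteq> \<zero>\<^bsub>N i\<^esub>}. h i (u i)) \<in> linear_maps K DS B"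
proof -
  interpret B: module K B by fact
  let ?l = "\<lambda>u. \<Oplus>\<^bsub>B\<^esub>i\<in>{i \<in> I. u i \<noteq> \<zero>\<^bsub>N i\<^esub>}. h i (u i)"
  have hc: "h i (u i) \<in> carrier B" if "i \<in> I" "u \<in> carrier DS" for i u
    using that by (intro linear_maps_closed[OF h]) auto
  \<comment> \<open>The supports of two families and of their sum differ, so sums over the support are compared
    over a common finite index set; the additional terms vanish.\<close>
  have enlarge: "?l u = (\<Oplus>\<^bsub>B\<^esub>i\<in>J. h i (u i))"
    if u: "u \<in> carrier DS" and J: "finite J" "J \<subseteq> I" "{i \<in> I. u i \<noteq> \<zero>\<^bsub>N i\<^esub>} \<subseteq> J" for u J
  proof (rule B.add.finprod_mono_neutral_cong_left)
    fix i assume "i \<in> J - {i \<in> I. u i \<noteq> \<zero>\<^bsub>N i\<^esub>}"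
    then have i: "i \<in> I" "u i = \<zero>\<^bsub>N i\<^esub>" using J by auto
    then show "h i (u i) = \<zero>\<^bsub>B\<^esub>" using linear_maps_zero[OF N B h] by simp
  qed (use J hc u in auto)
  have supp: "finite {i \<in> I. u i \<noteq> \<zero>\<^bsub>N i\<^esub>}" if "u \<in> carrier DS" for u
    using that by simp
  show ?thesis
  proof (rule linear_mapsI)
    fix u assume "u \<in> carrier DS"
    then show "?l u \<in> carrier B" by (intro B.finsum_closed) (auto intro!: hc simp del: direct_sum_simps)
  next
    fix u v assume u: "u \<in> carrier DS" and v: "v \<in> carrier DS"
    let ?w = "u \<oplus>\<^bsub>DS\<^esub> v"
    define J where "J = {i \<in> I. u i \<noteq> \<zero>\<^bsub>N i\<^esub>} \<union> {i \<in> I. v i \<noteq> \<zero>\<^bsub>N i\<^esub>} \<union> {i \<in> I. ?w i \<noteq> \<zero>\<^bsub>N i\<^esub>}"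
    have J_sub: "{i \<in> I. u i \<noteq> \<zero>\<^bsub>N i\<^esub>} \<subseteq> J" "{i \<in> I. v i \<noteq> \<zero>\<^bsub>N i\<^esub>} \<subseteq> J"
      unfolding J_def by blast+
    have w: "?w \<in> carrier DS" by (rule direct_sum_add_closed) fact+
    have J: "finite J" "J \<subseteq> I" using supp[OF u] supp[OF v] supp[OF w] by (auto simp: J_def)
    have "?l ?w = (\<Oplus>\<^bsub>B\<^esub>i\<in>J. h i (?w i))"
      by (rule enlarge[OF w J]) (auto simp: J_def)
    also have "\<dots> = (\<Oplus>\<^bsub>B\<^esub>i\<in>J. h i (u i) \<oplus>\<^bsub>B\<^esub> h i (v i))"
    proof (rule B.finsum_cong')
      fix i assume "i \<in> J"
      then have "i \<in> I" using J by auto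
      then show "h i (?w i) = h i (u i) \<oplus>\<^bsub>B\<^esub> h i (v i)"
        using u v by (auto simp: PiE_iff linear_maps_add[OF h])
    qed (use J u v hc in auto)
    also have "\<dots> = (\<Oplus>\<^bsub>B\<^esub>i\<in>J. h i (u i)) \<oplus>\<^bsub>B\<^esub> (\<Oplus>\<^bsub>B\<^esub>i\<in>J. h i (v i))"
      using J u v hc by (intro B.finsum_addf) auto
    also have "\<dots> = ?l u \<oplus>\<^bsub>B\<^esub> ?l v"
      using enlarge[OF u J] enlarge[OF v J] by (simp del: direct_sum_simps add: J_sub)
    finally show "?l ?w = ?l u \<oplus>\<^bsub>B\<^esub> ?l v" .
  next
    fix c u assume c: "c \<in> carrier K" and u: "u \<in> carrier DS"
    let ?w = "c \<odot>\<^bsub>DS\<^esub> u"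
    define J where "J = {i \<in> I. u i \<noteq> \<zero>\<^bsub>N i\<^esub>} \<union> {i \<in> I. ?w i \<noteq> \<zero>\<^bsub>N i\<^esub>}"
    have w: "?w \<in> carrier DS" by (rule direct_sum_smult_closed) fact+
    have J: "finite J" "J \<subseteq> I" using supp[OF u] supp[OF w] by (auto simp: J_def)
    have "?l ?w = (\<Oplus>\<^bsub>B\<^esub>i\<in>J. h i (?w i))"
      by (rule enlarge[OF w J]) (auto simp: J_def)
    also have "\<dots> = (\<Oplus>\<^bsub>B\<^esub>i\<in>J. c \<odot>\<^bsub>B\<^esub> h i (u i))"
    proof (rule B.finsum_cong')
      fix i assume "i \<in> J"
      then have "i \<in> I" using J by auto
      then show "h i (?w i) = c \<odot>\<^bsub>B\<^esub> h i (u i)"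
        using u c by (auto simp: PiE_iff linear_maps_smult[OF h])
    qed (use J u c hc in auto)
    also have "\<dots> = c \<odot>\<^bsub>B\<^esub> (\<Oplus>\<^bsub>B\<^esub>i\<in>J. h i (u i))"
      using J u c hc by (intro B.finsum_smult_ldistr[symmetric]) auto
    also have "\<dots> = c \<odot>\<^bsub>B\<^esub> ?l u"
      using enlarge[OF u J] unfolding J_def by (simp del: direct_sum_simps)
    finally show "?l ?w = c \<odot>\<^bsub>B\<^esub> ?l u" .
  qed
qed

lemma direct_sum_lift_summand:
  assumes B: "module K B" and h: "h i \<in> linear_maps K (N i) B" and i: "i \<in> I" and m: "m \<in> carrier (N i)"
  shows "(\<Oplus>\<^bsub>B\<^esub>j\<in>{j \<in> I. summand I N i m j \<noteq> \<zero>\<^bsub>N j\<^esub>}. h j (summand I N i m j)) = h i m"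
proof -
  interpret B: module K B by fact
  show ?thesis
  proof (cases "m = \<zero>\<^bsub>N i\<^esub>")
    case True
    then have "{j \<in> I. summand I N i m j \<noteq> \<zero>\<^bsub>N j\<^esub>} = {}"
      by (auto simp: summand_def)
    then show ?thesis using True linear_maps_zero[OF N B h] i by (simp only: B.finsum_empty)
  next
    case False
    then have *: "{j \<in> I. summand I N i m j \<noteq> \<zero>\<^bsub>N j\<^esub>} = {i}"
      using i by (auto simp: summand_def split: if_splits)
    show ?thesis
      unfolding * using linear_maps_closed[OF h m] i
      by (simp add: B.finsum_insert summand_def)
  qed
qed

end

section \<open>Free modules and quotients\<close>

lemma ring_module_simps [simp]:
  "carrier (ring_module K) = carrier K" "zero (ring_module K) = \<zero>\<^bsub>K\<^esub>"
  "add (ring_module K) = (\<oplus>\<^bsub>K\<^esub>)" "smult (ring_module K) = (\<otimes>\<^bsub>K\<^esub>)"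
  by (simp_all add: ring_module_def)

lemma ring_module_module:
  assumes "cring K" shows "module K (ring_module K)"
proof -
  interpret cring K by fact
  show ?thesis
    by (rule moduleI[OF assms abelian_groupI])
      (auto simp: a_ac m_ac l_distr r_distr intro!: bexI[of _ "\<ominus>\<^bsub>K\<^esub> x" for x] l_neg)
qed

lemma ring_module_generates:
  assumes "cring K" shows "generates K (ring_module K) {\<one>\<^bsub>K\<^esub>}"
  unfolding generates_def
proof (intro conjI allI impI subsetI)
  interpret cring K by fact
  show "x \<in> carrier (ring_module K)" if "x \<in> {\<one>\<^bsub>K\<^esub>}" for x using that by simp
  fix H x assume "submodule H K (ring_module K) \<and> {\<one>\<^bsub>K\<^esub>} \<subseteq> H" and "x \<in> carrier (ring_module K)"
  then show "x \<in> H" using submodule.smult_closed[of H K "ring_module K" x "\<one>\<^bsub>K\<^esub>"] by simp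
qed

lemma free_module_module:
  assumes "cring K" shows "module K (free_module K S)"
  unfolding free_module_def
  by (rule direct_sum_module[OF assms ring_module_module[OF assms]])

lemma basis_closed:
  assumes "cring K" "s \<in> S" shows "basis K S s \<in> carrier (free_module K S)"
proof -
  interpret cring K by fact
  show ?thesis
    unfolding basis_def free_module_def
    by (rule linear_maps_closed[OF summand_linear[of K]]) (simp_all add: assms ring_module_module)
qed

lemma free_module_generates:
  assumes "cring K" shows "generates K (free_module K S) (basis K S ` S)"
proof -
  have "basis K S ` S = (\<Union>s\<in>S. summand S (\<lambda>_. ring_module K) s ` {\<one>\<^bsub>K\<^esub>})"
    by (auto simp: basis_def)
  then show ?thesis
    unfolding free_module_def
    using direct_sum_generates[of K S "\<lambda>_. ring_module K" "\<lambda>_. {\<one>\<^bsub>K\<^esub>}"]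
    by (simp add: assms ring_module_module ring_module_generates)
qed

lemma smult_linear:
  assumes "module K B" "b \<in> carrier B"
  shows "(\<lambda>c. c \<odot>\<^bsub>B\<^esub> b) \<in> linear_maps K (ring_module K) B"
proof -
  interpret B: module K B by fact
  show ?thesis
    by (rule linear_mapsI) (simp_all add: assms B.smult_l_distr B.smult_assoc1)
qed

lemma linear_extension_linear:
  assumes "module K B" "\<And>s. s \<in> S \<Longrightarrow> \<phi> s \<in> carrier B"
  shows "linear_extension K S B \<phi> \<in> linear_maps K (free_module K S) B"
  using direct_sum_lift[of K S "\<lambda>_. ring_module K" B "\<lambda>s c. c \<odot>\<^bsub>B\<^esub> \<phi> s"] assms
  by (simp add: linear_extension_def [abs_def] free_module_def smult_linear ring_module_module
      module.axioms(1))

lemma linear_extension_basis: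
  assumes "module K B" "\<phi> s \<in> carrier B" "s \<in> S"
  shows "linear_extension K S B \<phi> (basis K S s) = \<phi> s"
proof -
  interpret B: module K B by fact
  show ?thesis
    using direct_sum_lift_summand[of K S "\<lambda>_. ring_module K" B "\<lambda>s c. c \<odot>\<^bsub>B\<^esub> \<phi> s" s "\<one>\<^bsub>K\<^esub>"] assms
    by (simp add: linear_extension_def basis_def smult_linear ring_module_module B.R.is_cring)
qed

context
  fixes K :: "('k, 'c) ring_scheme" and N :: "('k, 'a, 'x) module_scheme" and H
  assumes N: "module K N" and H: "submodule H K N"
begin

interpretation N: module K N by (rule N)

lemma submodule_abelian_subgroup: "abelian_subgroup H N"
  using H by (intro abelian_subgroupI3 additive_subgroupI) (auto simp: submodule_def N.M.abelian_group_axioms)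

interpretation H: abelian_subgroup H N by (rule submodule_abelian_subgroup)

lemma coset_eq_iff:
  assumes "x \<in> carrier N" "y \<in> carrier N"
  shows "H +>\<^bsub>N\<^esub> x = H +>\<^bsub>N\<^esub> y \<longleftrightarrow> y \<ominus>\<^bsub>N\<^esub> x \<in> H"
  unfolding a_minus_def H.a_rcos_module[OF assms, symmetric]
  using H.a_repr_independence'[OF _ assms(1)] H.a_repr_independenceD[OF assms(2)] by blast

lemma quotient_module_simps:
  "carrier (quotient_module N H) = a_rcosets\<^bsub>N\<^esub> H" "zero (quotient_module N H) = H"
  "add (quotient_module N H) = set_add N"
  "smult (quotient_module N H) c X = (\<Union>x\<in>X. H +>\<^bsub>N\<^esub> (c \<odot>\<^bsub>N\<^esub> x))"
  by (simp_all add: quotient_module_def)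

text \<open>
  Scalar multiplication of a coset is defined through all its representatives at once; they all give
  the same coset since a submodule absorbs the multiple of their difference.
\<close>

lemma coset_smult:
  assumes "c \<in> carrier K" "x \<in> carrier N"
  shows "c \<odot>\<^bsub>quotient_module N H\<^esub> (H +>\<^bsub>N\<^esub> x) = H +>\<^bsub>N\<^esub> (c \<odot>\<^bsub>N\<^esub> x)"
proof -
  have "H +>\<^bsub>N\<^esub> (c \<odot>\<^bsub>N\<^esub> y) = H +>\<^bsub>N\<^esub> (c \<odot>\<^bsub>N\<^esub> x)" if y: "y \<in> H +>\<^bsub>N\<^esub> x" for y
  proof -
    have yN: "y \<in> carrier N" by (rule H.a_elemrcos_carrier[OF assms(2) y])
    have "H +>\<^bsub>N\<^esub> y = H +>\<^bsub>N\<^esub> x" using H.a_repr_independence'[OF y assms(2)] ..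
    then have "x \<ominus>\<^bsub>N\<^esub> y \<in> H" using coset_eq_iff yN assms(2) by blast
    then have "c \<odot>\<^bsub>N\<^esub> (x \<ominus>\<^bsub>N\<^esub> y) \<in> H" using N.submoduleE(4)[OF H assms(1)] by blast
    also have "c \<odot>\<^bsub>N\<^esub> (x \<ominus>\<^bsub>N\<^esub> y) = c \<odot>\<^bsub>N\<^esub> x \<ominus>\<^bsub>N\<^esub> c \<odot>\<^bsub>N\<^esub> y"
      using assms yN by (simp add: a_minus_def N.smult_r_distr N.smult_r_minus)
    finally show ?thesis using coset_eq_iff yN assms by simp
  qed
  moreover have "x \<in> H +>\<^bsub>N\<^esub> x" by (rule H.a_rcos_self) fact
  ultimately show ?thesis unfolding quotient_module_simps by blast
qed

lemma coset_add:
  assumes "x \<in> carrier N" "y \<in> carrier N"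
  shows "(H +>\<^bsub>N\<^esub> x) \<oplus>\<^bsub>quotient_module N H\<^esub> (H +>\<^bsub>N\<^esub> y) = H +>\<^bsub>N\<^esub> (x \<oplus>\<^bsub>N\<^esub> y)"
  unfolding quotient_module_simps by (rule H.a_rcos_sum) fact+

lemma coset_zero: "\<zero>\<^bsub>quotient_module N H\<^esub> = H +>\<^bsub>N\<^esub> \<zero>\<^bsub>N\<^esub>"
  unfolding quotient_module_simps using H.a_rcos_const[of "\<zero>\<^bsub>N\<^esub>"] by simp

lemma coset_cases:
  assumes "X \<in> carrier (quotient_module N H)"
  obtains x where "x \<in> carrier N" "X = H +>\<^bsub>N\<^esub> x"
  using assms unfolding quotient_module_simps A_RCOSETS_def' by auto

lemma coset_closed: "x \<in> carrier N \<Longrightarrow> H +>\<^bsub>N\<^esub> x \<in> carrier (quotient_module N H)"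
  unfolding quotient_module_simps A_RCOSETS_def' by auto

lemma quotient_module_module: "module K (quotient_module N H)"
proof (rule moduleI[OF _ abelian_groupI])
  show "cring K" by (rule N.R.is_cring)
  fix X assume "X \<in> carrier (quotient_module N H)"
  then obtain x where x: "x \<in> carrier N" "X = H +>\<^bsub>N\<^esub> x" by (rule coset_cases)
  have "(H +>\<^bsub>N\<^esub> \<ominus>\<^bsub>N\<^esub> x) \<oplus>\<^bsub>quotient_module N H\<^esub> X = \<zero>\<^bsub>quotient_module N H\<^esub>"
    using x by (simp add: coset_add coset_zero N.M.l_neg)
  then show "\<exists>y\<in>carrier (quotient_module N H). y \<oplus>\<^bsub>quotient_module N H\<^esub> X = \<zero>\<^bsub>quotient_module N H\<^esub>"
    using x coset_closed by blast
qed (auto elim!: coset_cases simp: coset_add coset_zero coset_smult coset_closed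
      N.smult_l_distr N.smult_r_distr N.smult_assoc1 N.M.a_ac)

lemma coset_linear: "(\<lambda>x. H +>\<^bsub>N\<^esub> x) \<in> linear_maps K N (quotient_module N H)"
  by (rule linear_mapsI) (auto simp: coset_add coset_smult coset_closed)

lemma quotient_generates:
  "generates K N S \<Longrightarrow> generates K (quotient_module N H) ((\<lambda>x. H +>\<^bsub>N\<^esub> x) ` S)"
  by (rule generates_image[OF N _ quotient_module_module coset_linear]) (auto elim: coset_cases)

lemma quotient_lift:
  assumes B: "module K B" and h: "h \<in> linear_maps K N B" and null: "\<And>x. x \<in> H \<Longrightarrow> h x = \<zero>\<^bsub>B\<^esub>"
  shows "\<exists>g\<in>linear_maps K (quotient_module N H) B. \<forall>x\<in>carrier N. g (H +>\<^bsub>N\<^esub> x) = h x"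
proof -
  interpret B: module K B by fact
  define g where "g X = h (SOME x. x \<in> X)" for X
  have g: "g (H +>\<^bsub>N\<^esub> x) = h x" if x: "x \<in> carrier N" for x
  proof -
    define y where "y = (SOME y. y \<in> H +>\<^bsub>N\<^esub> x)"
    have y: "y \<in> H +>\<^bsub>N\<^esub> x"
      unfolding y_def by (rule someI, rule H.a_rcos_self) fact
    have yN: "y \<in> carrier N" by (rule H.a_elemrcos_carrier[OF x y])
    have "y \<ominus>\<^bsub>N\<^esub> x \<in> H"
      using H.a_repr_independence'[OF y x] coset_eq_iff[OF x yN] by blast
    then have "h y \<ominus>\<^bsub>B\<^esub> h x = \<zero>\<^bsub>B\<^esub>"
      using null linear_maps_minus[OF N B h yN x] by simp
    then have "h y = h x"
      using linear_maps_closed[OF h] x yN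
      by (metis B.M.a_inv_closed B.M.minus_equality B.M.minus_minus a_minus_def)
    then show ?thesis by (simp add: g_def y_def)
  qed
  have "g \<in> linear_maps K (quotient_module N H) B"
    by (rule linear_mapsI) (auto elim!: coset_cases simp: coset_add coset_smult g
        linear_maps_closed[OF h] linear_maps_add[OF h] linear_maps_smult[OF h])
  then show ?thesis using g by blast
qed

end

lemma submodule_zero: "module K B \<Longrightarrow> submodule {\<zero>\<^bsub>B\<^esub>} K B"
proof -
  assume "module K B"
  then interpret module K B .
  show ?thesis by (rule submoduleI) auto
qed

section \<open>Tensor powers\<close>

definition multilinear_maps ::
    "('k, 'c) ring_scheme \<Rightarrow> ('k, 'm, 'x) module_scheme \<Rightarrow> nat \<Rightarrow> ('k, 'b, 'y) module_scheme \<Rightarrow>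
      ('m list \<Rightarrow> 'b) set"
  where "multilinear_maps K M n B =
    {\<phi>. (\<forall>xs\<in>tuples M n. \<phi> xs \<in> carrier B) \<and>
      (\<forall>xs ys. set xs \<subseteq> carrier M \<and> set ys \<subseteq> carrier M \<and> length xs + 1 + length ys = n \<longrightarrow>
        (\<lambda>a. \<phi> (xs @ [a] @ ys)) \<in> linear_maps K M B)}"

context
  fixes K :: "('k, 'c) ring_scheme" and M :: "('k, 'm, 'd) module_scheme"
  assumes M: "module K M"
begin

interpretation M: module K M by (rule M)

lemma multilinear_maps_slot:
  "\<lbrakk>\<phi> \<in> multilinear_maps K M n B; set xs \<subseteq> carrier M; set ys \<subseteq> carrier M; length xs + 1 + length ys = n\<rbrakk> \<Longrightarrow>
    (\<lambda>a. \<phi> (xs @ [a] @ ys)) \<in> linear_maps K M B"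
  by (simp add: multilinear_maps_def)

lemma multilinear_maps_cong:
  assumes "\<phi> \<in> multilinear_maps K M n B" "\<And>xs. xs \<in> tuples M n \<Longrightarrow> \<psi> xs = \<phi> xs"
  shows "\<psi> \<in> multilinear_maps K M n B"
  unfolding multilinear_maps_def
proof (intro CollectI conjI ballI allI impI)
  fix xs ys assume *: "set xs \<subseteq> carrier M \<and> set ys \<subseteq> carrier M \<and> length xs + 1 + length ys = n"
  show "(\<lambda>a. \<psi> (xs @ [a] @ ys)) \<in> linear_maps K M B"
    by (rule linear_maps_cong[OF M multilinear_maps_slot[OF assms(1)] assms(2)])
      (use * in \<open>auto simp: tuples_def\<close>)
qed (use assms in \<open>simp add: multilinear_maps_def\<close>)

lemma multilinear_maps_surround:
  assumes "\<phi> \<in> multilinear_maps K M n B" "n = length us + p + length vs"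
    and "set us \<subseteq> carrier M" "set vs \<subseteq> carrier M"
  shows "(\<lambda>xs. \<phi> (us @ xs @ vs)) \<in> multilinear_maps K M p B"
  unfolding multilinear_maps_def
proof (intro CollectI conjI ballI allI impI)
  fix xs assume "xs \<in> tuples M p"
  then show "\<phi> (us @ xs @ vs) \<in> carrier B"
    using assms by (auto simp: multilinear_maps_def tuples_def)
next
  fix xs ys assume "set xs \<subseteq> carrier M \<and> set ys \<subseteq> carrier M \<and> length xs + 1 + length ys = p"
  then show "(\<lambda>a. \<phi> (us @ (xs @ [a] @ ys) @ vs)) \<in> linear_maps K M B"
    using multilinear_maps_slot[OF assms(1), of "us @ xs" "ys @ vs"] assms(2-4) by simp
qed

abbreviation (input) "FT n \<equiv> free_module K (tuples M n)"

abbreviation (input) "FB n \<equiv> basis K (tuples M n)"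
abbreviation (input) "FN n \<equiv> tensor_null K M n"

lemma FT_module: "module K (FT n)"
  by (rule free_module_module) (rule M.R.is_cring)

lemma tuple_basis_closed: "xs \<in> tuples M n \<Longrightarrow> FB n xs \<in> carrier (FT n)"
  by (rule basis_closed) (rule M.R.is_cring)

lemma relations_closed: "multilinearity_relations K M n \<subseteq> carrier (FT n)"
proof -
  interpret FT: module K "FT n" by (rule FT_module)
  have t: "FB n (xs @ [a] @ ys) \<in> carrier (FT n)"
    if "set xs \<subseteq> carrier M" "a \<in> carrier M" "set ys \<subseteq> carrier M" "length xs + 1 + length ys = n" for xs a ys
    using that by (intro tuple_basis_closed) (simp add: tuples_def)
  show ?thesis
  proof
    fix r assume "r \<in> multilinearity_relations K M n"
    then show "r \<in> carrier (FT n)"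
      unfolding multilinearity_relations_def Let_def
    proof (elim UnE CollectE exE conjE)
      fix xs a b ys
      assume *: "set xs \<subseteq> carrier M" "a \<in> carrier M" "b \<in> carrier M" "set ys \<subseteq> carrier M"
        "length xs + 1 + length ys = n"
      assume r: "r = FB n (xs @ [a \<oplus>\<^bsub>M\<^esub> b] @ ys) \<ominus>\<^bsub>FT n\<^esub>
        (FB n (xs @ [a] @ ys) \<oplus>\<^bsub>FT n\<^esub> FB n (xs @ [b] @ ys))"
      show ?thesis
        unfolding r by (intro FT.M.minus_closed FT.M.a_closed t M.M.a_closed *)
    next
      fix xs a c ys
      assume *: "set xs \<subseteq> carrier M" "c \<in> carrier K" "a \<in> carrier M" "set ys \<subseteq> carrier M"
        "length xs + 1 + length ys = n"
      assume r: "r = FB n (xs @ [c \<odot>\<^bsub>M\<^esub> a] @ ys) \<ominus>\<^bsub>FT n\<^esub>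
        c \<odot>\<^bsub>FT n\<^esub> FB n (xs @ [a] @ ys)"
      show ?thesis
        unfolding r by (intro FT.M.minus_closed FT.smult_closed t M.smult_closed *)
    qed
  qed
qed

lemma tensor_null_submodule: "submodule (FN n) K (FT n)"
proof -
  interpret FT: module K "FT n" by (rule FT_module)
  let ?\<H> = "{H. submodule H K (FT n) \<and> multilinearity_relations K M n \<subseteq> H}"
  have c: "carrier (FT n) \<in> ?\<H>"
    using FT.carrier_is_submodule relations_closed by blast
  show ?thesis
    unfolding tensor_null_def submodule_span_def
  proof (rule FT.submoduleI)
    show "\<Inter>?\<H> \<subseteq> carrier (FT n)" using c by blast
    show "\<zero>\<^bsub>FT n\<^esub> \<in> \<Inter>?\<H>"
      using subgroup.one_closed[OF submodule.axioms(1)] by fastforce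
  qed (use FT.submoduleE(3,4,5) in blast)+
qed

lemma tensor_null_least:
  "\<lbrakk>submodule H K (FT n); multilinearity_relations K M n \<subseteq> H\<rbrakk> \<Longrightarrow> FN n \<subseteq> H"
  unfolding tensor_null_def submodule_span_def by blast

lemma relations_in_null: "multilinearity_relations K M n \<subseteq> FN n"
  unfolding tensor_null_def submodule_span_def by blast

lemma relation_add_in_null:
  assumes "set xs \<subseteq> carrier M" "a \<in> carrier M" "b \<in> carrier M" "set ys \<subseteq> carrier M"
    "length xs + 1 + length ys = n"
  shows "FB n (xs @ [a \<oplus>\<^bsub>M\<^esub> b] @ ys) \<ominus>\<^bsub>FT n\<^esub>
    (FB n (xs @ [a] @ ys) \<oplus>\<^bsub>FT n\<^esub> FB n (xs @ [b] @ ys))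
    \<in> FN n"
  by (rule subsetD[OF relations_in_null], unfold multilinearity_relations_def Let_def,
      rule UnI1, rule CollectI, rule exI[of _ xs], rule exI[of _ a], rule exI[of _ b], rule exI[of _ ys])
    (intro conjI refl assms)

lemma relation_smult_in_null:
  assumes "set xs \<subseteq> carrier M" "c \<in> carrier K" "a \<in> carrier M" "set ys \<subseteq> carrier M"
    "length xs + 1 + length ys = n"
  shows "FB n (xs @ [c \<odot>\<^bsub>M\<^esub> a] @ ys) \<ominus>\<^bsub>FT n\<^esub>
    c \<odot>\<^bsub>FT n\<^esub> FB n (xs @ [a] @ ys) \<in> FN n"
  by (rule subsetD[OF relations_in_null], unfold multilinearity_relations_def Let_def,
      rule UnI2, rule CollectI, rule exI[of _ xs], rule exI[of _ c], rule exI[of _ a], rule exI[of _ ys])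
    (intro conjI refl assms)

text \<open>
  A linear map that is multilinear on the basis kills the multilinearity relations, hence the
  submodule that they span.
\<close>

lemma linear_maps_null:
  assumes B: "module K B" and h: "h \<in> linear_maps K (FT n) B"
    and ml: "(\<lambda>xs. h (FB n xs)) \<in> multilinear_maps K M n B" and x: "x \<in> FN n"
  shows "h x = \<zero>\<^bsub>B\<^esub>"
proof -
  interpret B: module K B by (rule B)
  interpret FT: module K "FT n" by (rule FT_module)
  have "multilinearity_relations K M n \<subseteq> {x \<in> carrier (FT n). h x \<in> {\<zero>\<^bsub>B\<^esub>}}"
  proof
    fix r assume r: "r \<in> multilinearity_relations K M n"
    then have rc: "r \<in> carrier (FT n)" using relations_closed by blast
    have "h r = \<zero>\<^bsub>B\<^esub>"
      using r unfolding multilinearity_relations_def Let_def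
    proof (elim UnE CollectE exE conjE)
      fix xs a b ys
      assume ab: "a \<in> carrier M" "b \<in> carrier M" and *: "set xs \<subseteq> carrier M" "set ys \<subseteq> carrier M"
        "length xs + 1 + length ys = n"
      assume r: "r = FB n (xs @ [a \<oplus>\<^bsub>M\<^esub> b] @ ys) \<ominus>\<^bsub>FT n\<^esub> (FB n (xs @ [a] @ ys) \<oplus>\<^bsub>FT n\<^esub> FB n (xs @ [b] @ ys))"
      have bc: "FB n (xs @ [c] @ ys) \<in> carrier (FT n)" if "c \<in> carrier M" for c
        using that * by (intro tuple_basis_closed) (auto simp: tuples_def)
      have "h (FB n (xs @ [a \<oplus>\<^bsub>M\<^esub> b] @ ys)) = h (FB n (xs @ [a] @ ys) \<oplus>\<^bsub>FT n\<^esub> FB n (xs @ [b] @ ys))"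
        unfolding linear_maps_add[OF h bc bc, OF ab]
        by (rule linear_maps_add[OF multilinear_maps_slot[OF ml *] ab])
      then show ?thesis
        unfolding r using bc ab linear_maps_closed[OF h FT.a_closed[OF bc bc, OF ab]]
        by (subst linear_maps_minus[OF FT_module B h]) (auto simp: a_minus_def B.M.r_neg)
    next
      fix xs a c ys
      assume ca: "c \<in> carrier K" "a \<in> carrier M" and *: "set xs \<subseteq> carrier M" "set ys \<subseteq> carrier M"
        "length xs + 1 + length ys = n"
      assume r: "r = FB n (xs @ [c \<odot>\<^bsub>M\<^esub> a] @ ys) \<ominus>\<^bsub>FT n\<^esub> c \<odot>\<^bsub>FT n\<^esub> FB n (xs @ [a] @ ys)"
      have bc: "FB n (xs @ [c] @ ys) \<in> carrier (FT n)" if "c \<in> carrier M" for c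
        using that * by (intro tuple_basis_closed) (auto simp: tuples_def)
      have "h (FB n (xs @ [c \<odot>\<^bsub>M\<^esub> a] @ ys)) = h (c \<odot>\<^bsub>FT n\<^esub> FB n (xs @ [a] @ ys))"
        unfolding linear_maps_smult[OF h ca(1) bc[OF ca(2)]]
        by (rule linear_maps_smult[OF multilinear_maps_slot[OF ml *] ca])
      then show ?thesis
        unfolding r using bc ca linear_maps_closed[OF h FT.smult_closed[OF ca(1) bc[OF ca(2)]]]
        by (subst linear_maps_minus[OF FT_module B h]) (auto simp: a_minus_def B.M.r_neg)
    qed
    then show "r \<in> {x \<in> carrier (FT n). h x \<in> {\<zero>\<^bsub>B\<^esub>}}" using rc by simp
  qed
  then show ?thesis
    using tensor_null_least[OF linear_preimage_submodule[OF FT_module B h submodule_zero[OF B]]] x by blast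
qed

lemma tensor_power_module: "module K (tensor_power K M n)"
  unfolding tensor_power_def by (rule quotient_module_module[OF FT_module tensor_null_submodule])

lemma pure_tensor_eq:
  "xs \<in> tuples M n \<Longrightarrow> pure_tensor K M xs = FN n +>\<^bsub>FT n\<^esub> FB n xs"
  by (simp add: pure_tensor_def tuples_def)

lemma pure_tensor_closed: "xs \<in> tuples M n \<Longrightarrow> pure_tensor K M xs \<in> carrier (tensor_power K M n)"
  unfolding pure_tensor_eq tensor_power_def
  by (intro coset_closed[OF FT_module tensor_null_submodule] tuple_basis_closed)

lemma tensor_power_generates: "generates K (tensor_power K M n) (pure_tensor K M ` tuples M n)"
proof -
  have "pure_tensor K M ` tuples M n =
      (\<lambda>x. FN n +>\<^bsub>FT n\<^esub> x) ` FB n ` tuples M n"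
    by (auto simp: pure_tensor_eq image_image)
  then show ?thesis
    unfolding tensor_power_def
    using quotient_generates[OF FT_module tensor_null_submodule free_module_generates[OF M.R.is_cring]]
    by simp
qed

lemma pure_tensor_multilinear:
  "pure_tensor K M \<in> multilinear_maps K M n (tensor_power K M n)"
  unfolding multilinear_maps_def
proof (intro CollectI conjI ballI allI impI)
  fix xs assume "xs \<in> tuples M n"
  then show "pure_tensor K M xs \<in> carrier (tensor_power K M n)" by (rule pure_tensor_closed)
next
  fix xs ys assume *: "set xs \<subseteq> carrier M \<and> set ys \<subseteq> carrier M \<and> length xs + 1 + length ys = n"
  interpret FT: module K "FT n" by (rule FT_module)
  let ?H = "FN n" and ?e = "FB n"
  note co = FT_module[of n] tensor_null_submodule[of n]
  have t: "xs @ [a] @ ys \<in> tuples M n" if "a \<in> carrier M" for a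
    using that * by (auto simp: tuples_def)
  note bc = tuple_basis_closed[OF t]
  show "(\<lambda>a. pure_tensor K M (xs @ [a] @ ys)) \<in> linear_maps K M (tensor_power K M n)"
  proof (rule linear_mapsI)
    fix a b assume ab: "a \<in> carrier M" "b \<in> carrier M"
    have "?e (xs @ [a \<oplus>\<^bsub>M\<^esub> b] @ ys) \<ominus>\<^bsub>FT n\<^esub> (?e (xs @ [a] @ ys) \<oplus>\<^bsub>FT n\<^esub> ?e (xs @ [b] @ ys)) \<in> ?H"
      using ab * by (intro relation_add_in_null) auto
    then have "?H +>\<^bsub>FT n\<^esub> (?e (xs @ [a] @ ys) \<oplus>\<^bsub>FT n\<^esub> ?e (xs @ [b] @ ys)) =
        ?H +>\<^bsub>FT n\<^esub> ?e (xs @ [a \<oplus>\<^bsub>M\<^esub> b] @ ys)"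
      using coset_eq_iff[OF co FT.a_closed[OF bc[OF ab(1)] bc[OF ab(2)]] bc[OF M.a_closed[OF ab]]]
      by blast
    then show "pure_tensor K M (xs @ [a \<oplus>\<^bsub>M\<^esub> b] @ ys) =
        pure_tensor K M (xs @ [a] @ ys) \<oplus>\<^bsub>tensor_power K M n\<^esub> pure_tensor K M (xs @ [b] @ ys)"
      unfolding pure_tensor_eq[OF t[OF ab(1)]] pure_tensor_eq[OF t[OF ab(2)]]
        pure_tensor_eq[OF t[OF M.a_closed[OF ab]]] tensor_power_def
        coset_add[OF co bc[OF ab(1)] bc[OF ab(2)]] by simp
  next
    fix c a assume ca: "c \<in> carrier K" "a \<in> carrier M"
    have "?e (xs @ [c \<odot>\<^bsub>M\<^esub> a] @ ys) \<ominus>\<^bsub>FT n\<^esub> c \<odot>\<^bsub>FT n\<^esub> ?e (xs @ [a] @ ys) \<in> ?H"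
      using ca * by (intro relation_smult_in_null) auto
    then have "?H +>\<^bsub>FT n\<^esub> (c \<odot>\<^bsub>FT n\<^esub> ?e (xs @ [a] @ ys)) = ?H +>\<^bsub>FT n\<^esub> ?e (xs @ [c \<odot>\<^bsub>M\<^esub> a] @ ys)"
      using coset_eq_iff[OF co] bc ca by blast
    then show "pure_tensor K M (xs @ [c \<odot>\<^bsub>M\<^esub> a] @ ys) =
        c \<odot>\<^bsub>tensor_power K M n\<^esub> pure_tensor K M (xs @ [a] @ ys)"
      unfolding pure_tensor_eq[OF t[OF ca(2)]]
        pure_tensor_eq[OF t[OF M.smult_closed[OF ca]]] tensor_power_def
        coset_smult[OF co ca(1) bc[OF ca(2)]] by simp
  qed (rule pure_tensor_closed[OF t])
qed

text \<open>
  The existence half of the universal property of the tensor power.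
\<close>

lemma tensor_power_lift:
  assumes B: "module K B" and \<phi>: "\<phi> \<in> multilinear_maps K M n B"
  shows "\<exists>h\<in>linear_maps K (tensor_power K M n) B. \<forall>xs\<in>tuples M n. h (pure_tensor K M xs) = \<phi> xs"
proof -
  let ?h = "linear_extension K (tuples M n) B \<phi>"
  have \<phi>c: "\<phi> xs \<in> carrier B" if "xs \<in> tuples M n" for xs
    using \<phi> that by (simp add: multilinear_maps_def)
  have h: "?h \<in> linear_maps K (FT n) B" by (rule linear_extension_linear[OF B \<phi>c])
  have hb: "?h (FB n xs) = \<phi> xs" if "xs \<in> tuples M n" for xs
    by (intro linear_extension_basis B \<phi>c that)
  obtain g where "g \<in> linear_maps K (tensor_power K M n) B"
    and g: "\<forall>x\<in>carrier (FT n). g (FN n +>\<^bsub>FT n\<^esub> x) = ?h x"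
    using quotient_lift[OF FT_module tensor_null_submodule B h
        linear_maps_null[OF B h multilinear_maps_cong[OF \<phi> hb]]]
    unfolding tensor_power_def by auto
  moreover have "g (pure_tensor K M xs) = \<phi> xs" if "xs \<in> tuples M n" for xs
    using that g by (simp add: pure_tensor_eq tuple_basis_closed hb)
  ultimately show ?thesis by blast
qed

section \<open>The product of the tensor algebra\<close>

lemma append_tuples: "\<lbrakk>xs \<in> tuples M p; ys \<in> tuples M q\<rbrakk> \<Longrightarrow> xs @ ys \<in> tuples M (p + q)"
  by (auto simp: tuples_def)

lemma concat_ext_left_linear:
  assumes "y \<in> carrier (FT q)"
  shows "(\<lambda>x. concat_ext K M p q x y) \<in> linear_maps K (FT p) (FT (p + q))"
  unfolding concat_ext_def Let_def
  by (rule linear_extension_linear[OF FT_module linear_maps_closed[OF linear_extension_linear[OF FT_module] assms]])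
    (rule tuple_basis_closed[OF append_tuples])

lemma concat_ext_right_linear:
  assumes x: "x \<in> carrier (FT p)"
  shows "concat_ext K M p q x \<in> linear_maps K (FT q) (FT (p + q))"
proof -
  have "finite {s \<in> tuples M p. x s \<noteq> \<zero>\<^bsub>K\<^esub>}" "x \<in> tuples M p \<rightarrow> carrier K"
    using x by (auto simp: free_module_def PiE_def)
  then show ?thesis
    unfolding concat_ext_def [abs_def] Let_def linear_extension_def [of K "tuples M p"]
    using tuple_basis_closed[OF append_tuples]
    by (intro linear_maps_finsum[OF FT_module] linear_maps_scale[OF FT_module]
        linear_extension_linear[OF FT_module]) auto
qed

lemma concat_ext_basis:
  assumes "xs \<in> tuples M p" "ys \<in> tuples M q"
  shows "concat_ext K M p q (FB p xs) (FB q ys) =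
    FB (p + q) (xs @ ys)"
proof -
  have *: "linear_extension K (tuples M q) (FT (p + q)) (\<lambda>ys. FB (p + q) (zs @ ys))
      (FB q ys) = FB (p + q) (zs @ ys)" if "zs \<in> tuples M p" for zs
    by (intro linear_extension_basis FT_module tuple_basis_closed append_tuples that assms)
  show ?thesis
    unfolding concat_ext_def Let_def
    by (subst linear_extension_basis[OF FT_module])
      (simp_all add: * assms tuple_basis_closed append_tuples)
qed

text \<open>
  Surrounding tuples by further elements respects the multilinearity relations, since it is
  multilinear modulo the relations in the higher degree.
\<close>

lemma null_surround:
  assumes h: "h \<in> linear_maps K (FT p) (FT n)" and n: "n = length us + p + length vs"
    and us: "set us \<subseteq> carrier M" and vs: "set vs \<subseteq> carrier M"
    and hb: "\<And>xs. xs \<in> tuples M p \<Longrightarrow> h (FB p xs) = FB n (us @ xs @ vs)"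
    and x: "x \<in> FN p"
  shows "h x \<in> FN n"
proof -
  note sub = FT_module tensor_null_submodule
  have xc: "x \<in> carrier (FT p)" using x module.submoduleE(1)[OF sub] by blast
  note hc = linear_maps_closed[OF h xc]
  have "FN n +>\<^bsub>FT n\<^esub> h x = \<zero>\<^bsub>tensor_power K M n\<^esub>"
  proof (rule linear_maps_null[OF tensor_power_module _ _ x])
    show "(\<lambda>x. FN n +>\<^bsub>FT n\<^esub> h x) \<in> linear_maps K (FT p) (tensor_power K M n)"
      unfolding tensor_power_def by (rule linear_maps_compose[OF h coset_linear[OF sub]])
    show "(\<lambda>xs. FN n +>\<^bsub>FT n\<^esub> h (FB p xs)) \<in> multilinear_maps K M p (tensor_power K M n)"
    proof (rule multilinear_maps_cong[OF multilinear_maps_surround[OF pure_tensor_multilinear n us vs]])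
      fix xs assume xs: "xs \<in> tuples M p"
      then have "us @ xs @ vs \<in> tuples M n" using us vs n by (auto simp: tuples_def)
      then show "FN n +>\<^bsub>FT n\<^esub> h (FB p xs) = pure_tensor K M (us @ xs @ vs)"
        by (simp add: hb[OF xs] pure_tensor_eq)
    qed
  qed
  then have "FN n +>\<^bsub>FT n\<^esub> h x = FN n"
    by (simp add: tensor_power_def quotient_module_def)
  then show ?thesis
    using abelian_subgroup.a_rcos_self[OF submodule_abelian_subgroup[OF sub] hc] by blast
qed

lemma concat_ext_null_left:
  assumes x: "x \<in> FN p" and y: "y \<in> carrier (FT q)"
  shows "concat_ext K M p q x y \<in> FN (p + q)"
proof -
  let ?H = "{y \<in> carrier (FT q). concat_ext K M p q x y \<in> FN (p + q)}"
  have "x \<in> carrier (FT p)"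
    using x module.submoduleE(1)[OF FT_module tensor_null_submodule] by blast
  then have "submodule ?H K (FT q)"
    by (rule linear_preimage_submodule[OF FT_module FT_module concat_ext_right_linear
          tensor_null_submodule])
  moreover have "FB q ` tuples M q \<subseteq> ?H"
  proof safe
    fix zs assume zs: "zs \<in> tuples M q"
    show "FB q zs \<in> carrier (FT q)" by (rule tuple_basis_closed[OF zs])
    then show "concat_ext K M p q x (FB q zs) \<in> FN (p + q)"
      by (rule null_surround[OF concat_ext_left_linear, where us = "[]" and vs = zs])
        (use zs x concat_ext_basis in \<open>auto simp: tuples_def\<close>)
  qed
  ultimately show ?thesis
    using free_module_generates[OF M.R.is_cring, of "tuples M q"] y unfolding generates_def by blast
qed

lemma concat_ext_null_right:
  assumes x: "x \<in> carrier (FT p)" and y: "y \<in> FN q"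
  shows "concat_ext K M p q x y \<in> FN (p + q)"
proof -
  let ?H = "{x \<in> carrier (FT p). concat_ext K M p q x y \<in> FN (p + q)}"
  have "y \<in> carrier (FT q)"
    using y module.submoduleE(1)[OF FT_module tensor_null_submodule] by blast
  then have "submodule ?H K (FT p)"
    by (rule linear_preimage_submodule[OF FT_module FT_module concat_ext_left_linear
          tensor_null_submodule])
  moreover have "FB p ` tuples M p \<subseteq> ?H"
  proof safe
    fix zs assume zs: "zs \<in> tuples M p"
    show "FB p zs \<in> carrier (FT p)" by (rule tuple_basis_closed[OF zs])
    then show "concat_ext K M p q (FB p zs) y \<in> FN (p + q)"
      by (rule null_surround[OF concat_ext_right_linear, where us = zs and vs = "[]"])
        (use zs y concat_ext_basis in \<open>auto simp: tuples_def\<close>)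
  qed
  ultimately show ?thesis
    using free_module_generates[OF M.R.is_cring, of "tuples M p"] x unfolding generates_def by blast
qed

text \<open>
  The product of two classes is a union over all pairs of representatives.  It is a single class
  because changing first the left and then the right representative alters \<open>concat_ext\<close> by
  elements of the null module only.
\<close>

lemma tensor_mult_coset:
  assumes x: "x \<in> carrier (FT p)" and y: "y \<in> carrier (FT q)"
  shows "tensor_mult K M p q (FN p +>\<^bsub>FT p\<^esub> x) (FN q +>\<^bsub>FT q\<^esub> y) =
    FN (p + q) +>\<^bsub>FT (p + q)\<^esub> concat_ext K M p q x y"
proof -
  interpret FT: module K "FT (p + q)" by (rule FT_module)
  let ?H = "FN (p + q)"
  note sub = FT_module tensor_null_submodule
  note asg = submodule_abelian_subgroup[OF sub]
  have "?H +>\<^bsub>FT (p + q)\<^esub> concat_ext K M p q x' y' = ?H +>\<^bsub>FT (p + q)\<^esub> concat_ext K M p q x y"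
    if x': "x' \<in> FN p +>\<^bsub>FT p\<^esub> x" and y': "y' \<in> FN q +>\<^bsub>FT q\<^esub> y" for x' y'
  proof -
    have xc: "x' \<in> carrier (FT p)" by (rule abelian_subgroup.a_elemrcos_carrier[OF asg x x'])
    have yc: "y' \<in> carrier (FT q)" by (rule abelian_subgroup.a_elemrcos_carrier[OF asg y y'])
    have xn: "x \<ominus>\<^bsub>FT p\<^esub> x' \<in> FN p"
      using abelian_subgroup.a_repr_independence'[OF asg x' x] coset_eq_iff[OF sub xc x] by blast
    have yn: "y \<ominus>\<^bsub>FT q\<^esub> y' \<in> FN q"
      using abelian_subgroup.a_repr_independence'[OF asg y' y] coset_eq_iff[OF sub yc y] by blast
    note cl = linear_maps_closed[OF concat_ext_left_linear]
    have "concat_ext K M p q x y' \<ominus>\<^bsub>FT (p + q)\<^esub> concat_ext K M p q x' y' \<in> ?H"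
      unfolding linear_maps_minus[OF FT_module FT_module concat_ext_left_linear[OF yc] x xc, symmetric]
      by (rule concat_ext_null_left[OF xn yc])
    then have "?H +>\<^bsub>FT (p + q)\<^esub> concat_ext K M p q x' y' = ?H +>\<^bsub>FT (p + q)\<^esub> concat_ext K M p q x y'"
      using coset_eq_iff[OF sub cl[OF yc xc] cl[OF yc x]] by blast
    moreover have "concat_ext K M p q x y \<ominus>\<^bsub>FT (p + q)\<^esub> concat_ext K M p q x y' \<in> ?H"
      unfolding linear_maps_minus[OF FT_module FT_module concat_ext_right_linear[OF x] y yc, symmetric]
      by (rule concat_ext_null_right[OF x yn])
    then have "?H +>\<^bsub>FT (p + q)\<^esub> concat_ext K M p q x y' = ?H +>\<^bsub>FT (p + q)\<^esub> concat_ext K M p q x y"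
      using coset_eq_iff[OF sub cl[OF yc x] cl[OF y x]] by blast
    ultimately show ?thesis by simp
  qed
  moreover have "x \<in> FN p +>\<^bsub>FT p\<^esub> x" by (rule abelian_subgroup.a_rcos_self[OF asg x])
  moreover have "y \<in> FN q +>\<^bsub>FT q\<^esub> y" by (rule abelian_subgroup.a_rcos_self[OF asg y])
  ultimately show ?thesis unfolding tensor_mult_def by blast
qed

lemma tensor_power_cases:
  assumes "X \<in> carrier (tensor_power K M n)"
  obtains x where "x \<in> carrier (FT n)" "X = FN n +>\<^bsub>FT n\<^esub> x"
  using assms unfolding tensor_power_def by (rule coset_cases[OF FT_module tensor_null_submodule])

lemma tensor_mult_left_linear:
  assumes Y: "Y \<in> carrier (tensor_power K M q)"
  shows "(\<lambda>X. tensor_mult K M p q X Y) \<in> linear_maps K (tensor_power K M p) (tensor_power K M (p + q))"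
proof -
  obtain y where y: "y \<in> carrier (FT q)" "Y = FN q +>\<^bsub>FT q\<^esub> y"
    using Y by (rule tensor_power_cases)
  note sub = FT_module tensor_null_submodule
  note cl = linear_maps_closed[OF concat_ext_left_linear[OF y(1)]]
  note qs = coset_closed[OF sub cl] coset_add[OF sub cl cl] coset_smult[OF sub _ cl]
  interpret FT: module K "FT p" by (rule FT_module)
  show ?thesis
    by (rule linear_mapsI; elim tensor_power_cases)
      (simp_all add: y tensor_mult_coset tensor_power_def coset_add[OF sub] coset_smult[OF sub] qs
        linear_maps_add[OF concat_ext_left_linear] linear_maps_smult[OF concat_ext_left_linear])
qed

lemma tensor_mult_right_linear:
  assumes X: "X \<in> carrier (tensor_power K M p)"
  shows "tensor_mult K M p q X \<in> linear_maps K (tensor_power K M q) (tensor_power K M (p + q))"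
proof -
  obtain x where x: "x \<in> carrier (FT p)" "X = FN p +>\<^bsub>FT p\<^esub> x"
    using X by (rule tensor_power_cases)
  note sub = FT_module tensor_null_submodule
  note cl = linear_maps_closed[OF concat_ext_right_linear[OF x(1)]]
  note qs = coset_closed[OF sub cl] coset_add[OF sub cl cl] coset_smult[OF sub _ cl]
  interpret FT: module K "FT q" by (rule FT_module)
  show ?thesis
    by (rule linear_mapsI; elim tensor_power_cases)
      (simp_all add: x tensor_mult_coset tensor_power_def coset_add[OF sub] coset_smult[OF sub] qs
        linear_maps_add[OF concat_ext_right_linear] linear_maps_smult[OF concat_ext_right_linear])
qed

lemma tensor_mult_pure:
  assumes "xs \<in> tuples M p" "ys \<in> tuples M q"
  shows "tensor_mult K M p q (pure_tensor K M xs) (pure_tensor K M ys) = pure_tensor K M (xs @ ys)"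
  using assms
  by (simp add: pure_tensor_eq[of _ p] pure_tensor_eq[of _ q] pure_tensor_eq[OF append_tuples]
      tensor_mult_coset tuple_basis_closed concat_ext_basis)

end

section \<open>Weighted multisets\<close>

text \<open>
  All coefficients of the product of two forests are sums of powers of the weight.  Such a
  combination is therefore recorded, independently of the ground ring, by the multiset of its terms,
  where the pair \<open>(n, s)\<close> stands for the basis element \<open>s\<close> with the coefficient \<open>wt\<^sup>n\<close>.
  The operations below are multiplication by a power of the weight and the linear extension of maps
  of basis elements to basis elements or to combinations.  Associativity of the product of forests
  then is an equation between multisets, where neither coefficients nor carriers occur.
\<close>

definition wshift :: "nat \<Rightarrow> (nat \<times> 'a) multiset \<Rightarrow> (nat \<times> 'a) multiset"
  where "wshift k X = image_mset (map_prod ((+) k) id) X"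

definition wmap :: "('a \<Rightarrow> 'b) \<Rightarrow> (nat \<times> 'a) multiset \<Rightarrow> (nat \<times> 'b) multiset"
  where "wmap h X = image_mset (map_prod id h) X"

definition wbind :: "(nat \<times> 'a) multiset \<Rightarrow> ('a \<Rightarrow> (nat \<times> 'b) multiset) \<Rightarrow> (nat \<times> 'b) multiset"
  where "wbind X g = (\<Sum>p\<in>#X. wshift (fst p) (g (snd p)))"

lemma wshift_simps [simp]:
  "wshift k {#} = {#}" "wshift k (X + Y) = wshift k X + wshift k Y"
  "wshift k (add_mset (n, s) X) = add_mset (k + n, s) (wshift k X)"
  "wshift 0 X = X" "wshift k (wshift l X) = wshift (k + l) X"
  by (simp_all add: wshift_def multiset.map_comp o_def map_prod_def case_prod_unfold add.assoc)

lemma wmap_simps [simp]: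
  "wmap h {#} = {#}" "wmap h (X + Y) = wmap h X + wmap h Y"
  "wmap h (add_mset (n, s) X) = add_mset (n, h s) (wmap h X)"
  "wmap h (wshift k X) = wshift k (wmap h X)"
  by (simp_all add: wmap_def wshift_def multiset.map_comp o_def map_prod_def case_prod_unfold)

lemma wmap_wmap [simp]: "wmap h (wmap g X) = wmap (\<lambda>s. h (g s)) X"
  by (simp add: wmap_def multiset.map_comp o_def map_prod_def case_prod_unfold)

lemma wbind_simps [simp]:
  "wbind {#} g = {#}" "wbind (X + Y) g = wbind X g + wbind Y g"
  "wbind (add_mset (n, s) X) g = wshift n (g s) + wbind X g"
  by (simp_all add: wbind_def)

lemma wmap_id [simp]: "wmap (\<lambda>s. s) X = X"
  by (induction X) auto

lemma wbind_wmap [simp]: "wbind (wmap h X) g = wbind X (\<lambda>s. g (h s))"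
  by (induction X) auto

lemma wbind_wshift [simp]: "wbind (wshift k X) g = wshift k (wbind X g)"
  by (induction X) auto

lemma wmap_wbind [simp]: "wmap h (wbind X g) = wbind X (\<lambda>s. wmap h (g s))"
  by (induction X) auto

lemma wbind_plus [simp]: "wbind X (\<lambda>s. f s + g s) = wbind X f + wbind X g"
  by (induction X) (auto simp: ac_simps)

lemma wbind_body_wshift [simp]: "wbind X (\<lambda>s. wshift k (g s)) = wshift k (wbind X g)"
  by (induction X) (auto simp: ac_simps)

lemma wbind_return [simp]: "wbind X (\<lambda>s. {#(0, h s)#}) = wmap h X"
  by (induction X) auto

text \<open>
  Two substitutions at different places commute.
\<close>

lemma wbind_wmap_swap:
  "wbind X (\<lambda>s. wmap (f s) Y) = wbind Y (\<lambda>t. wmap (\<lambda>s. f s t) X)"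
proof (induction X)
  case empty show ?case by (induction Y) auto
next
  case (add p X)
  obtain n s where p: "p = (n, s)" by (cases p)
  have "wbind Y (\<lambda>t. wmap (\<lambda>s. f s t) (add_mset p X)) =
      wshift n (wmap (f s) Y) + wbind Y (\<lambda>t. wmap (\<lambda>s. f s t) X)"
    by (induction Y) (auto simp: ac_simps p)
  then show ?case using add by (simp add: p)
qed

lemma wbind_cong:
  "(\<And>n s. (n, s) \<in># X \<Longrightarrow> f s = g s) \<Longrightarrow> wbind X f = wbind X g"
  unfolding wbind_def by (intro arg_cong[where f = sum_mset] image_mset_cong) auto

lemma in_wshift: "(n, s) \<in># wshift k X \<Longrightarrow> \<exists>m. (m, s) \<in># X"
  by (auto simp: wshift_def)

lemma in_wmap: "(n, t) \<in># wmap h X \<Longrightarrow> \<exists>s. (n, s) \<in># X \<and> t = h s"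
  by (auto simp: wmap_def)

lemma in_wbind: "(n, t) \<in># wbind X g \<Longrightarrow> \<exists>m s k. (m, s) \<in># X \<and> (k, t) \<in># g s"
  by (fastforce simp: wbind_def dest!: in_wshift)

section \<open>The product of forests as a weighted multiset\<close>

text \<open>
  The recursion is that of \<open>tree_diamond\<close> and \<open>diamond\<close>.  As the product of two trees is a
  combination of single trees, \<open>tree_prod\<close> yields trees instead of forests.
\<close>

function (sequential)
  tree_prod :: "ptree \<Rightarrow> ptree \<Rightarrow> (nat \<times> ptree) multiset" and
  forest_prod :: "forest \<Rightarrow> forest \<Rightarrow> (nat \<times> forest) multiset"
  where
    "tree_prod (Node F) (Node G) =
      (if G = [] then {#(0, Node F)#}
       else if F = [] then {#(0, Node G)#}
       else wmap Node (forest_prod [Node F] G + forest_prod F [Node G] + wshift 1 (forest_prod F G)))"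
  | "forest_prod F G =
      (if F = [] \<or> G = [] then {#}
       else wmap (\<lambda>T. butlast F @ [T] @ tl G) (tree_prod (last F) (hd G)))"
  by pat_completeness auto
termination
proof (relation "measure (\<lambda>s. case s of
      Inl (T, T') \<Rightarrow> 2 * (vertices T + vertices T')
    | Inr (F, F') \<Rightarrow> 2 * (sum_list (map vertices F) + sum_list (map vertices F')) + 1)",
    goal_cases)
  case (5 F F')
  then show ?case
    using vertices_last_hd_le[of F F'] by simp
qed simp_all

declare tree_prod.simps [simp del] forest_prod.simps [simp del]

lemma tree_prod_bullet [simp]:
  "tree_prod T bullet = {#(0, T)#}" "tree_prod bullet = (\<lambda>T. {#(0, T)#})"
proof -
  show "tree_prod T bullet = {#(0, T)#}" by (cases T) (simp add: tree_prod.simps)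
  have "tree_prod bullet U = {#(0, U)#}" for U by (cases U) (simp add: tree_prod.simps)
  then show "tree_prod bullet = (\<lambda>T. {#(0, T)#})" by blast
qed

lemma tree_prod_Node:
  "\<lbrakk>F \<noteq> []; G \<noteq> []\<rbrakk> \<Longrightarrow> tree_prod (Node F) (Node G) =
    wmap Node (forest_prod [Node F] G + forest_prod F [Node G] + wshift 1 (forest_prod F G))"
  by (simp add: tree_prod.simps)

lemma forest_prod_snoc_Cons [simp]:
  "forest_prod (F @ [T]) (U # G) = wmap (\<lambda>V. F @ V # G) (tree_prod T U)"
  by (simp add: forest_prod.simps)

lemma forest_prod_snoc_Cons_Cons [simp]:
  "forest_prod (S # F @ [T]) (U # G) = wmap (\<lambda>V. S # F @ V # G) (tree_prod T U)"
  by (simp add: forest_prod.simps)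

lemma forest_prod_single_Cons [simp]:
  "forest_prod [T] (U # G) = wmap (\<lambda>V. V # G) (tree_prod T U)"
  using forest_prod_snoc_Cons[of "[]"] by simp

abbreviation fvertices :: "forest \<Rightarrow> nat"
  where "fvertices F \<equiv> sum_list (map vertices F)"

text \<open>
  If the middle forest has at least two trees, the two products take place at different trees and
  commute.  If it is a single tree, both sides reduce to the associativity of the product of three
  trees; the bound \<open>n\<close> makes this usable inside an induction on the number of vertices.
\<close>

lemma forest_prod_assoc_aux:
  assumes tree: "\<And>T U V. vertices T + vertices U + vertices V < n \<Longrightarrow>
      wbind (tree_prod T U) (\<lambda>X. tree_prod X V) = wbind (tree_prod U V) (\<lambda>X. tree_prod T X)"
    and ne: "F \<noteq> []" "G \<noteq> []" "H \<noteq> []" and n: "fvertices F + fvertices G + fvertices H < n"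
  shows "wbind (forest_prod F G) (\<lambda>X. forest_prod X H) = wbind (forest_prod G H) (\<lambda>X. forest_prod F X)"
proof -
  obtain F' T where F: "F = F' @ [T]" using ne(1) by (metis rev_exhaust)
  obtain V H' where H: "H = V # H'" using ne(3) by (cases H) auto
  obtain U G' where G: "G = U # G'" using ne(2) by (cases G) auto
  show ?thesis
  proof (cases G' rule: rev_cases)
    case Nil
    have "wbind (tree_prod T U) (\<lambda>X. tree_prod X V) = wbind (tree_prod U V) (\<lambda>X. tree_prod T X)"
      using n by (intro tree) (simp add: F G H Nil)
    then have "wmap (\<lambda>X. F' @ X # H') (wbind (tree_prod T U) (\<lambda>X. tree_prod X V)) =
        wmap (\<lambda>X. F' @ X # H') (wbind (tree_prod U V) (\<lambda>X. tree_prod T X))" by simp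
    then show ?thesis by (simp add: F G H Nil)
  next
    case (snoc G0 W)
    have "forest_prod (F' @ X # G0 @ [W]) (V # H') = wmap (\<lambda>Y. F' @ X # G0 @ Y # H') (tree_prod W V)" for X
      using forest_prod_snoc_Cons[of "F' @ X # G0"] by simp
    then show ?thesis
      by (simp add: F G H snoc wbind_wmap_swap[of _ _ "tree_prod T U"])
  qed
qed

text \<open>
  Expanding both sides for \<open>T = Node A\<close>, \<open>U = Node B\<close>, \<open>V = Node C\<close> gives grafted products of
  three forests, each with at least one of \<open>T\<close>, \<open>U\<close>, \<open>V\<close> replaced by the smaller \<open>A\<close>, \<open>B\<close>,
  \<open>C\<close>.  By induction these products are associative.  Five terms on each side match one by one.
  On the left, three further terms are products of a grafted forest with \<open>C\<close>; they add up to the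
  product of \<open>[T]\<close>, \<open>[U]\<close> and \<open>C\<close>, which is the sixth term on the right.  Likewise, the
  remaining three terms on the right add up to the sixth term on the left.
\<close>

lemma tree_prod_assoc:
  "wbind (tree_prod T U) (\<lambda>X. tree_prod X V) = wbind (tree_prod U V) (\<lambda>X. tree_prod T X)"
proof (induction "vertices T + vertices U + vertices V" arbitrary: T U V rule: less_induct)
  case less
  obtain A B C where TUV: "T = Node A" "U = Node B" "V = Node C"
    by (metis ptree.exhaust)
  show ?case
  proof (cases "A = [] \<or> B = [] \<or> C = []")
    case True
    then show ?thesis by (auto simp: TUV)
  next
    case False
    then have ne: "A \<noteq> []" "B \<noteq> []" "C \<noteq> []" by auto
    have IH: "wbind (forest_prod F G) (\<lambda>X. forest_prod X H) = wbind (forest_prod G H) (\<lambda>X. forest_prod F X)"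
      if "F \<noteq> []" "G \<noteq> []" "H \<noteq> []" "fvertices F + fvertices G + fvertices H < vertices T + vertices U + vertices V"
      for F G H
      using that less by (intro forest_prod_assoc_aux[of "vertices T + vertices U + vertices V"]) auto
    have fp_ne: "X \<noteq> []" if "(n, X) \<in># forest_prod F G" for n X F G
      using that by (auto simp: forest_prod.simps dest!: in_wmap split: if_splits)
    have l: "wbind (forest_prod F G) (\<lambda>X. tree_prod (Node X) V) =
        wbind (forest_prod F G) (\<lambda>X. wmap Node (forest_prod [Node X] C + forest_prod X [V] +
          wshift 1 (forest_prod X C)))" for F G
      unfolding TUV by (rule wbind_cong) (simp add: tree_prod_Node fp_ne ne)
    have r: "wbind (forest_prod F G) (\<lambda>X. tree_prod T (Node X)) =
        wbind (forest_prod F G) (\<lambda>X. wmap Node (forest_prod [T] X + forest_prod A [Node X] +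
          wshift 1 (forest_prod A X)))" for F G
      unfolding TUV by (rule wbind_cong) (simp add: tree_prod_Node fp_ne ne)
    have TU: "forest_prod [T] [U] = wmap (\<lambda>X. [X]) (tree_prod T U)" for T U by simp
    have "wbind (forest_prod [T] [U]) (\<lambda>X. forest_prod X C) = wbind (forest_prod [U] C) (\<lambda>X. forest_prod [T] X)"
      by (rule IH) (simp_all add: TUV ne)
    then have 1: "wbind (tree_prod T U) (\<lambda>X. forest_prod [X] C) = wbind (forest_prod [U] C) (\<lambda>X. forest_prod [T] X)"
      by (simp del: forest_prod_single_Cons add: TU)
    have "wbind (forest_prod A [U]) (\<lambda>X. forest_prod X [V]) = wbind (forest_prod [U] [V]) (\<lambda>X. forest_prod A X)"
      by (rule IH) (simp_all add: TUV ne)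
    then have 2: "wbind (forest_prod A [U]) (\<lambda>X. forest_prod X [V]) = wbind (tree_prod U V) (\<lambda>X. forest_prod A [X])"
      by (simp del: forest_prod_single_Cons add: TU)
    have 3: "wbind (forest_prod [T] B) (\<lambda>X. forest_prod X [V]) = wbind (forest_prod B [V]) (\<lambda>X. forest_prod [T] X)"
      "wbind (forest_prod [T] B) (\<lambda>X. forest_prod X C) = wbind (forest_prod B C) (\<lambda>X. forest_prod [T] X)"
      "wbind (forest_prod A [U]) (\<lambda>X. forest_prod X C) = wbind (forest_prod [U] C) (\<lambda>X. forest_prod A X)"
      "wbind (forest_prod A B) (\<lambda>X. forest_prod X [V]) = wbind (forest_prod B [V]) (\<lambda>X. forest_prod A X)"
      "wbind (forest_prod A B) (\<lambda>X. forest_prod X C) = wbind (forest_prod B C) (\<lambda>X. forest_prod A X)"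
      by ((rule IH; simp add: TUV ne)+)
    \<comment> \<open>By the recursion, the three terms are those of the product of \<open>T\<close> and \<open>U\<close>, with \<open>C\<close> to the right.\<close>
    have e1: "wbind (forest_prod [T] B) (\<lambda>X. forest_prod [Node X] C) + wbind (forest_prod A [U]) (\<lambda>X. forest_prod [Node X] C)
        + wshift 1 (wbind (forest_prod A B) (\<lambda>X. forest_prod [Node X] C)) = wbind (forest_prod [U] C) (\<lambda>X. forest_prod [T] X)"
      using 1 unfolding TUV tree_prod_Node[OF ne(1,2)] by simp
    \<comment> \<open>By the recursion, the three terms are those of the product of \<open>U\<close> and \<open>V\<close>, with \<open>A\<close> to the left.\<close>
    have e2: "wbind (forest_prod A [U]) (\<lambda>X. forest_prod X [V]) = wbind (forest_prod [U] C) (\<lambda>X. forest_prod A [Node X])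
        + wbind (forest_prod B [V]) (\<lambda>X. forest_prod A [Node X]) + wshift 1 (wbind (forest_prod B C) (\<lambda>X. forest_prod A [Node X]))"
      using 2 unfolding TUV tree_prod_Node[OF ne(2,3)] by simp
    have "wbind (tree_prod T U) (\<lambda>X. tree_prod X V) =
      wmap Node (
        (wbind (forest_prod [T] B) (\<lambda>X. forest_prod [Node X] C) + wbind (forest_prod A [U]) (\<lambda>X. forest_prod [Node X] C)
          + wshift 1 (wbind (forest_prod A B) (\<lambda>X. forest_prod [Node X] C)))
        + wbind (forest_prod A [U]) (\<lambda>X. forest_prod X [V])
        + wbind (forest_prod [T] B) (\<lambda>X. forest_prod X [V])
        + wshift 1 (wbind (forest_prod [T] B) (\<lambda>X. forest_prod X C))
        + wshift 1 (wbind (forest_prod A [U]) (\<lambda>X. forest_prod X C))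
        + wshift 1 (wbind (forest_prod A B) (\<lambda>X. forest_prod X [V]))
        + wshift 2 (wbind (forest_prod A B) (\<lambda>X. forest_prod X C)))"
      using l[of "[T]" B] l[of A "[U]"] l[of A B]
      unfolding TUV tree_prod_Node[OF ne(1,2)] by (simp add: ac_simps numeral_2_eq_2)
    moreover have "wbind (tree_prod U V) (\<lambda>X. tree_prod T X) =
      wmap Node (
        wbind (forest_prod [U] C) (\<lambda>X. forest_prod [T] X)
        + (wbind (forest_prod [U] C) (\<lambda>X. forest_prod A [Node X])
          + wbind (forest_prod B [V]) (\<lambda>X. forest_prod A [Node X]) + wshift 1 (wbind (forest_prod B C) (\<lambda>X. forest_prod A [Node X])))
        + wbind (forest_prod B [V]) (\<lambda>X. forest_prod [T] X)
        + wshift 1 (wbind (forest_prod B C) (\<lambda>X. forest_prod [T] X))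
        + wshift 1 (wbind (forest_prod [U] C) (\<lambda>X. forest_prod A X))
        + wshift 1 (wbind (forest_prod B [V]) (\<lambda>X. forest_prod A X))
        + wshift 2 (wbind (forest_prod B C) (\<lambda>X. forest_prod A X)))"
      using r[of "[U]" C] r[of B "[V]"] r[of B C]
      unfolding TUV tree_prod_Node[OF ne(2,3)] by (simp add: ac_simps numeral_2_eq_2)
    ultimately show ?thesis unfolding e1 e2[symmetric] 3 by simp
  qed
qed

lemma forest_prod_assoc:
  assumes "F \<noteq> []" "G \<noteq> []" "H \<noteq> []"
  shows "wbind (forest_prod F G) (\<lambda>X. forest_prod X H) = wbind (forest_prod G H) (\<lambda>X. forest_prod F X)"
  by (rule forest_prod_assoc_aux[OF tree_prod_assoc assms lessI])

subsection \<open>Leaves and ladders\<close>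

lemma leaves_simps [simp]:
  "leaves [] = 0" "leaves (T # F) = tree_leaves T + leaves F" "leaves (F @ G) = leaves F + leaves G"
  by (simp_all add: leaves_def)

lemma tree_leaves_Node: "tree_leaves (Node F) = (if F = [] then 1 else leaves F)"
  by (simp add: leaves_def)

declare tree_leaves.simps [simp del]

lemma tree_leaves_pos [simp]: "0 < tree_leaves T"
proof (induction T)
  case (Node F) then show ?case by (cases F) (auto simp: tree_leaves_Node)
qed

lemma leaves_pos: "F \<noteq> [] \<Longrightarrow> 0 < leaves F"
  by (cases F) auto

definition ladder_free :: "ptree \<Rightarrow> bool"
  where "ladder_free T \<longleftrightarrow> Node [bullet] \<notin> subtrees T"

lemma ladder_free_Node:
  "ladder_free (Node F) \<longleftrightarrow> F \<noteq> [bullet] \<and> (\<forall>T\<in>set F. ladder_free T)"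
  by (auto simp: ladder_free_def)

lemma ladder_free_forests_iff:
  "F \<in> ladder_free_forests \<longleftrightarrow> F \<noteq> [] \<and> F \<noteq> [bullet] \<and> (\<forall>T\<in>set F. ladder_free T)"
  by (auto simp: ladder_free_forests_def forests_def ladder_free_def)

lemma ladder_free_Node_iff: "ladder_free (Node F) \<longleftrightarrow> F = [] \<or> F \<in> ladder_free_forests"
  by (auto simp: ladder_free_Node ladder_free_forests_iff)

lemma bullet_ladder_free [simp]: "ladder_free bullet"
  by (simp add: ladder_free_Node)

lemma graft_ladder_free: "F \<in> ladder_free_forests \<Longrightarrow> [Node F] \<in> ladder_free_forests"
  by (auto simp: ladder_free_forests_iff ladder_free_Node)

lemma forest_prod_leaves_aux:
  assumes "\<And>n T. (n, T) \<in># tree_prod (last F) (hd G) \<Longrightarrow> Suc (tree_leaves T) = tree_leaves (last F) + tree_leaves (hd G)"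
    and "(n, X) \<in># forest_prod F G"
  shows "X \<noteq> [] \<and> Suc (leaves X) = leaves F + leaves G"
proof -
  have ne: "F \<noteq> []" "G \<noteq> []" using assms(2) by (auto simp: forest_prod.simps split: if_splits)
  obtain F' T where F: "F = F' @ [T]" using ne(1) by (metis rev_exhaust)
  obtain V H' where H: "G = V # H'" using ne(2) by (cases G) auto
  show ?thesis using assms by (auto simp: F H dest!: in_wmap)
qed

lemma tree_prod_leaves:
  "(n, X) \<in># tree_prod T U \<Longrightarrow> Suc (tree_leaves X) = tree_leaves T + tree_leaves U"
proof (induction "vertices T + vertices U" arbitrary: T U n X rule: less_induct)
  case less
  obtain A B where TU: "T = Node A" "U = Node B" by (metis ptree.exhaust)
  show ?case
  proof (cases "A = [] \<or> B = []")
    case True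
    then show ?thesis using less.prems by (auto simp: TU tree_leaves_Node)
  next
    case False
    have IH: "Y \<noteq> [] \<and> Suc (leaves Y) = leaves F + leaves G"
      if "(m, Y) \<in># forest_prod F G" "fvertices F + fvertices G < vertices T + vertices U" "F \<noteq> []" "G \<noteq> []"
      for m Y F G
    proof (rule forest_prod_leaves_aux[OF less.hyps that(1)])
      show "vertices (last F) + vertices (hd G) < vertices T + vertices U"
        using vertices_last_hd_le[of F G] that by linarith
    qed
    obtain Y where X: "X = Node Y" and Y: "(n, Y) \<in># forest_prod [T] B + forest_prod A [U] + wshift 1 (forest_prod A B)"
      using less.prems False by (auto simp: TU tree_prod_Node simp del: wmap_simps dest!: in_wmap)
    from Y consider "(n, Y) \<in># forest_prod [T] B" | "(n, Y) \<in># forest_prod A [U]" | m where "(m, Y) \<in># forest_prod A B"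
      by (auto dest: in_wshift)
    then show ?thesis
    proof cases
      case 1 then show ?thesis using IH[OF 1] False by (auto simp: X TU tree_leaves_Node)
    next
      case 2 then show ?thesis using IH[OF 2] False by (auto simp: X TU tree_leaves_Node)
    next
      case 3 then show ?thesis using IH[OF 3] False by (auto simp: X TU tree_leaves_Node)
    qed
  qed
qed

lemma forest_prod_leaves:
  "(n, X) \<in># forest_prod F G \<Longrightarrow> X \<noteq> [] \<and> Suc (leaves X) = leaves F + leaves G"
  by (rule forest_prod_leaves_aux[OF tree_prod_leaves])

lemma forest_prod_ladder_free_aux:
  assumes "\<And>n T. (n, T) \<in># tree_prod (last F) (hd G) \<Longrightarrow>
      ladder_free T \<and> (T = bullet \<longrightarrow> last F = bullet \<and> hd G = bullet)"
    and "(n, X) \<in># forest_prod F G"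
    and "\<forall>T\<in>set F. ladder_free T" "\<forall>T\<in>set G. ladder_free T" "F \<noteq> [bullet] \<or> G \<noteq> [bullet]"
  shows "X \<in> ladder_free_forests"
proof -
  have ne: "F \<noteq> []" "G \<noteq> []" using assms(2) by (auto simp: forest_prod.simps split: if_splits)
  obtain F' T where F: "F = F' @ [T]" using ne(1) by (metis rev_exhaust)
  obtain V H' where H: "G = V # H'" using ne(2) by (cases G) auto
  show ?thesis using assms
    by (cases F') (auto simp: F H ladder_free_forests_iff dest!: in_wmap)
qed

text \<open>
  The clause on \<open>bullet\<close> makes the induction work: a graft is a ladder only if \<open>[bullet]\<close> is
  grafted, and by this clause \<open>[bullet]\<close> is a product of \<open>[bullet]\<close> with itself only, whereas the
  children of a vertex of a ladder-free tree never form the forest \<open>[bullet]\<close>.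
\<close>

lemma tree_prod_ladder_free:
  "\<lbrakk>(n, X) \<in># tree_prod T U; ladder_free T; ladder_free U\<rbrakk> \<Longrightarrow>
    ladder_free X \<and> (X = bullet \<longrightarrow> T = bullet \<and> U = bullet)"
proof (induction "vertices T + vertices U" arbitrary: T U n X rule: less_induct)
  case less
  obtain A B where TU: "T = Node A" "U = Node B" by (metis ptree.exhaust)
  show ?case
  proof (cases "A = [] \<or> B = []")
    case True
    then show ?thesis using less.prems by (auto simp: TU)
  next
    case False
    then have AB: "A \<in> ladder_free_forests" "B \<in> ladder_free_forests"
      using less.prems by (auto simp: TU ladder_free_Node_iff)
    then have AB': "\<forall>T\<in>set A. ladder_free T" "\<forall>T\<in>set B. ladder_free T" "A \<noteq> [bullet]" "B \<noteq> [bullet]"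
      by (auto simp: ladder_free_forests_iff)
    have IH: "Y \<in> ladder_free_forests"
      if Y: "(m, Y) \<in># forest_prod F G" "fvertices F + fvertices G < vertices T + vertices U" "F \<noteq> []" "G \<noteq> []"
        and lf: "\<forall>T\<in>set F. ladder_free T" "\<forall>T\<in>set G. ladder_free T" "F \<noteq> [bullet] \<or> G \<noteq> [bullet]"
      for m Y F G
    proof (rule forest_prod_ladder_free_aux[OF less.hyps Y(1) lf])
      show "vertices (last F) + vertices (hd G) < vertices T + vertices U"
        using vertices_last_hd_le[of F G] Y by linarith
    qed (use lf Y in auto)
    obtain Y where X: "X = Node Y" and Y: "(n, Y) \<in># forest_prod [T] B + forest_prod A [U] + wshift 1 (forest_prod A B)"
      using less.prems False by (auto simp: TU tree_prod_Node simp del: wmap_simps dest!: in_wmap)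
    from Y consider "(n, Y) \<in># forest_prod [T] B" | "(n, Y) \<in># forest_prod A [U]" | m where "(m, Y) \<in># forest_prod A B"
      by (auto dest: in_wshift)
    then have "Y \<in> ladder_free_forests"
    proof cases
      case 1 then show ?thesis using IH[OF 1] False less.prems AB' by (auto simp: TU)
    next
      case 2 then show ?thesis using IH[OF 2] False less.prems AB' by (auto simp: TU)
    next
      case 3 then show ?thesis using IH[OF 3] False less.prems AB' by (auto simp: TU)
    qed
    then show ?thesis by (auto simp: X ladder_free_Node_iff ladder_free_forests_iff)
  qed
qed

lemma forest_prod_ladder_free:
  assumes "(n, X) \<in># forest_prod F G" "F \<in> ladder_free_forests" "G \<in> ladder_free_forests"
  shows "X \<in> ladder_free_forests"
  using assms
  by (intro forest_prod_ladder_free_aux[OF tree_prod_ladder_free]) (auto simp: ladder_free_forests_iff)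

section \<open>Weighted sums in a module\<close>

text \<open>
  Addition is commutative on the carrier only, so the fold over a multiset does not apply.  The
  elements are added in some order instead, and the order is irrelevant for summands in the carrier.
\<close>

definition msum :: "('k, 'b, 'y) module_scheme \<Rightarrow> ('a \<Rightarrow> 'b) \<Rightarrow> 'a multiset \<Rightarrow> 'b"
  where "msum N \<phi> X = foldr (\<lambda>s r. \<phi> s \<oplus>\<^bsub>N\<^esub> r) (SOME xs. mset xs = X) \<zero>\<^bsub>N\<^esub>"

definition wsum ::
    "('k, 'c) ring_scheme \<Rightarrow> 'k \<Rightarrow> ('k, 'b, 'y) module_scheme \<Rightarrow> ('a \<Rightarrow> 'b) \<Rightarrow> (nat \<times> 'a) multiset \<Rightarrow> 'b"
  where "wsum K wt N \<phi> X = msum N (\<lambda>p. (wt [^]\<^bsub>K\<^esub> fst p) \<odot>\<^bsub>N\<^esub> \<phi> (snd p)) X"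

context
  fixes K :: "('k, 'c) ring_scheme" and N :: "('k, 'b, 'y) module_scheme"
  assumes N: "module K N"
begin

interpretation N: module K N by (rule N)

lemma foldr_add_closed:
  "(\<And>s. s \<in> set xs \<Longrightarrow> \<phi> s \<in> carrier N) \<Longrightarrow> foldr (\<lambda>s r. \<phi> s \<oplus>\<^bsub>N\<^esub> r) xs \<zero>\<^bsub>N\<^esub> \<in> carrier N"
  by (induction xs) auto

lemma foldr_add_remove1:
  "\<lbrakk>\<And>s. s \<in> set xs \<Longrightarrow> \<phi> s \<in> carrier N; x \<in> set xs\<rbrakk> \<Longrightarrow>
    foldr (\<lambda>s r. \<phi> s \<oplus>\<^bsub>N\<^esub> r) xs \<zero>\<^bsub>N\<^esub> = \<phi> x \<oplus>\<^bsub>N\<^esub> foldr (\<lambda>s r. \<phi> s \<oplus>\<^bsub>N\<^esub> r) (remove1 x xs) \<zero>\<^bsub>N\<^esub>"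
proof (induction xs)
  case (Cons y xs)
  show ?case
  proof (cases "x = y")
    case False
    have c: "foldr (\<lambda>s r. \<phi> s \<oplus>\<^bsub>N\<^esub> r) (remove1 x xs) \<zero>\<^bsub>N\<^esub> \<in> carrier N"
      using Cons.prems by (intro foldr_add_closed) (auto dest: notin_set_remove1)
    show ?thesis using False Cons c by (simp add: N.a_ac)
  qed simp
qed simp

lemma foldr_add_perm:
  "\<lbrakk>\<And>s. s \<in> set xs \<Longrightarrow> \<phi> s \<in> carrier N; mset xs = mset ys\<rbrakk> \<Longrightarrow>
    foldr (\<lambda>s r. \<phi> s \<oplus>\<^bsub>N\<^esub> r) xs \<zero>\<^bsub>N\<^esub> = foldr (\<lambda>s r. \<phi> s \<oplus>\<^bsub>N\<^esub> r) ys \<zero>\<^bsub>N\<^esub>"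
proof (induction xs arbitrary: ys)
  case (Cons x xs)
  have x: "x \<in> set ys" using Cons.prems(2) by (metis list.set_intros(1) mset_eq_setD)
  have "mset xs = mset (remove1 x ys)"
    using Cons.prems(2) by (metis add_mset_remove_trivial mset.simps(2) mset_remove1)
  then have "foldr (\<lambda>s r. \<phi> s \<oplus>\<^bsub>N\<^esub> r) xs \<zero>\<^bsub>N\<^esub> = foldr (\<lambda>s r. \<phi> s \<oplus>\<^bsub>N\<^esub> r) (remove1 x ys) \<zero>\<^bsub>N\<^esub>"
    using Cons by auto
  moreover have "\<And>s. s \<in> set ys \<Longrightarrow> \<phi> s \<in> carrier N"
    using Cons.prems by (metis mset_eq_setD)
  ultimately show ?case using foldr_add_remove1[OF _ x, of \<phi>] by simp
qed simp

lemma msum_mset: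
  assumes "\<And>s. s \<in> set xs \<Longrightarrow> \<phi> s \<in> carrier N"
  shows "msum N \<phi> (mset xs) = foldr (\<lambda>s r. \<phi> s \<oplus>\<^bsub>N\<^esub> r) xs \<zero>\<^bsub>N\<^esub>"
proof -
  have *: "mset (SOME ys. mset ys = mset xs) = mset xs" by (rule someI[of _ xs]) simp
  show ?thesis
    unfolding msum_def
    using assms * by (intro foldr_add_perm) (metis mset_eq_setD)+
qed

lemma msum_empty [simp]: "msum N \<phi> {#} = \<zero>\<^bsub>N\<^esub>"
  by (simp add: msum_def)

lemma msum_add_mset:
  assumes "\<And>s. s \<in># add_mset x X \<Longrightarrow> \<phi> s \<in> carrier N"
  shows "msum N \<phi> (add_mset x X) = \<phi> x \<oplus>\<^bsub>N\<^esub> msum N \<phi> X"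
proof -
  obtain xs where X: "X = mset xs" by (metis ex_mset)
  then show ?thesis
    using msum_mset[of xs \<phi>] msum_mset[of "x # xs" \<phi>] assms by simp
qed

end

context
  fixes K :: "('k, 'c) ring_scheme" and N :: "('k, 'b, 'y) module_scheme" and wt :: 'k
  assumes N: "module K N" and wt: "wt \<in> carrier K"
begin

interpretation N: module K N by (rule N)

lemma wsum_empty [simp]: "wsum K wt N \<phi> {#} = \<zero>\<^bsub>N\<^esub>"
  by (simp add: wsum_def msum_empty[OF N])

lemma wsum_add_mset:
  assumes "\<phi> s \<in> carrier N" "\<forall>p\<in>#X. \<phi> (snd p) \<in> carrier N"
  shows "wsum K wt N \<phi> (add_mset (n, s) X) = (wt [^]\<^bsub>K\<^esub> n) \<odot>\<^bsub>N\<^esub> \<phi> s \<oplus>\<^bsub>N\<^esub> wsum K wt N \<phi> X"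
proof -
  have "(wt [^]\<^bsub>K\<^esub> fst p) \<odot>\<^bsub>N\<^esub> \<phi> (snd p) \<in> carrier N" if "p \<in># add_mset (n, s) X" for p
    using that assms wt by auto
  then show ?thesis unfolding wsum_def by (subst msum_add_mset[OF N]) simp_all
qed

lemma wsum_closed: "\<forall>p\<in>#X. \<phi> (snd p) \<in> carrier N \<Longrightarrow> wsum K wt N \<phi> X \<in> carrier N"
proof (induction X)
  case (add p X)
  then show ?case by (cases p) (simp add: wsum_add_mset wt)
qed simp

lemma wsum_single: "\<phi> s \<in> carrier N \<Longrightarrow> wsum K wt N \<phi> {#(0, s)#} = \<phi> s"
  by (simp add: wsum_add_mset)

lemma wsum_add:
  "\<lbrakk>\<forall>p\<in>#X. \<phi> (snd p) \<in> carrier N; \<forall>p\<in>#Y. \<phi> (snd p) \<in> carrier N\<rbrakk> \<Longrightarrow>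
    wsum K wt N \<phi> (X + Y) = wsum K wt N \<phi> X \<oplus>\<^bsub>N\<^esub> wsum K wt N \<phi> Y"
proof (induction X)
  case (add p X)
  then show ?case
    by (cases p) (simp add: wsum_add_mset wsum_closed wt N.a_assoc ball_Un)
qed (simp add: wsum_closed)

lemma wsum_cong:
  "\<lbrakk>\<forall>p\<in>#X. \<psi> (snd p) \<in> carrier N; \<forall>p\<in>#X. \<phi> (snd p) = \<psi> (snd p)\<rbrakk> \<Longrightarrow>
    wsum K wt N \<phi> X = wsum K wt N \<psi> X"
proof (induction X)
  case (add p X)
  then show ?case by (cases p) (simp add: wsum_add_mset)
qed simp

lemma wsum_wmap:
  "\<forall>p\<in>#X. \<phi> (h (snd p)) \<in> carrier N \<Longrightarrow>
    wsum K wt N \<phi> (wmap h X) = wsum K wt N (\<lambda>s. \<phi> (h s)) X"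
proof (induction X)
  case (add p X)
  then have "\<forall>p\<in>#wmap h X. \<phi> (snd p) \<in> carrier N" by (auto simp: wmap_def)
  with add show ?case by (cases p) (simp add: wsum_add_mset)
qed simp

lemma wsum_wshift:
  "\<forall>p\<in>#X. \<phi> (snd p) \<in> carrier N \<Longrightarrow>
    wsum K wt N \<phi> (wshift k X) = (wt [^]\<^bsub>K\<^esub> k) \<odot>\<^bsub>N\<^esub> wsum K wt N \<phi> X"
proof (induction X)
  case (add p X)
  then have "\<forall>p\<in>#wshift k X. \<phi> (snd p) \<in> carrier N" by (auto simp: wshift_def)
  moreover have "wt [^]\<^bsub>K\<^esub> (k + n) = wt [^]\<^bsub>K\<^esub> k \<otimes>\<^bsub>K\<^esub> wt [^]\<^bsub>K\<^esub> n" for n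
    using wt by (simp add: N.R.nat_pow_mult)
  ultimately show ?case using add wt
    by (cases p) (simp add: wsum_add_mset wsum_closed N.smult_r_distr N.smult_assoc1)
qed (simp add: wt)

lemma wsum_wbind:
  "\<forall>p\<in>#X. \<forall>q\<in>#g (snd p). \<phi> (snd q) \<in> carrier N \<Longrightarrow>
    wsum K wt N \<phi> (wbind X g) = wsum K wt N (\<lambda>s. wsum K wt N \<phi> (g s)) X"
proof (induction X)
  case (add p X)
  then have "\<forall>q\<in>#wbind X g. \<phi> (snd q) \<in> carrier N"
    "\<forall>q\<in>#wshift k (g (snd p)). \<phi> (snd q) \<in> carrier N" for k
    by (auto dest!: in_wbind in_wshift) fastforce+
  with add show ?case
    by (cases p) (simp add: wsum_add wsum_wshift wsum_add_mset wsum_closed)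
qed simp

lemma wsum_linear:
  assumes "\<forall>p\<in>#X. h (snd p) \<in> linear_maps K A N" and A: "module K A"
  shows "(\<lambda>x. wsum K wt N (\<lambda>s. h s x) X) \<in> linear_maps K A N"
  using assms(1)
proof (induction X)
  case empty then show ?case by (simp add: linear_maps_zero_map[OF N])
next
  case (add p X)
  obtain n s where p: "p = (n, s)" by (cases p)
  have "(\<lambda>x. (wt [^]\<^bsub>K\<^esub> n) \<odot>\<^bsub>N\<^esub> h s x \<oplus>\<^bsub>N\<^esub> wsum K wt N (\<lambda>s. h s x) X) \<in> linear_maps K A N"
    using add wt by (intro linear_maps_plus[OF N] linear_maps_scale[OF N]) (auto simp: p)
  then show ?case
  proof (rule linear_maps_cong[OF A])
    fix x assume x: "x \<in> carrier A"
    show "wsum K wt N (\<lambda>s. h s x) (add_mset p X) = (wt [^]\<^bsub>K\<^esub> n) \<odot>\<^bsub>N\<^esub> h s x \<oplus>\<^bsub>N\<^esub> wsum K wt N (\<lambda>s. h s x) X"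
      unfolding p using add.prems linear_maps_closed[OF _ x]
      by (intro wsum_add_mset) (auto simp: p)
  qed
qed

end

lemma linear_maps_wsum:
  assumes N: "module K N" and B: "module K B" and wt: "wt \<in> carrier K" and h: "h \<in> linear_maps K N B"
  shows "\<forall>p\<in>#X. \<phi> (snd p) \<in> carrier N \<Longrightarrow>
    h (wsum K wt N \<phi> X) = wsum K wt B (\<lambda>s. h (\<phi> s)) X"
proof (induction X)
  case empty
  then show ?case by (simp add: wsum_empty[OF N wt] wsum_empty[OF B wt] linear_maps_zero[OF N B h])
next
  case (add p X)
  interpret N: module K N by fact
  show ?case
    using add wt
    by (cases p) (simp add: wsum_add_mset[OF N wt] wsum_add_mset[OF B wt] wsum_closed[OF N wt]
        linear_maps_closed[OF h] linear_maps_add[OF h] linear_maps_smult[OF h])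
qed

subsection \<open>The diamond product as a weighted sum\<close>

lemma graft_ext_linear:
  assumes K: "cring K"
  shows "graft_ext K \<in> linear_maps K (forest_module K) (forest_module K)"
  unfolding graft_ext_def forest_module_def
  by (intro linear_extension_linear free_module_module basis_closed K) (simp add: forests_def)

lemma graft_ext_basis:
  assumes K: "cring K" and F: "F \<noteq> []"
  shows "graft_ext K (basis K forests F) = basis K forests [Node F]"
  unfolding graft_ext_def forest_module_def
  by (intro linear_extension_basis free_module_module basis_closed K) (simp_all add: F forests_def)

lemma between_ext_linear:
  assumes K: "cring K"
  shows "(\<lambda>x. between_ext K A x B) \<in> linear_maps K (forest_module K) (forest_module K)"
  unfolding between_ext_def forest_module_def
  by (intro linear_extension_linear free_module_module basis_closed K) (simp add: forests_def)

lemma between_ext_basis: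
  assumes K: "cring K" and F: "F \<noteq> []"
  shows "between_ext K A (basis K forests F) B = basis K forests (A @ F @ B)"
  unfolding between_ext_def forest_module_def
  by (intro linear_extension_basis free_module_module basis_closed K) (simp_all add: F forests_def)

lemma forest_prod_nonempty: "p \<in># forest_prod F G \<Longrightarrow> snd p \<noteq> []"
  using forest_prod_leaves[of "fst p" "snd p"] by simp

lemma diamond_eq_wsum_aux:
  assumes K: "cring K" and wt: "wt \<in> carrier K"
    and tree: "tree_diamond K wt (last F) (hd G) =
      wsum K wt (forest_module K) (\<lambda>T. basis K forests [T]) (tree_prod (last F) (hd G))"
  shows "diamond K wt F G = wsum K wt (forest_module K) (basis K forests) (forest_prod F G)"
proof (cases "F = [] \<or> G = []")
  case True
  have m: "module K (forest_module K)" unfolding forest_module_def by (rule free_module_module[OF K])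
  from True show ?thesis by (auto simp: wsum_empty[OF m wt] forest_prod.simps)
next
  case False
  have m: "module K (forest_module K)" unfolding forest_module_def by (rule free_module_module[OF K])
  have bc: "basis K forests X \<in> carrier (forest_module K)" if "X \<noteq> []" for X
    unfolding forest_module_def using that by (intro basis_closed K) (simp add: forests_def)
  have "diamond K wt F G = between_ext K (butlast F) (tree_diamond K wt (last F) (hd G)) (tl G)"
    using False by simp
  also have "\<dots> = wsum K wt (forest_module K) (\<lambda>T. between_ext K (butlast F) (basis K forests [T]) (tl G))
      (tree_prod (last F) (hd G))"
    unfolding tree by (rule linear_maps_wsum[OF m m wt between_ext_linear[OF K]]) (simp add: bc)
  also have "\<dots> = wsum K wt (forest_module K) (basis K forests) (forest_prod F G)"
    using False by (simp add: forest_prod.simps between_ext_basis[OF K] wsum_wmap[OF m wt] bc)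
  finally show ?thesis .
qed

declare tree_diamond.simps [simp del] diamond.simps [simp del]

lemma tree_diamond_eq_wsum:
  assumes K: "cring K" and wt: "wt \<in> carrier K"
  shows "tree_diamond K wt T U = wsum K wt (forest_module K) (\<lambda>T. basis K forests [T]) (tree_prod T U)"
proof (induction "vertices T + vertices U" arbitrary: T U rule: less_induct)
  case less
  obtain A B where TU: "T = Node A" "U = Node B" by (metis ptree.exhaust)
  have m: "module K (forest_module K)" unfolding forest_module_def by (rule free_module_module[OF K])
  have bc: "basis K forests X \<in> carrier (forest_module K)" if "X \<noteq> []" for X
    unfolding forest_module_def using that by (intro basis_closed K) (simp add: forests_def)
  show ?case
  proof (cases "A = [] \<or> B = []")
    case True
    then show ?thesis by (auto simp: TU tree_diamond.simps wsum_single[OF m wt] bc)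
  next
    case False
    have IH: "graft_ext K (diamond K wt F G) =
        wsum K wt (forest_module K) (\<lambda>X. basis K forests [Node X]) (forest_prod F G)"
      if "fvertices F + fvertices G < vertices T + vertices U" "F \<noteq> []" "G \<noteq> []" for F G
    proof -
      have "vertices (last F) + vertices (hd G) < vertices T + vertices U"
        using vertices_last_hd_le[of F G] that by linarith
      then have "graft_ext K (diamond K wt F G) =
          graft_ext K (wsum K wt (forest_module K) (basis K forests) (forest_prod F G))"
        using diamond_eq_wsum_aux[OF K wt less] by simp
      also have "\<dots> = wsum K wt (forest_module K) (\<lambda>X. graft_ext K (basis K forests X)) (forest_prod F G)"
        by (rule linear_maps_wsum[OF m m wt graft_ext_linear[OF K]]) (simp add: bc forest_prod_nonempty)
      also have "\<dots> = wsum K wt (forest_module K) (\<lambda>X. basis K forests [Node X]) (forest_prod F G)"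
        by (rule wsum_cong[OF m wt]) (auto simp: bc graft_ext_basis[OF K] dest: forest_prod_nonempty)
      finally show ?thesis .
    qed
    interpret cring K by (rule K)
    have "tree_diamond K wt T U =
        graft_ext K (diamond K wt [T] B) \<oplus>\<^bsub>forest_module K\<^esub> graft_ext K (diamond K wt A [U])
        \<oplus>\<^bsub>forest_module K\<^esub> wt \<odot>\<^bsub>forest_module K\<^esub> graft_ext K (diamond K wt A B)"
      using False by (simp add: TU tree_diamond.simps)
    also have "\<dots> = wsum K wt (forest_module K) (\<lambda>X. basis K forests [Node X])
        (forest_prod [T] B + forest_prod A [U] + wshift 1 (forest_prod A B))"
    proof -
      have "graft_ext K (diamond K wt [T] B) =
            wsum K wt (forest_module K) (\<lambda>X. basis K forests [Node X]) (forest_prod [T] B)"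
        "graft_ext K (diamond K wt A [U]) =
            wsum K wt (forest_module K) (\<lambda>X. basis K forests [Node X]) (forest_prod A [U])"
        "graft_ext K (diamond K wt A B) =
            wsum K wt (forest_module K) (\<lambda>X. basis K forests [Node X]) (forest_prod A B)"
        using False by (auto intro!: IH simp: TU)
      then show ?thesis
        by (simp add: wsum_add[OF m wt] wsum_wshift[OF m wt] bc wt del: forest_prod_single_Cons)
    qed
    also have "\<dots> = wsum K wt (forest_module K) (\<lambda>T. basis K forests [T]) (tree_prod T U)"
      using False by (simp add: TU tree_prod_Node wsum_wmap[OF m wt] bc del: wmap_simps wmap_wmap forest_prod_single_Cons)
    finally show ?thesis .
  qed
qed

text \<open>
  This carries the combinatorics of multisets over to the product of forests with coefficients in
  the ground ring.
\<close>

lemma diamond_eq_wsum: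
  assumes K: "cring K" and wt: "wt \<in> carrier K"
  shows "diamond K wt F G = wsum K wt (forest_module K) (basis K forests) (forest_prod F G)"
  by (rule diamond_eq_wsum_aux[OF K wt tree_diamond_eq_wsum[OF K wt]])

lemma wsum_zero:
  assumes N: "module K N" and wt: "wt \<in> carrier K"
  shows "\<forall>p\<in>#X. \<phi> (snd p) = \<zero>\<^bsub>N\<^esub> \<Longrightarrow> wsum K wt N \<phi> X = \<zero>\<^bsub>N\<^esub>"
proof (induction X)
  case empty then show ?case by (simp add: wsum_empty[OF N wt])
next
  case (add p X)
  interpret N: module K N by (rule N)
  show ?case using add wt by (cases p) (simp add: wsum_add_mset[OF N wt])
qed

text \<open>
  Evaluation at \<open>s\<close> is linear, so it can be moved inside the weighted sum.
\<close>

lemma wsum_basis_outside: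
  assumes K: "cring K" and wt: "wt \<in> carrier K" and X: "\<forall>p\<in>#X. snd p \<in> S"
    and s: "s \<in> S" "\<forall>p\<in>#X. snd p \<noteq> s"
  shows "wsum K wt (free_module K S) (basis K S) X s = \<zero>\<^bsub>K\<^esub>"
proof -
  interpret cring K by (rule K)
  have ev: "(\<lambda>x. x s) \<in> linear_maps K (free_module K S) (ring_module K)"
    using s(1) by (intro linear_mapsI) (auto simp: free_module_def)
  have "wsum K wt (free_module K S) (basis K S) X s =
      wsum K wt (ring_module K) (\<lambda>t. basis K S t s) X"
    by (rule linear_maps_wsum[OF free_module_module[OF K] ring_module_module[OF K] wt ev])
      (use X in \<open>auto intro: basis_closed[OF K]\<close>)
  also have "\<dots> = \<zero>\<^bsub>ring_module K\<^esub>"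
    by (rule wsum_zero[OF ring_module_module[OF K] wt])
      (use s in \<open>auto simp: basis_def summand_def\<close>)
  finally show ?thesis by simp
qed

text \<open>
  A linear extension may be computed with other values outside the support of its argument,
  in case the given values do not lie in the module there.
\<close>

lemma linear_extension_cong_support:
  assumes B: "module K B" and "\<And>s. \<lbrakk>s \<in> S; x s \<noteq> \<zero>\<^bsub>K\<^esub>\<rbrakk> \<Longrightarrow> \<phi> s = \<psi> s"
    and "\<And>s. s \<in> S \<Longrightarrow> \<psi> s \<in> carrier B" and x: "x \<in> carrier (free_module K S)"
  shows "linear_extension K S B \<phi> x = linear_extension K S B \<psi> x"
proof -
  interpret B: module K B by (rule B)
  show ?thesis
    unfolding linear_extension_def
    using assms(2,3) x by (intro B.finsum_cong') (auto simp: free_module_def PiE_iff)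
qed

lemma leaves_graft: "F \<noteq> [] \<Longrightarrow> leaves [Node F] = leaves F"
  by (simp add: tree_leaves_Node)

lemma forest_prod_in:
  assumes "F \<in> ladder_free_forests" "G \<in> ladder_free_forests" "p \<in># forest_prod F G"
  shows "snd p \<in> ladder_free_forests" "leaves (snd p) - 1 = (leaves F - 1) + (leaves G - 1)"
proof -
  have p: "(fst p, snd p) \<in># forest_prod F G" using assms(3) by simp
  show "snd p \<in> ladder_free_forests" by (rule forest_prod_ladder_free[OF p assms(1,2)])
  have "0 < leaves F" "0 < leaves G" using assms by (auto simp: ladder_free_forests_iff leaves_pos)
  then show "leaves (snd p) - 1 = (leaves F - 1) + (leaves G - 1)"
    using forest_prod_leaves[OF p] by linarith
qed

lemma bullets_ladder_free: "[bullet, bullet] \<in> ladder_free_forests" "leaves [bullet, bullet] - 1 = 1"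
  by (auto simp: ladder_free_forests_iff tree_leaves_Node)

lemma module_mult_update: "module K N \<Longrightarrow> module K (N\<lparr>mult := m\<rparr>)"
  by (simp add: module_def abelian_group_def abelian_group_axioms_def abelian_monoid_def module_axioms_def)

section \<open>The module of decorated forests\<close>

context
  fixes K :: "('k, 'c) ring_scheme" and M :: "('k, 'm, 'd) module_scheme" and wt :: 'k
  assumes K: "cring K" and wt: "wt \<in> carrier K" and M: "module K M"
begin

interpretation M: module K M by (rule M)

abbreviation (input) "Sh \<equiv> ShNC0_module K M"
abbreviation (input) "mul \<equiv> ShNC0_mult K wt M"
abbreviation (input) "Op \<equiv> ShNC0_operator K M"

lemma decorations_module: "module K (decorations K M F)"
  unfolding decorations_def by (rule tensor_power_module[OF M])

lemma Sh_module: "module K Sh"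
  unfolding ShNC0_module_def by (rule direct_sum_module[OF K decorations_module])

interpretation Sh: module K Sh by (rule Sh_module)

lemma decorated_linear:
  "F \<in> ladder_free_forests \<Longrightarrow> decorated K M F \<in> linear_maps K (tensor_power K M (leaves F - 1)) Sh"
  unfolding decorated_def ShNC0_module_def decorations_def[symmetric]
  by (rule summand_linear[OF K decorations_module])

definition dec :: "forest \<Rightarrow> 'm list \<Rightarrow> forest \<Rightarrow> ('m list \<Rightarrow> 'k) set"
  where "dec F xs = decorated K M F (pure_tensor K M xs)"

definition decs :: "(forest \<Rightarrow> ('m list \<Rightarrow> 'k) set) set"
  where "decs = {dec F xs | F xs. F \<in> ladder_free_forests \<and> xs \<in> tuples M (leaves F - 1)}"

lemma dec_closed:
  "\<lbrakk>F \<in> ladder_free_forests; xs \<in> tuples M (leaves F - 1)\<rbrakk> \<Longrightarrow> dec F xs \<in> carrier Sh"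
  unfolding dec_def by (intro linear_maps_closed[OF decorated_linear] pure_tensor_closed[OF M])

lemma Sh_generates: "generates K Sh decs"
proof -
  have "decs = (\<Union>F\<in>ladder_free_forests. summand ladder_free_forests (decorations K M) F `
      (pure_tensor K M ` tuples M (leaves F - 1)))"
    by (auto simp: decs_def dec_def decorated_def)
  then show ?thesis
    unfolding ShNC0_module_def
    using direct_sum_generates[where N = "decorations K M" and I = ladder_free_forests
        and S = "\<lambda>F. pure_tensor K M ` tuples M (leaves F - 1)", OF K decorations_module]
      tensor_power_generates[OF M]
    by (simp add: decorations_def)
qed

lemma dec_multilinear:
  assumes F: "F \<in> ladder_free_forests"
  shows "dec F \<in> multilinear_maps K M (leaves F - 1) Sh"
proof -
  have "(\<lambda>a. dec F (xs @ [a] @ ys)) \<in> linear_maps K M Sh"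
    if "set xs \<subseteq> carrier M" "set ys \<subseteq> carrier M" "length xs + 1 + length ys = leaves F - 1" for xs ys
    unfolding dec_def
    by (rule linear_maps_compose[OF _ decorated_linear[OF F]])
      (use pure_tensor_multilinear[OF M, of "leaves F - 1"] that in \<open>auto simp: multilinear_maps_def\<close>)
  then show ?thesis
    using dec_closed[OF F] by (simp add: multilinear_maps_def)
qed

text \<open>
  The universal properties of direct sums and tensor powers combine: a linear map on decorated
  forests is given by one multilinear map of the decorations for each forest.
\<close>

lemma Sh_lift:
  assumes B: "module K B"
    and \<phi>: "\<And>F. F \<in> ladder_free_forests \<Longrightarrow> \<phi> F \<in> multilinear_maps K M (leaves F - 1) B"
  shows "\<exists>h\<in>linear_maps K Sh B. \<forall>F\<in>ladder_free_forests. \<forall>xs\<in>tuples M (leaves F - 1). h (dec F xs) = \<phi> F xs"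
proof -
  have "\<forall>F\<in>ladder_free_forests. \<exists>g. g \<in> linear_maps K (decorations K M F) B \<and>
      (\<forall>xs\<in>tuples M (leaves F - 1). g (pure_tensor K M xs) = \<phi> F xs)"
    using tensor_power_lift[OF M B \<phi>] by (fastforce simp: decorations_def)
  then obtain g where gl: "\<And>F. F \<in> ladder_free_forests \<Longrightarrow> g F \<in> linear_maps K (decorations K M F) B"
    and g: "\<And>F xs. \<lbrakk>F \<in> ladder_free_forests; xs \<in> tuples M (leaves F - 1)\<rbrakk> \<Longrightarrow> g F (pure_tensor K M xs) = \<phi> F xs"
    by metis
  let ?h = "\<lambda>u. \<Oplus>\<^bsub>B\<^esub>F\<in>{F \<in> ladder_free_forests. u F \<noteq> \<zero>\<^bsub>decorations K M F\<^esub>}. g F (u F)"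
  have hl: "?h \<in> linear_maps K Sh B"
    unfolding ShNC0_module_def by (rule direct_sum_lift[OF K decorations_module B gl])
  have "?h (dec F xs) = \<phi> F xs"
    if F: "F \<in> ladder_free_forests" and xs: "xs \<in> tuples M (leaves F - 1)" for F xs
  proof -
    have px: "pure_tensor K M xs \<in> carrier (decorations K M F)"
      unfolding decorations_def by (rule pure_tensor_closed[OF M xs])
    show ?thesis
      unfolding dec_def decorated_def g[OF F xs, symmetric]
      by (rule direct_sum_lift_summand[where N = "decorations K M" and h = g,
            OF K decorations_module B gl[OF F] F px])
  qed
  then show ?thesis by (intro bexI[OF _ hl] ballI)
qed

section \<open>The operator on decorated forests\<close>

lemma operator_aux:
  assumes F: "F \<in> ladder_free_forests"
  shows "decorated K M [Node F] \<in> linear_maps K (decorations K M F) Sh"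
proof -
  have "F \<noteq> []" using F by (simp add: ladder_free_forests_iff)
  then show ?thesis
    using decorated_linear[OF graft_ladder_free[OF F]] by (simp add: decorations_def leaves_graft del: leaves_simps)
qed

lemma operator_linear: "Op \<in> linear_maps K Sh Sh"
  unfolding ShNC0_operator_def [abs_def] decorated_support_def
  using direct_sum_lift[where N = "decorations K M" and h = "\<lambda>F. decorated K M [Node F]", OF K decorations_module Sh_module operator_aux]
  unfolding ShNC0_module_def by simp

lemma operator_dec:
  assumes F: "F \<in> ladder_free_forests" and xs: "xs \<in> tuples M (leaves F - 1)"
  shows "Op (dec F xs) = dec [Node F] xs"
proof -
  have px: "pure_tensor K M xs \<in> carrier (decorations K M F)"
    unfolding decorations_def by (rule pure_tensor_closed[OF M xs])
  have *: "decorated K M F = summand ladder_free_forests (decorations K M) F"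
    by (simp add: decorated_def)
  show ?thesis
    unfolding ShNC0_operator_def decorated_support_def dec_def *
    by (rule direct_sum_lift_summand[where N = "decorations K M" and h = "\<lambda>F. decorated K M [Node F]",
          OF K decorations_module Sh_module operator_aux[OF F] F px])
qed

section \<open>The product of decorated forests\<close>

lemma decorated_ext_diamond:
  assumes F: "F \<in> ladder_free_forests" and G: "G \<in> ladder_free_forests"
    and m: "m \<in> carrier (tensor_power K M ((leaves F - 1) + (leaves G - 1)))"
  shows "decorated_ext K M (diamond K wt F G) m = wsum K wt Sh (\<lambda>X. decorated K M X m) (forest_prod F G)"
proof -
  let ?ok = "\<lambda>X. X \<in> ladder_free_forests \<and> leaves X - 1 = (leaves F - 1) + (leaves G - 1)"
  \<comment> \<open>A decoration \<open>m\<close> fits only forests with the right number of leaves.  Zero in the other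
    places makes the extension linear on all combinations of forests.\<close>
  define \<phi> where "\<phi> X = (if ?ok X then decorated K M X m else \<zero>\<^bsub>Sh\<^esub>)" for X
  have \<phi>c: "\<phi> X \<in> carrier Sh" for X
    using linear_maps_closed[OF decorated_linear, of X m] m by (auto simp: \<phi>_def)
  note fm = free_module_module[OF K, of forests]
  have bc: "\<forall>p\<in>#forest_prod F G. basis K forests (snd p) \<in> carrier (free_module K forests)"
    by (auto simp: forests_def intro!: basis_closed[OF K] dest: forest_prod_nonempty)
  have D: "diamond K wt F G = wsum K wt (free_module K forests) (basis K forests) (forest_prod F G)"
    using diamond_eq_wsum[OF K wt] by (simp add: forest_module_def)
  note L = linear_extension_linear[OF Sh_module, of forests \<phi>, OF \<phi>c]
  have "decorated_ext K M (diamond K wt F G) m = linear_extension K forests Sh \<phi> (diamond K wt F G)"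
    unfolding decorated_ext_def
  proof (rule linear_extension_cong_support[OF Sh_module _ \<phi>c])
    fix X assume X: "X \<in> forests" "diamond K wt F G X \<noteq> \<zero>\<^bsub>K\<^esub>"
    have "\<exists>p\<in>#forest_prod F G. snd p = X"
    proof (rule ccontr)
      assume "\<not> (\<exists>p\<in>#forest_prod F G. snd p = X)"
      then have "diamond K wt F G X = \<zero>\<^bsub>K\<^esub>"
        unfolding D using X(1)
        by (intro wsum_basis_outside[OF K wt]) (auto simp: forests_def dest: forest_prod_nonempty)
      then show False using X(2) by simp
    qed
    then show "decorated K M X m = \<phi> X" using forest_prod_in[OF F G] by (auto simp: \<phi>_def)
  qed (use bc in \<open>auto simp: D intro: wsum_closed[OF fm wt]\<close>)
  also have "\<dots> = wsum K wt Sh (\<lambda>X. linear_extension K forests Sh \<phi> (basis K forests X)) (forest_prod F G)"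
    unfolding D by (rule linear_maps_wsum[OF fm Sh_module wt L bc])
  also have "\<dots> = wsum K wt Sh (\<lambda>X. decorated K M X m) (forest_prod F G)"
  proof (rule wsum_cong[OF Sh_module wt]; intro ballI)
    fix p assume p: "p \<in># forest_prod F G"
    then have ok: "?ok (snd p)" using forest_prod_in[OF F G] by blast
    show "decorated K M (snd p) m \<in> carrier Sh"
      using \<phi>c[of "snd p"] ok by (simp add: \<phi>_def)
    show "linear_extension K forests Sh \<phi> (basis K forests (snd p)) = decorated K M (snd p) m"
      using linear_extension_basis[OF Sh_module, of \<phi> "snd p" forests, OF \<phi>c] ok forest_prod_nonempty[OF p]
      by (auto simp: \<phi>_def forests_def)
  qed
  finally show ?thesis .
qed

text \<open>
  The component of the product that is indexed by a pair of forests.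
\<close>

definition dec_mult ::
    "forest \<Rightarrow> forest \<Rightarrow> ('m list \<Rightarrow> 'k) set \<Rightarrow> ('m list \<Rightarrow> 'k) set \<Rightarrow> forest \<Rightarrow> ('m list \<Rightarrow> 'k) set"
  where "dec_mult F G X Y =
    decorated_ext K M (diamond K wt F G) (tensor_mult K M (leaves F - 1) (leaves G - 1) X Y)"

lemma decorated_ext_linear:
  assumes F: "F \<in> ladder_free_forests" and G: "G \<in> ladder_free_forests"
  shows "decorated_ext K M (diamond K wt F G)
    \<in> linear_maps K (tensor_power K M ((leaves F - 1) + (leaves G - 1))) Sh"
proof (rule linear_maps_cong[OF tensor_power_module[OF M] _ decorated_ext_diamond[OF F G]])
  show "(\<lambda>m. wsum K wt Sh (\<lambda>X. decorated K M X m) (forest_prod F G))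
      \<in> linear_maps K (tensor_power K M (leaves F - 1 + (leaves G - 1))) Sh"
    using forest_prod_in[OF F G] decorated_linear
    by (intro wsum_linear[OF Sh_module wt] tensor_power_module[OF M]) fastforce
qed

lemma dec_mult_left_linear:
  assumes F: "F \<in> ladder_free_forests" and G: "G \<in> ladder_free_forests" and Y: "Y \<in> carrier (decorations K M G)"
  shows "(\<lambda>X. dec_mult F G X Y) \<in> linear_maps K (decorations K M F) Sh"
  unfolding dec_mult_def decorations_def
  by (rule linear_maps_compose[OF tensor_mult_left_linear[OF M] decorated_ext_linear[OF F G]])
    (use Y in \<open>simp add: decorations_def\<close>)

lemma dec_mult_right_linear:
  assumes F: "F \<in> ladder_free_forests" and G: "G \<in> ladder_free_forests" and X: "X \<in> carrier (decorations K M F)"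
  shows "dec_mult F G X \<in> linear_maps K (decorations K M G) Sh"
  unfolding dec_mult_def [abs_def] decorations_def
  by (rule linear_maps_compose[OF tensor_mult_right_linear[OF M] decorated_ext_linear[OF F G]])
    (use X in \<open>simp add: decorations_def\<close>)

lemma ShNC0_mult_eq:
  "mul u v =
    (\<Oplus>\<^bsub>Sh\<^esub>F\<in>{F \<in> ladder_free_forests. u F \<noteq> \<zero>\<^bsub>decorations K M F\<^esub>}.
      \<Oplus>\<^bsub>Sh\<^esub>G\<in>{G \<in> ladder_free_forests. v G \<noteq> \<zero>\<^bsub>decorations K M G\<^esub>}. dec_mult F G (u F) (v G))"
  by (simp add: ShNC0_mult_def dec_mult_def decorated_support_def)

lemma Sh_component: "\<lbrakk>u \<in> carrier Sh; F \<in> ladder_free_forests\<rbrakk> \<Longrightarrow> u F \<in> carrier (decorations K M F)"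
  unfolding ShNC0_module_def by auto

lemma Sh_support_finite: "u \<in> carrier Sh \<Longrightarrow> finite {F \<in> ladder_free_forests. u F \<noteq> \<zero>\<^bsub>decorations K M F\<^esub>}"
  unfolding ShNC0_module_def by auto

lemma mult_left_linear:
  assumes v: "v \<in> carrier Sh"
  shows "(\<lambda>u. mul u v) \<in> linear_maps K Sh Sh"
proof -
  let ?h = "\<lambda>F X. \<Oplus>\<^bsub>Sh\<^esub>G\<in>{G \<in> ladder_free_forests. v G \<noteq> \<zero>\<^bsub>decorations K M G\<^esub>}. dec_mult F G X (v G)"
  have "?h F \<in> linear_maps K (decorations K M F) Sh" if "F \<in> ladder_free_forests" for F
    using that v
    by (intro linear_maps_finsum[OF Sh_module] dec_mult_left_linear Sh_support_finite Sh_component) auto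
  then show ?thesis
    unfolding ShNC0_mult_eq
    using direct_sum_lift[where N = "decorations K M" and h = ?h, OF K decorations_module Sh_module]
    unfolding ShNC0_module_def by simp
qed

lemma mult_right_linear:
  assumes u: "u \<in> carrier Sh"
  shows "mul u \<in> linear_maps K Sh Sh"
  unfolding ShNC0_mult_eq [abs_def]
proof (rule linear_maps_finsum[OF Sh_module Sh_support_finite[OF u]])
  fix F assume "F \<in> {F \<in> ladder_free_forests. u F \<noteq> \<zero>\<^bsub>decorations K M F\<^esub>}"
  then have F: "F \<in> ladder_free_forests" by simp
  have "(\<lambda>v. \<Oplus>\<^bsub>Sh\<^esub>G\<in>{G \<in> ladder_free_forests. v G \<noteq> \<zero>\<^bsub>decorations K M G\<^esub>}. dec_mult F G (u F) (v G))
      \<in> linear_maps K (direct_sum ladder_free_forests (decorations K M)) Sh"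
    by (rule direct_sum_lift[OF K decorations_module Sh_module])
      (rule dec_mult_right_linear[OF F _ Sh_component[OF u F]])
  then show "(\<lambda>v. \<Oplus>\<^bsub>Sh\<^esub>G\<in>{G \<in> ladder_free_forests. v G \<noteq> \<zero>\<^bsub>decorations K M G\<^esub>}. dec_mult F G (u F) (v G))
      \<in> linear_maps K Sh Sh"
    by (simp add: ShNC0_module_def)
qed

lemma mult_closed: "\<lbrakk>u \<in> carrier Sh; v \<in> carrier Sh\<rbrakk> \<Longrightarrow> mul u v \<in> carrier Sh"
  by (rule linear_maps_closed[OF mult_right_linear])

text \<open>
  On generators the product of decorated forests is thereby reduced to multisets of forests and to
  concatenation of decorations.
\<close>

lemma mult_dec:
  assumes F: "F \<in> ladder_free_forests" and xs: "xs \<in> tuples M (leaves F - 1)"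
    and G: "G \<in> ladder_free_forests" and ys: "ys \<in> tuples M (leaves G - 1)"
  shows "mul (dec F xs) (dec G ys) = wsum K wt Sh (\<lambda>X. dec X (xs @ ys)) (forest_prod F G)"
proof -
  have px: "pure_tensor K M xs \<in> carrier (decorations K M F)"
    and py: "pure_tensor K M ys \<in> carrier (decorations K M G)"
    unfolding decorations_def by (rule pure_tensor_closed[OF M xs], rule pure_tensor_closed[OF M ys])
  let ?h = "\<lambda>F X. \<Oplus>\<^bsub>Sh\<^esub>G'\<in>{G' \<in> ladder_free_forests. dec G ys G' \<noteq> \<zero>\<^bsub>decorations K M G'\<^esub>}. dec_mult F G' X (dec G ys G')"
  have hl: "?h F \<in> linear_maps K (decorations K M F) Sh"
    using dec_closed[OF G ys] F
    by (intro linear_maps_finsum[OF Sh_module] dec_mult_left_linear Sh_support_finite Sh_component) auto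
  have "mul (dec F xs) (dec G ys) = ?h F (pure_tensor K M xs)"
    unfolding ShNC0_mult_eq dec_def[of F] decorated_def
    by (rule direct_sum_lift_summand[where N = "decorations K M" and h = ?h, OF K decorations_module Sh_module hl F px])
  also have "\<dots> = dec_mult F G (pure_tensor K M xs) (pure_tensor K M ys)"
    unfolding dec_def decorated_def
    by (rule direct_sum_lift_summand[where N = "decorations K M" and h = "\<lambda>G. dec_mult F G (pure_tensor K M xs)",
        OF K decorations_module Sh_module dec_mult_right_linear[OF F G px] G py])
  also have "\<dots> = decorated_ext K M (diamond K wt F G) (pure_tensor K M (xs @ ys))"
    unfolding dec_mult_def tensor_mult_pure[OF M xs ys] ..
  also have "\<dots> = wsum K wt Sh (\<lambda>X. dec X (xs @ ys)) (forest_prod F G)"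
    unfolding dec_def
    by (rule decorated_ext_diamond[OF F G pure_tensor_closed[OF M append_tuples[OF M xs ys]]])
  finally show ?thesis .
qed

lemma dec_forest_prod_closed:
  assumes "F \<in> ladder_free_forests" "xs \<in> tuples M (leaves F - 1)"
    and "G \<in> ladder_free_forests" "ys \<in> tuples M (leaves G - 1)"
  shows "\<forall>p\<in>#forest_prod F G. dec (snd p) (xs @ ys) \<in> carrier Sh"
  using forest_prod_in[OF assms(1,3)] append_tuples[OF M assms(2,4)] by (simp add: dec_closed)

lemma mult_assoc_dec:
  assumes F: "F \<in> ladder_free_forests" and xs: "xs \<in> tuples M (leaves F - 1)"
    and G: "G \<in> ladder_free_forests" and ys: "ys \<in> tuples M (leaves G - 1)"
    and H: "H \<in> ladder_free_forests" and zs: "zs \<in> tuples M (leaves H - 1)"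
  shows "mul (mul (dec F xs) (dec G ys)) (dec H zs) =
    mul (dec F xs) (mul (dec G ys) (dec H zs))"
proof -
  note xys = append_tuples[OF M xs ys] and yzs = append_tuples[OF M ys zs]
  have ne: "F \<noteq> []" "G \<noteq> []" "H \<noteq> []" using F G H by (auto simp: ladder_free_forests_iff)
  have l: "\<forall>p\<in>#forest_prod F G. \<forall>q\<in>#forest_prod (snd p) H. dec (snd q) (xs @ ys @ zs) \<in> carrier Sh"
  proof
    fix p assume p: "p \<in># forest_prod F G"
    show "\<forall>q\<in>#forest_prod (snd p) H. dec (snd q) (xs @ ys @ zs) \<in> carrier Sh"
      using dec_forest_prod_closed[OF forest_prod_in(1)[OF F G p] _ H zs, of "xs @ ys"] xys
      unfolding forest_prod_in(2)[OF F G p] append_assoc by blast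
  qed
  have r: "\<forall>p\<in>#forest_prod G H. \<forall>q\<in>#forest_prod F (snd p). dec (snd q) (xs @ ys @ zs) \<in> carrier Sh"
  proof
    fix p assume p: "p \<in># forest_prod G H"
    show "\<forall>q\<in>#forest_prod F (snd p). dec (snd q) (xs @ ys @ zs) \<in> carrier Sh"
      using dec_forest_prod_closed[OF F xs forest_prod_in(1)[OF G H p], of "ys @ zs"] yzs
      unfolding forest_prod_in(2)[OF G H p] by blast
  qed
  have "mul (mul (dec F xs) (dec G ys)) (dec H zs) =
      wsum K wt Sh (\<lambda>X. mul (dec X (xs @ ys)) (dec H zs)) (forest_prod F G)"
    unfolding mult_dec[OF F xs G ys]
    by (rule linear_maps_wsum[OF Sh_module Sh_module wt mult_left_linear[OF dec_closed[OF H zs]]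
        dec_forest_prod_closed[OF F xs G ys]])
  also have "\<dots> = wsum K wt Sh (\<lambda>X. wsum K wt Sh (\<lambda>Y. dec Y (xs @ ys @ zs)) (forest_prod X H)) (forest_prod F G)"
  proof (rule wsum_cong[OF Sh_module wt]; intro ballI)
    fix p assume p: "p \<in># forest_prod F G"
    show "wsum K wt Sh (\<lambda>Y. dec Y (xs @ ys @ zs)) (forest_prod (snd p) H) \<in> carrier Sh"
      using l p by (intro wsum_closed[OF Sh_module wt]) blast
    show "mul (dec (snd p) (xs @ ys)) (dec H zs) = wsum K wt Sh (\<lambda>Y. dec Y (xs @ ys @ zs)) (forest_prod (snd p) H)"
      using mult_dec[OF forest_prod_in(1)[OF F G p] _ H zs, of "xs @ ys"] xys
      unfolding forest_prod_in(2)[OF F G p] append_assoc by blast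
  qed
  also have "\<dots> = wsum K wt Sh (\<lambda>Y. dec Y (xs @ ys @ zs)) (wbind (forest_prod F G) (\<lambda>X. forest_prod X H))"
    by (rule wsum_wbind[OF Sh_module wt l, symmetric])
  also have "\<dots> = wsum K wt Sh (\<lambda>Y. dec Y (xs @ ys @ zs)) (wbind (forest_prod G H) (\<lambda>X. forest_prod F X))"
    unfolding forest_prod_assoc[OF ne] ..
  also have "\<dots> = wsum K wt Sh (\<lambda>X. wsum K wt Sh (\<lambda>Y. dec Y (xs @ ys @ zs)) (forest_prod F X)) (forest_prod G H)"
    by (rule wsum_wbind[OF Sh_module wt r])
  also have "\<dots> = wsum K wt Sh (\<lambda>X. mul (dec F xs) (dec X (ys @ zs))) (forest_prod G H)"
  proof (rule wsum_cong[OF Sh_module wt]; intro ballI)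
    fix p assume p: "p \<in># forest_prod G H"
    have "dec (snd p) (ys @ zs) \<in> carrier Sh" using dec_forest_prod_closed[OF G ys H zs] p by blast
    then show "mul (dec F xs) (dec (snd p) (ys @ zs)) \<in> carrier Sh"
      by (rule mult_closed[OF dec_closed[OF F xs]])
    show "wsum K wt Sh (\<lambda>Y. dec Y (xs @ ys @ zs)) (forest_prod F (snd p)) = mul (dec F xs) (dec (snd p) (ys @ zs))"
      using mult_dec[OF F xs forest_prod_in(1)[OF G H p], of "ys @ zs"] yzs
      unfolding forest_prod_in(2)[OF G H p] by simp
  qed
  also have "\<dots> = mul (dec F xs) (mul (dec G ys) (dec H zs))"
    unfolding mult_dec[OF G ys H zs]
    by (rule linear_maps_wsum[OF Sh_module Sh_module wt mult_right_linear[OF dec_closed[OF F xs]]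
        dec_forest_prod_closed[OF G ys H zs], symmetric])
  finally show ?thesis .
qed

lemma mult_assoc:
  assumes u: "u \<in> carrier Sh" and v: "v \<in> carrier Sh" and w: "w \<in> carrier Sh"
  shows "mul (mul u v) w = mul u (mul v w)"
proof (rule linear_maps_agree[OF Sh_module Sh_generates Sh_module _ _ _ w])
  show "mul (mul u v) \<in> linear_maps K Sh Sh" by (intro mult_right_linear mult_closed u v)
  show "(\<lambda>w. mul u (mul v w)) \<in> linear_maps K Sh Sh"
    by (rule linear_maps_compose[OF mult_right_linear[OF v] mult_right_linear[OF u]])
  fix s assume s: "s \<in> decs"
  then have sc: "s \<in> carrier Sh" by (rule generates_closed[OF Sh_generates])
  show "mul (mul u v) s = mul u (mul v s)"
  proof (rule bilinear_agree[OF Sh_module Sh_generates Sh_module Sh_generates Sh_module _ _ _ _ _ u v])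
    fix y assume y: "y \<in> carrier Sh"
    show "(\<lambda>x. mul (mul x y) s) \<in> linear_maps K Sh Sh"
      by (rule linear_maps_compose[OF mult_left_linear[OF y] mult_left_linear[OF sc]])
    show "(\<lambda>x. mul x (mul y s)) \<in> linear_maps K Sh Sh"
      by (intro mult_left_linear mult_closed y sc)
  next
    fix x assume x: "x \<in> carrier Sh"
    show "(\<lambda>y. mul (mul x y) s) \<in> linear_maps K Sh Sh"
      by (rule linear_maps_compose[OF mult_right_linear[OF x] mult_left_linear[OF sc]])
    show "(\<lambda>y. mul x (mul y s)) \<in> linear_maps K Sh Sh"
      by (rule linear_maps_compose[OF mult_left_linear[OF sc] mult_right_linear[OF x]])
  next
    fix a b assume "a \<in> decs" "b \<in> decs"
    then show "mul (mul a b) s = mul a (mul b s)" using s unfolding decs_def by (auto simp: mult_assoc_dec)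
  qed
qed

section \<open>The Rota--Baxter identity\<close>

text \<open>
  For two grafted forests the recursion that defines the product of trees is the Rota--Baxter
  identity.
\<close>

lemma rota_baxter_dec:
  assumes F: "F \<in> ladder_free_forests" and xs: "xs \<in> tuples M (leaves F - 1)"
    and G: "G \<in> ladder_free_forests" and ys: "ys \<in> tuples M (leaves G - 1)"
  shows "mul (Op (dec F xs)) (Op (dec G ys)) =
    Op (mul (Op (dec F xs)) (dec G ys) \<oplus>\<^bsub>Sh\<^esub>
      mul (dec F xs) (Op (dec G ys)) \<oplus>\<^bsub>Sh\<^esub>
      wt \<odot>\<^bsub>Sh\<^esub> mul (dec F xs) (dec G ys))"
proof -
  let ?Y = "forest_prod [Node F] G + forest_prod F [Node G] + wshift 1 (forest_prod F G)"
  let ?d = "\<lambda>X. dec X (xs @ ys)"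
  have ne: "F \<noteq> []" "G \<noteq> []" using F G by (auto simp: ladder_free_forests_iff)
  note F1 = graft_ladder_free[OF F] and G1 = graft_ladder_free[OF G]
  have xs1: "xs \<in> tuples M (leaves [Node F] - 1)" and ys1: "ys \<in> tuples M (leaves [Node G] - 1)"
    unfolding leaves_graft[OF ne(1)] leaves_graft[OF ne(2)] by (fact xs ys)+
  have c: "\<forall>p\<in>#forest_prod [Node F] G. ?d (snd p) \<in> carrier Sh"
    "\<forall>p\<in>#forest_prod F [Node G]. ?d (snd p) \<in> carrier Sh"
    "\<forall>p\<in>#forest_prod F G. ?d (snd p) \<in> carrier Sh"
    by (intro dec_forest_prod_closed F G F1 G1 xs ys xs1 ys1)+
  have cs: "\<forall>p\<in>#wshift 1 (forest_prod F G). ?d (snd p) \<in> carrier Sh"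
    using c(3) by (auto simp: wshift_def)
  have cY: "\<forall>p\<in>#?Y. ?d (snd p) \<in> carrier Sh" using c cs by auto
  have PY: "\<forall>p\<in>#?Y. Op (?d (snd p)) = dec [Node (snd p)] (xs @ ys)"
  proof (intro ballI)
    fix p assume "p \<in># ?Y"
    then consider "p \<in># forest_prod [Node F] G" | "p \<in># forest_prod F [Node G]"
      | q where "q \<in># forest_prod F G" "snd p = snd q"
      by (auto simp: wshift_def)
    then have "snd p \<in> ladder_free_forests \<and> leaves (snd p) - 1 = (leaves F - 1) + (leaves G - 1)"
    proof cases
      case 1 then show ?thesis using forest_prod_in[OF F1 G 1] unfolding leaves_graft[OF ne(1)] by blast
    next
      case 2 then show ?thesis using forest_prod_in[OF F G1 2] unfolding leaves_graft[OF ne(2)] by blast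
    next
      case 3 then show ?thesis using forest_prod_in[OF F G 3(1)] by simp
    qed
    then show "Op (?d (snd p)) = dec [Node (snd p)] (xs @ ys)"
      using append_tuples[OF M xs ys] by (intro operator_dec) auto
  qed
  have cN: "\<forall>p\<in>#?Y. dec [Node (snd p)] (xs @ ys) \<in> carrier Sh"
    using PY cY linear_maps_closed[OF operator_linear] by metis
  have "mul (Op (dec F xs)) (Op (dec G ys)) = wsum K wt Sh ?d (forest_prod [Node F] [Node G])"
    unfolding operator_dec[OF F xs] operator_dec[OF G ys] by (rule mult_dec[OF F1 xs1 G1 ys1])
  also have "forest_prod [Node F] [Node G] = wmap (\<lambda>X. [Node X]) ?Y"
    using ne by (simp add: tree_prod_Node)
  also have "wsum K wt Sh ?d (wmap (\<lambda>X. [Node X]) ?Y) = wsum K wt Sh (\<lambda>X. dec [Node X] (xs @ ys)) ?Y"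
    by (rule wsum_wmap[OF Sh_module wt]) (rule cN)
  also have "\<dots> = wsum K wt Sh (\<lambda>X. Op (?d X)) ?Y"
  proof (rule wsum_cong[OF Sh_module wt]; intro ballI)
    fix p assume p: "p \<in># ?Y"
    show "Op (?d (snd p)) \<in> carrier Sh" using PY cN p by metis
    show "dec [Node (snd p)] (xs @ ys) = Op (?d (snd p))" using PY p by metis
  qed
  also have "\<dots> = Op (wsum K wt Sh ?d ?Y)"
    by (rule linear_maps_wsum[OF Sh_module Sh_module wt operator_linear cY, symmetric])
  also have "wsum K wt Sh ?d ?Y = mul (Op (dec F xs)) (dec G ys) \<oplus>\<^bsub>Sh\<^esub>
      mul (dec F xs) (Op (dec G ys)) \<oplus>\<^bsub>Sh\<^esub> wt \<odot>\<^bsub>Sh\<^esub> mul (dec F xs) (dec G ys)"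
    unfolding operator_dec[OF F xs] operator_dec[OF G ys] mult_dec[OF F1 xs1 G ys]
      mult_dec[OF F xs G1 ys1] mult_dec[OF F xs G ys]
    using c cs wt by (simp add: wsum_add[OF Sh_module wt] wsum_wshift[OF Sh_module wt] ball_Un
        del: forest_prod_single_Cons)
  finally show ?thesis .
qed

lemma rota_baxter_identity:
  assumes u: "u \<in> carrier Sh" and v: "v \<in> carrier Sh"
  shows "mul (Op u) (Op v) =
    Op (mul (Op u) v \<oplus>\<^bsub>Sh\<^esub>
      mul u (Op v) \<oplus>\<^bsub>Sh\<^esub> wt \<odot>\<^bsub>Sh\<^esub> mul u v)"
proof (rule bilinear_agree[OF Sh_module Sh_generates Sh_module Sh_generates Sh_module _ _ _ _ _ u v])
  note Pl = operator_linear and Pc = linear_maps_closed[OF operator_linear]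
  note mr = mult_right_linear and ml = mult_left_linear
  fix y assume y: "y \<in> carrier Sh"
  show "(\<lambda>x. mul (Op x) (Op y)) \<in> linear_maps K Sh Sh"
    by (rule linear_maps_compose[OF Pl ml[OF Pc[OF y]]])
  show "(\<lambda>x. Op (mul (Op x) y \<oplus>\<^bsub>Sh\<^esub> mul x (Op y) \<oplus>\<^bsub>Sh\<^esub> wt \<odot>\<^bsub>Sh\<^esub> mul x y)) \<in> linear_maps K Sh Sh"
    by (intro linear_maps_compose[OF _ Pl] linear_maps_plus[OF Sh_module] linear_maps_scale[OF Sh_module]
        linear_maps_compose[OF Pl ml] ml Pc y wt)
next
  note Pl = operator_linear and Pc = linear_maps_closed[OF operator_linear]
  note mr = mult_right_linear and ml = mult_left_linear
  fix x assume x: "x \<in> carrier Sh"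
  show "(\<lambda>y. mul (Op x) (Op y)) \<in> linear_maps K Sh Sh"
    by (rule linear_maps_compose[OF Pl mr[OF Pc[OF x]]])
  show "(\<lambda>y. Op (mul (Op x) y \<oplus>\<^bsub>Sh\<^esub> mul x (Op y) \<oplus>\<^bsub>Sh\<^esub> wt \<odot>\<^bsub>Sh\<^esub> mul x y)) \<in> linear_maps K Sh Sh"
    by (intro linear_maps_compose[OF _ Pl] linear_maps_plus[OF Sh_module] linear_maps_scale[OF Sh_module]
        linear_maps_compose[OF Pl mr] mr Pc x wt)
next
  fix s t assume "s \<in> decs" "t \<in> decs"
  then show "mul (Op s) (Op t) =
    Op (mul (Op s) t \<oplus>\<^bsub>Sh\<^esub>
      mul s (Op t) \<oplus>\<^bsub>Sh\<^esub> wt \<odot>\<^bsub>Sh\<^esub> mul s t)"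
    unfolding decs_def by (auto simp: rota_baxter_dec)
qed

lemma ShNC0_simps:
  "carrier (ShNC0 K wt M) = carrier Sh" "add (ShNC0 K wt M) = add Sh" "smult (ShNC0 K wt M) = smult Sh"
  "monoid.mult (ShNC0 K wt M) = mul"
  by (simp_all add: ShNC0_def)

lemma ShNC0_module_module: "module K (ShNC0 K wt M)"
  unfolding ShNC0_def by (rule module_mult_update[OF Sh_module])

lemma linear_maps_ShNC0:
  "linear_maps K (ShNC0 K wt M) B = linear_maps K Sh B"
  "linear_maps K A (ShNC0 K wt M) = linear_maps K A Sh"
  by (simp_all add: linear_maps_def ShNC0_simps)

lemma ShNC0_nonunital_algebra: "nonunital_algebra K (ShNC0 K wt M)"
proof (rule nonunital_algebra.intro[OF ShNC0_module_module], rule nonunital_algebra_axioms.intro)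
qed (simp_all add: ShNC0_simps mult_closed mult_assoc
    linear_maps_add[OF mult_right_linear] linear_maps_add[OF mult_left_linear]
    linear_maps_smult[OF mult_right_linear] linear_maps_smult[OF mult_left_linear])

lemma ShNC0_rota_baxter: "nonunital_rota_baxter K (ShNC0 K wt M) wt (Op)"
proof (rule nonunital_rota_baxter.intro[OF ShNC0_nonunital_algebra], rule nonunital_rota_baxter_axioms.intro)
qed (simp_all add: ShNC0_simps linear_maps_ShNC0 wt operator_linear rota_baxter_identity)

section \<open>The embedding\<close>

lemma ShNC0_embed_eq: "ShNC0_embed K M a = dec [bullet, bullet] [a]"
  by (simp add: ShNC0_embed_def dec_def)

lemma ShNC0_embed_linear: "ShNC0_embed K M \<in> linear_maps K M Sh"
proof -
  have "(\<lambda>a. dec [bullet, bullet] ([] @ [a] @ [])) \<in> linear_maps K M Sh"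
    using dec_multilinear[OF bullets_ladder_free(1)] unfolding multilinear_maps_def bullets_ladder_free(2)
    by (elim CollectE conjE allE impE) auto
  then show ?thesis by (simp add: ShNC0_embed_eq [abs_def])
qed

end

section \<open>Evaluation in a Rota--Baxter algebra\<close>

text \<open>
  The product of a nonempty word.  An algebra without identity has no product of the empty word; zero
  is a default that keeps all values in the carrier.
\<close>

fun wprod :: "('k, 'a, 'x) module_scheme \<Rightarrow> 'a list \<Rightarrow> 'a"
  where
    "wprod R [] = \<zero>\<^bsub>R\<^esub>"
  | "wprod R [x] = x"
  | "wprod R (x # y # zs) = x \<otimes>\<^bsub>R\<^esub> wprod R (y # zs)"

context nonunital_algebra
begin

lemma wprod_closed: "set u \<subseteq> carrier A \<Longrightarrow> wprod A u \<in> carrier A"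
  by (induction u rule: induct_list012) (auto intro: mult_closed)

lemma wprod_append:
  "\<lbrakk>set u \<subseteq> carrier A; set v \<subseteq> carrier A; u \<noteq> []; v \<noteq> []\<rbrakk> \<Longrightarrow>
    wprod A (u @ v) = wprod A u \<otimes>\<^bsub>A\<^esub> wprod A v"
proof (induction u rule: induct_list012)
  case (2 x)
  then show ?case by (cases v) auto
next
  case (3 x y zs)
  then show ?case by (simp add: mult_assoc wprod_closed)
qed simp

lemma wprod_slot_linear:
  assumes u: "set u \<subseteq> carrier A" and v: "set v \<subseteq> carrier A"
  shows "(\<lambda>x. wprod A (u @ [x] @ v)) \<in> linear_maps K A A"
proof -
  have r: "(\<lambda>x. wprod A (x # v)) \<in> linear_maps K A A"
  proof (cases "v = []")
    case True
    then show ?thesis by (simp add: linear_maps_id)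
  next
    case False
    then have "wprod A (x # v) = x \<otimes>\<^bsub>A\<^esub> wprod A v" for x by (cases v) auto
    then show ?thesis
      using wprod_closed[OF v]
      by (intro linear_mapsI) (auto simp: mult_closed distrib_right smult_mult_left)
  qed
  show ?thesis
  proof (cases "u = []")
    case True
    then show ?thesis using r by simp
  next
    case False
    have lin: "(\<lambda>x. wprod A u \<otimes>\<^bsub>A\<^esub> wprod A (x # v)) \<in> linear_maps K A A"
      using wprod_closed[OF u] linear_maps_closed[OF r] linear_maps_add[OF r] linear_maps_smult[OF r]
      by (intro linear_mapsI) (auto simp: mult_closed distrib_left smult_mult_right)
    have eq: "wprod A (u @ [x] @ v) = wprod A u \<otimes>\<^bsub>A\<^esub> wprod A (x # v)" if "x \<in> carrier A" for x
      using wprod_append[of u "x # v"] False u v that by simp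
    show ?thesis by (rule linear_maps_cong[OF module_axioms lin eq])
  qed
qed

lemma wprod_merge:
  assumes "set u \<subseteq> carrier A" "set v \<subseteq> carrier A" "x \<in> carrier A" "y \<in> carrier A"
  shows "wprod A (u @ [x]) \<otimes>\<^bsub>A\<^esub> wprod A (y # v) = wprod A (u @ [x \<otimes>\<^bsub>A\<^esub> y] @ v)"
proof -
  have r: "wprod A (z # v) = z \<otimes>\<^bsub>A\<^esub> wprod A v" if "v \<noteq> []" for z using that by (cases v) auto
  have l: "wprod A (u @ w) = wprod A u \<otimes>\<^bsub>A\<^esub> wprod A w"
    if "u \<noteq> []" "set w \<subseteq> carrier A" "w \<noteq> []" for w using wprod_append that assms by auto
  have c: "wprod A u \<in> carrier A" "wprod A v \<in> carrier A" using assms by (auto intro: wprod_closed)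
  have m: "wprod A [x] \<otimes>\<^bsub>A\<^esub> wprod A (y # v) = wprod A ((x \<otimes>\<^bsub>A\<^esub> y) # v)"
    using assms c by (cases "v = []") (simp_all add: r mult_assoc)
  show ?thesis
  proof (cases "u = []")
    case True
    then show ?thesis using m by simp
  next
    case False
    have "wprod A (y # v) \<in> carrier A" using assms by (intro wprod_closed) simp
    then show ?thesis
      using l[OF False, of "[x]"] l[OF False, of "(x \<otimes>\<^bsub>A\<^esub> y) # v"] m assms c
      by (simp add: mult_assoc mult_closed)
  qed
qed

end

text \<open>
  A forest \<open>[T\<^sub>1, \<dots>, T\<^sub>b]\<close> whose gaps between adjacent leaves carry letters of \<open>M\<close> is read
  from left to right as a word over \<open>R\<close>: the tree \<open>bullet\<close> contributes nothing, a letter \<open>a\<close>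
  between two trees contributes \<open>f a\<close>, and a tree \<open>Node F\<close> contributes the single letter \<open>P r\<close>,
  where \<open>r\<close> is the product of the word of \<open>F\<close>.  A tree with \<open>l\<close> leaves uses up \<open>l - 1\<close>
  letters, and \<open>tail_word\<close> reads trees that are each preceded by a letter.  Using words instead of
  products lets \<open>bullet\<close> act as an identity in an algebra that has none.
\<close>

function (sequential)
  tree_word :: "('k, 'a, 'x) module_scheme \<Rightarrow> ('a \<Rightarrow> 'a) \<Rightarrow> ('m \<Rightarrow> 'a) \<Rightarrow> ptree \<Rightarrow> 'm list \<Rightarrow> 'a list" and
  tail_word :: "('k, 'a, 'x) module_scheme \<Rightarrow> ('a \<Rightarrow> 'a) \<Rightarrow> ('m \<Rightarrow> 'a) \<Rightarrow> forest \<Rightarrow> 'm list \<Rightarrow> 'a list"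
  where
    "tree_word R P f (Node []) xs = []"
  | "tree_word R P f (Node (T # F)) xs =
      [P (wprod R (tree_word R P f T (take (tree_leaves T - 1) xs) @
        tail_word R P f F (drop (tree_leaves T - 1) xs)))]"
  | "tail_word R P f [] xs = []"
  | "tail_word R P f (T # F) xs =
      f (hd xs) # tree_word R P f T (take (tree_leaves T - 1) (tl xs)) @
        tail_word R P f F (drop (tree_leaves T) xs)"
  by pat_completeness auto
termination
proof -
  have [simp]: "0 < vertices T" for T by (cases T) simp
  show ?thesis
    by (relation "measure (\<lambda>s. case s of
      Inl (R, P, f, T, xs) \<Rightarrow> 2 * vertices T
    | Inr (R, P, f, F, xs) \<Rightarrow> 2 * sum_list (map vertices F) + 1)") auto
qed

fun forest_word :: "('k, 'a, 'x) module_scheme \<Rightarrow> ('a \<Rightarrow> 'a) \<Rightarrow> ('m \<Rightarrow> 'a) \<Rightarrow> forest \<Rightarrow> 'm list \<Rightarrow> 'a list"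
  where
    "forest_word R P f [] xs = []"
  | "forest_word R P f (T # F) xs =
      tree_word R P f T (take (tree_leaves T - 1) xs) @ tail_word R P f F (drop (tree_leaves T - 1) xs)"

definition evaluate :: "('k, 'a, 'x) module_scheme \<Rightarrow> ('a \<Rightarrow> 'a) \<Rightarrow> ('m \<Rightarrow> 'a) \<Rightarrow> forest \<Rightarrow> 'm list \<Rightarrow> 'a"
  where "evaluate R P f F xs = wprod R (forest_word R P f F xs)"

lemma tree_word_Node: "F \<noteq> [] \<Longrightarrow> tree_word R P f (Node F) xs = [P (evaluate R P f F xs)]"
  by (cases F) (simp_all add: evaluate_def)

declare tree_word.simps(2) [simp del] tail_word.simps(2) [simp del] forest_word.simps(2) [simp del]

lemma take_append_drop_append [simp]: "take n xs @ drop n xs @ ys = xs @ ys"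
  by (simp flip: append_assoc)

lemma tail_word_Cons:
  assumes "length ms = tree_leaves T - 1"
  shows "tail_word R P f (T # F) (a # ms @ zs) = f a # tree_word R P f T ms @ tail_word R P f F zs"
proof -
  have "tree_leaves T = Suc (length ms)" using assms tree_leaves_pos[of T] by linarith
  then show ?thesis by (simp add: tail_word.simps)
qed

lemma forest_word_Cons:
  assumes "length ms = tree_leaves T - 1"
  shows "forest_word R P f (T # F) (ms @ zs) = tree_word R P f T ms @ tail_word R P f F zs"
  using assms by (simp add: forest_word.simps)

lemma forest_word_single:
  assumes "length ms = tree_leaves T - 1"
  shows "forest_word R P f [T] ms = tree_word R P f T ms"
  using forest_word_Cons[OF assms, of R P f "[]" "[]"] by simp

lemma tail_word_split:
  assumes "length xs = leaves (T # F)"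
  obtains a ms zs where "xs = a # ms @ zs" "length ms = tree_leaves T - 1" "length zs = leaves F"
proof -
  obtain a ys where "xs = a # ys" using assms tree_leaves_pos[of T] by (cases xs) auto
  then show thesis
    using that[of a "take (tree_leaves T - 1) ys" "drop (tree_leaves T - 1) ys"] assms tree_leaves_pos[of T]
    by simp
qed

lemma forest_word_split:
  assumes "length xs = leaves (T # F) - 1"
  obtains ms zs where "xs = ms @ zs" "length ms = tree_leaves T - 1" "length zs = leaves F"
  using that[of "take (tree_leaves T - 1) xs" "drop (tree_leaves T - 1) xs"] assms tree_leaves_pos[of T]
  by simp

lemma tail_word_append:
  "length xs = leaves F \<Longrightarrow>
    tail_word R P f (F @ G) (xs @ ys) = tail_word R P f F xs @ tail_word R P f G ys"
proof (induction F arbitrary: xs)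
  case (Cons T F)
  obtain a ms zs where xs: "xs = a # ms @ zs" "length ms = tree_leaves T - 1" "length zs = leaves F"
    using Cons.prems by (rule tail_word_split)
  show ?case
    using Cons.IH[OF xs(3)] tail_word_Cons[OF xs(2), of R P f "F @ G" a "zs @ ys"]
      tail_word_Cons[OF xs(2), of R P f F a zs]
    by (simp add: xs(1))
qed simp

lemma forest_word_append:
  assumes "F \<noteq> []" "length xs = leaves F - 1"
  shows "forest_word R P f (F @ G) (xs @ ys) = forest_word R P f F xs @ tail_word R P f G ys"
proof -
  obtain T F' where F: "F = T # F'" using assms(1) by (cases F) auto
  obtain ms zs where xs: "xs = ms @ zs" "length ms = tree_leaves T - 1" "length zs = leaves F'"
    using assms(2) unfolding F by (rule forest_word_split)
  show ?thesis
    using tail_word_append[OF xs(3), of R P f G ys] forest_word_Cons[OF xs(2), of R P f "F' @ G" "zs @ ys"]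
      forest_word_Cons[OF xs(2), of R P f F' zs]
    by (simp add: xs(1) F)
qed

text \<open>
  What precedes the last tree of a forest contributes a prefix that does not depend on that tree.
\<close>

lemma forest_word_snoc:
  fixes xs :: "'m list"
  assumes "length xs = leaves F"
  shows "\<exists>u. \<forall>T ms. length ms = tree_leaves T - 1 \<longrightarrow>
    forest_word R P f (F @ [T]) (xs @ ms) = u @ tree_word R P f T ms"
proof (cases "F = []")
  case True
  then show ?thesis using assms by (intro exI[of _ "[]"]) (simp add: forest_word_single)
next
  case False
  then have "xs \<noteq> []" using assms leaves_pos[of F] by auto
  then have xs: "xs = butlast xs @ [last xs]" by simp
  show ?thesis
  proof (intro exI[of _ "forest_word R P f F (butlast xs) @ [f (last xs)]"] allI impI)
    fix T :: ptree and ms :: "'m list" assume ms: "length ms = tree_leaves T - 1"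
    have "forest_word R P f (F @ [T]) (butlast xs @ (last xs # ms)) =
        forest_word R P f F (butlast xs) @ tail_word R P f [T] (last xs # ms)"
      using assms by (intro forest_word_append False) simp
    also have "tail_word R P f [T] (last xs # ms) = f (last xs) # tree_word R P f T ms"
      using tail_word_Cons[OF ms, of R P f "[]" "last xs" "[]"] by simp
    also have "butlast xs @ (last xs # ms) = xs @ ms" using xs by (metis append.assoc append_Cons append_Nil)
    finally show "forest_word R P f (F @ [T]) (xs @ ms) =
        (forest_word R P f F (butlast xs) @ [f (last xs)]) @ tree_word R P f T ms" by simp
  qed
qed

context
  fixes K :: "('k, 'c) ring_scheme" and M :: "('k, 'm, 'd) module_scheme" and wt :: 'k
    and R :: "('k, 'r, 'e) module_scheme" and P :: "'r \<Rightarrow> 'r" and f :: "'m \<Rightarrow> 'r"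
  assumes K: "cring K" and M: "module K M"
    and R: "nonunital_rota_baxter K R wt P" and f: "f \<in> linear_maps K M R"
begin

interpretation R: nonunital_rota_baxter K R wt P by (rule R)

lemma R_module: "module K R" by (rule R.module_axioms)

abbreviation (input) "tw \<equiv> tree_word R P f"
abbreviation (input) "tlw \<equiv> tail_word R P f"
abbreviation (input) "fw \<equiv> forest_word R P f"
abbreviation (input) "ev \<equiv> evaluate R P f"

lemma words_closed_aux:
  "\<lbrakk>\<And>T ms. \<lbrakk>T \<in> set F; set ms \<subseteq> carrier M; length ms = tree_leaves T - 1\<rbrakk> \<Longrightarrow> set (tw T ms) \<subseteq> carrier R;
    set xs \<subseteq> carrier M; length xs = leaves F\<rbrakk> \<Longrightarrow> set (tlw F xs) \<subseteq> carrier R"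
proof (induction F arbitrary: xs)
  case (Cons T F)
  obtain a ms zs where xs: "xs = a # ms @ zs" "length ms = tree_leaves T - 1" "length zs = leaves F"
    using Cons.prems(3) by (rule tail_word_split)
  have "set (tlw F zs) \<subseteq> carrier R"
    using Cons.prems xs by (intro Cons.IH) auto
  moreover have "set (tw T ms) \<subseteq> carrier R" using Cons.prems xs by auto
  ultimately show ?case
    unfolding xs(1) tail_word_Cons[OF xs(2)] using Cons.prems(2) xs(1) linear_maps_closed[OF f] by auto
qed simp

lemma tree_word_closed:
  "\<lbrakk>set ms \<subseteq> carrier M; length ms = tree_leaves T - 1\<rbrakk> \<Longrightarrow> set (tw T ms) \<subseteq> carrier R"
proof (induction T arbitrary: ms)
  case (Node F)
  show ?case
  proof (cases F)
    case (Cons T F')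
    have "length ms = leaves (T # F') - 1" using Node.prems Cons by (simp add: tree_leaves_Node)
    then obtain ms1 zs where ms: "ms = ms1 @ zs" "length ms1 = tree_leaves T - 1" "length zs = leaves F'"
      by (rule forest_word_split)
    have "set (tw T ms1) \<subseteq> carrier R"
      by (rule Node.IH) (use Node.prems ms Cons in auto)
    moreover have "set (tlw F' zs) \<subseteq> carrier R"
      by (rule words_closed_aux[OF Node.IH]) (use Node.prems ms Cons in auto)
    ultimately have "ev F ms \<in> carrier R"
      unfolding evaluate_def Cons ms(1) forest_word_Cons[OF ms(2)] by (intro R.wprod_closed) simp
    then show ?thesis using linear_maps_closed[OF R.operator_linear] by (simp add: Cons tree_word_Node)
  qed simp
qed

lemma tail_word_closed:
  "\<lbrakk>set xs \<subseteq> carrier M; length xs = leaves F\<rbrakk> \<Longrightarrow> set (tlw F xs) \<subseteq> carrier R"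
  by (rule words_closed_aux[OF tree_word_closed])

lemma forest_word_closed:
  assumes "set xs \<subseteq> carrier M" "length xs = leaves F - 1"
  shows "set (fw F xs) \<subseteq> carrier R"
proof (cases F)
  case (Cons T F')
  obtain ms zs where xs: "xs = ms @ zs" "length ms = tree_leaves T - 1" "length zs = leaves F'"
    using assms(2) unfolding Cons by (rule forest_word_split)
  show ?thesis
    unfolding Cons xs(1) forest_word_Cons[OF xs(2)]
    using assms(1) xs tree_word_closed[of ms T] tail_word_closed[of zs F'] by simp
qed simp

lemma evaluate_closed: "xs \<in> tuples M (leaves F - 1) \<Longrightarrow> ev F xs \<in> carrier R"
  unfolding evaluate_def by (intro R.wprod_closed forest_word_closed) (simp_all add: tuples_def)

text \<open>
  Among the nonempty forests only \<open>[bullet]\<close> has the empty word, so it would have to be sent to an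
  identity of \<open>R\<close>.  Excluding ladders keeps it from appearing below a root as well.
\<close>

lemma forest_word_nonempty:
  assumes "F \<in> ladder_free_forests" "length xs = leaves F - 1"
  shows "fw F xs \<noteq> []"
proof -
  obtain T F' where F: "F = T # F'" using assms(1) by (cases F) (auto simp: ladder_free_forests_iff)
  obtain ms zs where xs: "xs = ms @ zs" "length ms = tree_leaves T - 1" "length zs = leaves F'"
    using assms(2) unfolding F by (rule forest_word_split)
  show ?thesis
  proof (cases F')
    case Nil
    then obtain A where "T = Node A" "A \<noteq> []"
      using assms(1) by (cases T) (auto simp: F ladder_free_forests_iff)
    then show ?thesis unfolding F xs(1) forest_word_Cons[OF xs(2)] by (simp add: tree_word_Node)
  next
    case (Cons U G)
    then show ?thesis unfolding F xs(1) forest_word_Cons[OF xs(2)] by (simp add: tail_word.simps)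
  qed
qed

section \<open>Multilinearity of the evaluation\<close>

text \<open>
  A word depends linearly on \<open>a\<close> in the strongest sense if \<open>a\<close> enters a single letter only, and
  linearly there.  This property passes from a forest to all forests that contain it.
\<close>

definition linear_slot :: "('m \<Rightarrow> 'r list) \<Rightarrow> bool"
  where "linear_slot w \<longleftrightarrow> (\<exists>u v h. set u \<subseteq> carrier R \<and> set v \<subseteq> carrier R \<and> h \<in> linear_maps K M R \<and>
    (\<forall>a. w a = u @ [h a] @ v))"

lemma linear_slot_extend:
  assumes "linear_slot w" "set u \<subseteq> carrier R" "set v \<subseteq> carrier R" "\<And>a. w' a = u @ w a @ v"
  shows "linear_slot w'"
proof -
  obtain u' v' h where "set u' \<subseteq> carrier R" "set v' \<subseteq> carrier R" "h \<in> linear_maps K M R"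
    "\<And>a. w a = u' @ [h a] @ v'" using assms(1) unfolding linear_slot_def by blast
  then show ?thesis
    unfolding linear_slot_def using assms(2-4)
    by (intro exI[of _ "u @ u'"] exI[of _ "v' @ v"] exI[of _ h]) auto
qed

lemma linear_slot_wprod: "linear_slot w \<Longrightarrow> (\<lambda>a. wprod R (w a)) \<in> linear_maps K M R"
  unfolding linear_slot_def using linear_maps_compose[OF _ R.wprod_slot_linear] by fastforce

lemma linear_slot_letter: "linear_slot (\<lambda>a. [f a])"
  unfolding linear_slot_def by (rule exI[of _ "[]"], rule exI[of _ "[]"], rule exI[of _ f]) (simp add: f)

lemma tail_word_slot:
  "\<lbrakk>\<And>T xs ys. \<lbrakk>T \<in> set F; set xs \<subseteq> carrier M; set ys \<subseteq> carrier M; length xs + 1 + length ys = tree_leaves T - 1\<rbrakk> \<Longrightarrow>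
      linear_slot (\<lambda>a. tw T (xs @ [a] @ ys));
    set xs \<subseteq> carrier M; set ys \<subseteq> carrier M; length xs + 1 + length ys = leaves F\<rbrakk> \<Longrightarrow>
    linear_slot (\<lambda>a. tlw F (xs @ [a] @ ys))"
proof (induction F arbitrary: xs)
  case (Cons T F)
  let ?l = "tree_leaves T - 1"
  define l where "l = ?l"
  have l: "tree_leaves T = Suc l" using tree_leaves_pos[of T] unfolding l_def by linarith
  consider "xs = []" | b xs' where "xs = b # xs'" "length xs' < ?l" | b xs' where "xs = b # xs'" "?l \<le> length xs'"
    by (cases xs) fastforce+
  then show ?case
  proof cases
    case 1
    have w: "tlw (T # F) (xs @ [a] @ ys) = [] @ [f a] @ (tw T (take ?l ys) @ tlw F (drop ?l ys))" for a
      using tail_word_Cons[of "take ?l ys" T R P f F a "drop ?l ys"] Cons.prems(4) l 1 by simp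
    have "set (tw T (take ?l ys)) \<subseteq> carrier R"
      using Cons.prems(2-4) 1 l set_take_subset[of ?l ys] by (intro tree_word_closed) auto
    moreover have "set (tlw F (drop ?l ys)) \<subseteq> carrier R"
      using Cons.prems(2-4) 1 l set_drop_subset[of ?l ys] by (intro tail_word_closed) auto
    ultimately show ?thesis
      by (intro linear_slot_extend[OF linear_slot_letter _ _ w]) auto
  next
    case 2
    define k where "k = ?l - Suc (length xs')"
    have w: "tlw (T # F) (xs @ [a] @ ys) = [f b] @ tw T (xs' @ [a] @ take k ys) @ tlw F (drop k ys)" for a
      using tail_word_Cons[of "xs' @ [a] @ take k ys" T R P f F b "drop k ys"] Cons.prems(4) l 2
      by (simp add: k_def)
    have s: "linear_slot (\<lambda>a. tw T (xs' @ [a] @ take k ys))"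
      using Cons.prems(2-4) 2 l set_take_subset[of k ys] by (intro Cons.prems(1)) (auto simp: k_def)
    have t: "set (tlw F (drop k ys)) \<subseteq> carrier R"
      using Cons.prems(2-4) 2 l set_drop_subset[of k ys] by (intro tail_word_closed) (auto simp: k_def)
    show ?thesis
      by (rule linear_slot_extend[OF s _ t w]) (use Cons.prems(2) 2 linear_maps_closed[OF f] in auto)
  next
    case 3
    have w: "tlw (T # F) (xs @ [a] @ ys) = (f b # tw T (take ?l xs')) @ tlw F (drop ?l xs' @ [a] @ ys) @ []" for a
      using tail_word_Cons[of "take ?l xs'" T R P f F b "drop ?l xs' @ [a] @ ys"] 3 by simp
    have s: "linear_slot (\<lambda>a. tlw F (drop ?l xs' @ [a] @ ys))"
      using Cons.prems 3 l set_drop_subset[of ?l xs'] by (intro Cons.IH) auto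
    have t: "set (tw T (take ?l xs')) \<subseteq> carrier R"
      using Cons.prems(2-4) 3 l set_take_subset[of ?l xs'] by (intro tree_word_closed) auto
    show ?thesis
      by (rule linear_slot_extend[OF s _ _ w]) (use Cons.prems(2) 3 t linear_maps_closed[OF f] in auto)
  qed
qed simp

lemma forest_word_slot_aux:
  assumes tree: "\<And>T xs ys. \<lbrakk>T \<in> set F; set xs \<subseteq> carrier M; set ys \<subseteq> carrier M;
      length xs + 1 + length ys = tree_leaves T - 1\<rbrakk> \<Longrightarrow> linear_slot (\<lambda>a. tw T (xs @ [a] @ ys))"
    and xs: "set xs \<subseteq> carrier M" "set ys \<subseteq> carrier M" "length xs + 1 + length ys = leaves F - 1"
  shows "linear_slot (\<lambda>a. fw F (xs @ [a] @ ys))"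
proof -
  obtain T F' where F: "F = T # F'" using xs(3) by (cases F) auto
  let ?l = "tree_leaves T - 1"
  define l where "l = ?l"
  have l: "tree_leaves T = Suc l" using tree_leaves_pos[of T] unfolding l_def by linarith
  show ?thesis
  proof (cases "length xs < ?l")
    case True
    define k where "k = ?l - Suc (length xs)"
    have w: "fw F (xs @ [a] @ ys) = [] @ tw T (xs @ [a] @ take k ys) @ tlw F' (drop k ys)" for a
      using forest_word_Cons[of "xs @ [a] @ take k ys" T R P f F' "drop k ys"] xs(3) l True
      by (simp add: k_def F)
    have s: "linear_slot (\<lambda>a. tw T (xs @ [a] @ take k ys))"
      using xs True l set_take_subset[of k ys] F by (intro tree) (auto simp: k_def)
    have t: "set (tlw F' (drop k ys)) \<subseteq> carrier R"
      using xs True l set_drop_subset[of k ys] F by (intro tail_word_closed) (auto simp: k_def)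
    show ?thesis by (rule linear_slot_extend[OF s _ t w]) simp
  next
    case False
    have w: "fw F (xs @ [a] @ ys) = tw T (take ?l xs) @ tlw F' (drop ?l xs @ [a] @ ys) @ []" for a
      using forest_word_Cons[of "take ?l xs" T R P f F' "drop ?l xs @ [a] @ ys"] False by (simp add: F)
    have s: "linear_slot (\<lambda>a. tlw F' (drop ?l xs @ [a] @ ys))"
      using xs False l set_drop_subset[of ?l xs] F tree by (intro tail_word_slot) auto
    have t: "set (tw T (take ?l xs)) \<subseteq> carrier R"
      using xs False l set_take_subset[of ?l xs] by (intro tree_word_closed) auto
    show ?thesis by (rule linear_slot_extend[OF s t _ w]) simp
  qed
qed

lemma tree_word_slot:
  "\<lbrakk>set xs \<subseteq> carrier M; set ys \<subseteq> carrier M; length xs + 1 + length ys = tree_leaves T - 1\<rbrakk> \<Longrightarrow>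
    linear_slot (\<lambda>a. tw T (xs @ [a] @ ys))"
proof (induction T arbitrary: xs ys)
  case (Node F)
  then have F: "F \<noteq> []" by (auto simp: tree_leaves_Node)
  have "linear_slot (\<lambda>a. fw F (xs @ [a] @ ys))"
    using Node F by (intro forest_word_slot_aux) (auto simp: tree_leaves_Node)
  then have "(\<lambda>a. P (ev F (xs @ [a] @ ys))) \<in> linear_maps K M R"
    unfolding evaluate_def by (rule linear_maps_compose[OF linear_slot_wprod R.operator_linear])
  then show ?case
    unfolding linear_slot_def tree_word_Node[OF F]
    by (intro exI[of _ "[]"] exI[of _ "\<lambda>a. P (ev F (xs @ [a] @ ys))"]) simp
qed

lemma evaluate_multilinear: "ev F \<in> multilinear_maps K M (leaves F - 1) R"
  unfolding multilinear_maps_def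
proof (intro CollectI conjI ballI allI impI)
  fix xs ys
  assume "set xs \<subseteq> carrier M \<and> set ys \<subseteq> carrier M \<and> length xs + 1 + length ys = leaves F - 1"
  then show "(\<lambda>a. ev F (xs @ [a] @ ys)) \<in> linear_maps K M R"
    unfolding evaluate_def by (intro linear_slot_wprod forest_word_slot_aux tree_word_slot) auto
qed (rule evaluate_closed)

section \<open>Multiplicativity of the evaluation\<close>

lemma evaluate_graft: "\<lbrakk>A \<noteq> []; length ms = leaves A - 1\<rbrakk> \<Longrightarrow> ev [Node A] ms = P (ev A ms)"
  unfolding evaluate_def[of R P f "[Node A]"]
  by (simp add: forest_word_single tree_leaves_Node tree_word_Node)

text \<open>
  The words of \<open>F\<close> and \<open>G\<close> meet at the last tree \<open>T\<close> of \<open>F\<close> and the first tree \<open>U\<close> of \<open>G\<close>, as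
  do the forests in their product.  If one of these trees is \<open>bullet\<close>, the words are simply
  concatenated.  Otherwise the letters \<open>P x\<close> and \<open>P y\<close> of \<open>T\<close> and \<open>U\<close> are multiplied by the
  Rota--Baxter identity in \<open>R\<close>, whose three terms are, by induction, the three terms of the product
  of \<open>T\<close> and \<open>U\<close>.
\<close>

lemma evaluate_mult:
  "\<lbrakk>F \<in> ladder_free_forests; xs \<in> tuples M (leaves F - 1); G \<in> ladder_free_forests; ys \<in> tuples M (leaves G - 1)\<rbrakk> \<Longrightarrow>
    ev F xs \<otimes>\<^bsub>R\<^esub> ev G ys = wsum K wt R (\<lambda>X. ev X (xs @ ys)) (forest_prod F G)"
proof (induction "fvertices F + fvertices G" arbitrary: F G xs ys rule: less_induct)
  case less
  note wtK = R.weight_closed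
  have "F \<noteq> []" "G \<noteq> []" using less.prems by (auto simp: ladder_free_forests_iff)
  then obtain F' T U G' where F: "F = F' @ [T]" and G: "G = U # G'"
    by (metis rev_exhaust list.exhaust)
  have xsM: "set xs \<subseteq> carrier M" "length xs = leaves F - 1"
    and ysM: "set ys \<subseteq> carrier M" "length ys = leaves G - 1"
    using less.prems by (auto simp: tuples_def)
  define xs1 ms where "xs1 = take (leaves F') xs" and "ms = drop (leaves F') xs"
  have xs: "xs = xs1 @ ms" "length xs1 = leaves F'" "length ms = tree_leaves T - 1"
  proof -
    have "leaves F' + (tree_leaves T - 1) = length xs"
      using xsM(2) tree_leaves_pos[of T] unfolding F leaves_simps by linarith
    then show "xs = xs1 @ ms" "length xs1 = leaves F'" "length ms = tree_leaves T - 1"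
      by (simp_all add: xs1_def ms_def)
  qed
  obtain ns ys2 where ys: "ys = ns @ ys2" "length ns = tree_leaves U - 1" "length ys2 = leaves G'"
    using ysM(2) unfolding G by (rule forest_word_split)
  obtain u where u: "\<And>T ms. length ms = tree_leaves T - 1 \<Longrightarrow> fw (F' @ [T]) (xs1 @ ms) = u @ tw T ms"
    using forest_word_snoc[OF xs(2), of R P f] by blast
  define v where "v = tlw G' ys2"
  have wF: "fw F xs = u @ tw T ms" using u[OF xs(3)] by (simp add: F xs(1))
  have wG: "fw G ys = tw U ns @ v" unfolding G ys(1) v_def by (rule forest_word_Cons[OF ys(2)])
  have wX: "fw (F' @ X # G') (xs1 @ zs @ ys2) = u @ tw X zs @ v" if "length zs = tree_leaves X - 1" for X zs
    using forest_word_append[of "F' @ [X]" "xs1 @ zs" R P f G' ys2] u[OF that] that xs(2) tree_leaves_pos[of X]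
    by (simp add: v_def)
  have cl: "set (fw F xs) \<subseteq> carrier R" "set (fw G ys) \<subseteq> carrier R"
    by (rule forest_word_closed[OF xsM], rule forest_word_closed[OF ysM])
  have ne: "fw F xs \<noteq> []" "fw G ys \<noteq> []"
    by (rule forest_word_nonempty[OF less.prems(1) xsM(2)], rule forest_word_nonempty[OF less.prems(3) ysM(2)])
  have evFG: "ev F xs \<otimes>\<^bsub>R\<^esub> ev G ys = wprod R (u @ tw T ms @ tw U ns @ v)"
    unfolding evaluate_def using R.wprod_append[OF cl ne] by (simp add: wF wG)
  have uv: "set u \<subseteq> carrier R" "set v \<subseteq> carrier R" using cl by (auto simp: wF wG)
  show ?case
  proof (cases "T = bullet \<or> U = bullet")
    case True
    then obtain X where X: "tree_prod T U = {#(0, X)#}" "tw X (ms @ ns) = tw T ms @ tw U ns"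
      "length (ms @ ns) = tree_leaves X - 1"
    proof
      assume T: "T = bullet"
      show thesis using that[of U] xs(3) ys(2) by (simp add: T tree_leaves_Node)
    next
      assume U: "U = bullet"
      show thesis using that[of T] xs(3) ys(2) by (simp add: U tree_leaves_Node)
    qed
    have "ev (F' @ X # G') (xs @ ys) = wprod R (u @ tw T ms @ tw U ns @ v)"
      unfolding evaluate_def using wX[OF X(3)] X(2) by (simp add: xs(1) ys(1))
    moreover have "forest_prod F G = {#(0, F' @ X # G')#}" by (simp add: F G X(1))
    moreover have "wprod R (u @ tw T ms @ tw U ns @ v) \<in> carrier R"
      using cl by (intro R.wprod_closed) (simp add: wF wG)
    ultimately show ?thesis
      unfolding evFG by (simp add: wsum_single[OF R_module wtK])
  next
    case False
    obtain A B where TU: "T = Node A" "U = Node B" by (metis ptree.exhaust)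
    have AB: "A \<noteq> []" "B \<noteq> []" using False by (auto simp: TU)
    have lf: "A \<in> ladder_free_forests" "B \<in> ladder_free_forests"
      "[T] \<in> ladder_free_forests" "[U] \<in> ladder_free_forests"
      using less.prems False AB by (auto simp: F G TU ladder_free_forests_iff ladder_free_Node)
    have lAB: "length ms = leaves A - 1" "length ns = leaves B - 1"
      using xs(3) ys(2) AB by (simp_all add: TU tree_leaves_Node)
    have ms: "ms \<in> tuples M (leaves A - 1)" "ms \<in> tuples M (leaves [T] - 1)"
      and ns: "ns \<in> tuples M (leaves B - 1)" "ns \<in> tuples M (leaves [U] - 1)"
      using xs ys xsM ysM lAB by (auto simp: tuples_def)
    let ?Y = "forest_prod [T] B + forest_prod A [U] + wshift 1 (forest_prod A B)"
    let ?e = "\<lambda>X. ev X (ms @ ns)"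
    have eT: "ev [T] ms = P (ev A ms)" and eU: "ev [U] ns = P (ev B ns)"
      using evaluate_graft AB lAB by (auto simp: TU)
    have good: "snd p \<noteq> [] \<and> length (ms @ ns) = leaves (snd p) - 1" if "p \<in># ?Y" for p
    proof -
      from that consider "p \<in># forest_prod [T] B" | "p \<in># forest_prod A [U]"
        | q where "q \<in># forest_prod A B" "snd p = snd q" by (auto simp: wshift_def)
      then show ?thesis
      proof cases
        case 1 then show ?thesis
          using forest_prod_in[OF lf(3,2) 1] forest_prod_nonempty[OF 1] lAB AB
          by (simp add: TU tree_leaves_Node)
      next
        case 2 then show ?thesis
          using forest_prod_in[OF lf(1,4) 2] forest_prod_nonempty[OF 2] lAB AB
          by (simp add: TU tree_leaves_Node)
      next
        case 3 then show ?thesis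
          using forest_prod_in[OF lf(1,2) 3(1)] forest_prod_nonempty[OF 3(1)] lAB by simp
      qed
    qed
    have tup: "ms @ ns \<in> tuples M (leaves (snd p) - 1)" if "p \<in># ?Y" for p
      using good[OF that] ms ns by (simp add: tuples_def)
    have cY: "\<forall>p\<in>#?Y. ?e (snd p) \<in> carrier R" using evaluate_closed[OF tup] by blast
    have c: "\<forall>p\<in>#forest_prod [T] B. ?e (snd p) \<in> carrier R"
      "\<forall>p\<in>#forest_prod A [U]. ?e (snd p) \<in> carrier R"
      "\<forall>p\<in>#wshift 1 (forest_prod A B). ?e (snd p) \<in> carrier R"
      using cY by auto
    have c': "\<forall>p\<in>#forest_prod A B. ?e (snd p) \<in> carrier R"
      using c(3) by (auto simp: wshift_def)
    have IH1: "ev [T] ms \<otimes>\<^bsub>R\<^esub> ev B ns = wsum K wt R ?e (forest_prod [T] B)"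
      by (rule less.hyps[OF _ lf(3) ms(2) lf(2) ns(1)]) (simp add: F G TU)
    have IH2: "ev A ms \<otimes>\<^bsub>R\<^esub> ev [U] ns = wsum K wt R ?e (forest_prod A [U])"
      by (rule less.hyps[OF _ lf(1) ms(1) lf(4) ns(2)]) (simp add: F G TU)
    have IH3: "ev A ms \<otimes>\<^bsub>R\<^esub> ev B ns = wsum K wt R ?e (forest_prod A B)"
      by (rule less.hyps[OF _ lf(1) ms(1) lf(2) ns(1)]) (simp add: F G TU)
    have eA: "ev A ms \<in> carrier R" and eB: "ev B ns \<in> carrier R" by (intro evaluate_closed ms ns)+
    note Pc = linear_maps_closed[OF R.operator_linear]
    let ?s = "\<lambda>x. wprod R (u @ [x] @ v)"
    note sl = R.wprod_slot_linear[OF uv]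
    have e: "ev (F' @ Node (snd p) # G') (xs @ ys) = ?s (P (?e (snd p))) \<and>
        ev (F' @ Node (snd p) # G') (xs @ ys) \<in> carrier R" if p: "p \<in># ?Y" for p
    proof -
      have "length (ms @ ns) = tree_leaves (Node (snd p)) - 1"
        using good[OF p] by (simp add: tree_leaves_Node)
      from wX[OF this] have "ev (F' @ Node (snd p) # G') (xs @ ys) = ?s (P (?e (snd p)))"
        using good[OF p] by (simp add: evaluate_def[of R P f "F' @ Node (snd p) # G'"] xs(1) ys(1) tree_word_Node)
      moreover have "?s (P (?e (snd p))) \<in> carrier R"
        by (rule linear_maps_closed[OF sl Pc]) (use cY p in blast)
      ultimately show ?thesis by simp
    qed
    have "ev F xs \<otimes>\<^bsub>R\<^esub> ev G ys = ?s (P (ev A ms) \<otimes>\<^bsub>R\<^esub> P (ev B ns))"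
    proof -
      have "ev F xs \<otimes>\<^bsub>R\<^esub> ev G ys = wprod R (u @ [P (ev A ms)]) \<otimes>\<^bsub>R\<^esub> wprod R (P (ev B ns) # v)"
        unfolding evaluate_def[of R P f F] evaluate_def[of R P f G] wF wG TU tree_word_Node[OF AB(1)]
          tree_word_Node[OF AB(2)] by simp
      then show ?thesis using R.wprod_merge[OF uv Pc[OF eA] Pc[OF eB]] by simp
    qed
    also have "P (ev A ms) \<otimes>\<^bsub>R\<^esub> P (ev B ns) = P (wsum K wt R ?e ?Y)"
      unfolding R.rota_baxter[OF eA eB] IH1[unfolded eT] IH2[unfolded eU] IH3
      using c c' wtK
      by (simp add: wsum_add[OF R_module wtK] wsum_wshift[OF R_module wtK] ball_Un
          del: forest_prod_single_Cons)
    also have "\<dots> = wsum K wt R (\<lambda>X. P (?e X)) ?Y"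
      by (rule linear_maps_wsum[OF R_module R_module wtK R.operator_linear cY])
    also have "?s \<dots> = wsum K wt R (\<lambda>X. ?s (P (?e X))) ?Y"
      by (rule linear_maps_wsum[OF R_module R_module wtK sl]) (use cY Pc in blast)
    also have "\<dots> = wsum K wt R (\<lambda>X. ev (F' @ Node X # G') (xs @ ys)) ?Y"
      by (rule wsum_cong[OF R_module wtK]; intro ballI; metis e)
    also have "\<dots> = wsum K wt R (\<lambda>X. ev X (xs @ ys)) (wmap (\<lambda>X. F' @ Node X # G') ?Y)"
      by (rule wsum_wmap[OF R_module wtK, symmetric]) (use e in blast)
    also have "wmap (\<lambda>X. F' @ Node X # G') ?Y = forest_prod F G"
      by (simp add: F G TU tree_prod_Node[OF AB] del: forest_prod_single_Cons)
    finally show ?thesis .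
  qed
qed

end

section \<open>The universal property\<close>

context
  fixes K :: "('k, 'c) ring_scheme" and M :: "('k, 'm, 'd) module_scheme" and wt :: 'k
    and R :: "('k, 'r, 'e) module_scheme" and P :: "'r \<Rightarrow> 'r" and f :: "'m \<Rightarrow> 'r"
  assumes K: "cring K" and wt: "wt \<in> carrier K" and M: "module K M"
    and R: "nonunital_rota_baxter K R wt P" and f: "f \<in> linear_maps K M R"
begin

interpretation R: nonunital_rota_baxter K R wt P by (rule R)

abbreviation (input) "homs \<equiv> rota_baxter_homs K (ShNC0 K wt M) (ShNC0_operator K M) R P"

text \<open>
  Evaluation extends to a linear map because it is multilinear in the decorations; the other
  properties are checked on generators.
\<close>

lemma exists_hom:
  "\<exists>g. g \<in> homs \<and>
    (\<forall>a\<in>carrier M. g (ShNC0_embed K M a) = f a)"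
proof -
  let ?ev = "evaluate R P f" and ?Sh = "ShNC0_module K M" and ?P = "ShNC0_operator K M"
  let ?m = "ShNC0_mult K wt M"
  note RM = R.module_axioms
  obtain g where gl: "g \<in> linear_maps K ?Sh R"
    and g: "\<And>F xs. \<lbrakk>F \<in> ladder_free_forests; xs \<in> tuples M (leaves F - 1)\<rbrakk> \<Longrightarrow> g (dec K M F xs) = ?ev F xs"
    using Sh_lift[OF K wt M RM evaluate_multilinear[OF K M R f]] by blast
  note gc = linear_maps_closed[OF gl]
  note Shm = Sh_module[OF K wt M] and gen = Sh_generates[OF K wt M]
  have mult: "g (?m u v) = g u \<otimes>\<^bsub>R\<^esub> g v" if u: "u \<in> carrier ?Sh" and v: "v \<in> carrier ?Sh" for u v
  proof (rule bilinear_agree[OF Shm gen Shm gen RM _ _ _ _ _ u v])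
    fix y assume y: "y \<in> carrier ?Sh"
    show "(\<lambda>x. g (?m x y)) \<in> linear_maps K ?Sh R"
      by (rule linear_maps_compose[OF mult_left_linear[OF K wt M y] gl])
    show "(\<lambda>x. g x \<otimes>\<^bsub>R\<^esub> g y) \<in> linear_maps K ?Sh R"
      using gc y linear_maps_add[OF gl] linear_maps_smult[OF gl]
      by (intro linear_mapsI) (simp_all add: R.mult_closed R.distrib_right R.smult_mult_left)
    show "(\<lambda>x. g (?m y x)) \<in> linear_maps K ?Sh R"
      by (rule linear_maps_compose[OF mult_right_linear[OF K wt M y] gl])
    show "(\<lambda>x. g y \<otimes>\<^bsub>R\<^esub> g x) \<in> linear_maps K ?Sh R"
      using gc y linear_maps_add[OF gl] linear_maps_smult[OF gl]
      by (intro linear_mapsI) (simp_all add: R.mult_closed R.distrib_left R.smult_mult_right)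
  next
    fix s t assume "s \<in> decs K M" "t \<in> decs K M"
    then obtain F xs G ys where s: "s = dec K M F xs" and F: "F \<in> ladder_free_forests"
      and xs: "xs \<in> tuples M (leaves F - 1)" and t: "t = dec K M G ys"
      and G: "G \<in> ladder_free_forests" and ys: "ys \<in> tuples M (leaves G - 1)"
      unfolding decs_def[OF K wt M] by blast
    have "g (?m s t) = wsum K wt R (\<lambda>X. g (dec K M X (xs @ ys))) (forest_prod F G)"
      unfolding s t mult_dec[OF K wt M F xs G ys]
      by (rule linear_maps_wsum[OF Shm RM wt gl dec_forest_prod_closed[OF K wt M F xs G ys]])
    also have "\<dots> = wsum K wt R (\<lambda>X. ?ev X (xs @ ys)) (forest_prod F G)"
    proof (rule wsum_cong[OF RM wt]; intro ballI)
      fix p assume p: "p \<in># forest_prod F G"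
      have "xs @ ys \<in> tuples M (leaves (snd p) - 1)"
        unfolding forest_prod_in(2)[OF F G p] by (rule append_tuples[OF M xs ys])
      then show "?ev (snd p) (xs @ ys) \<in> carrier R" "g (dec K M (snd p) (xs @ ys)) = ?ev (snd p) (xs @ ys)"
        using evaluate_closed[OF K M R f] g[OF forest_prod_in(1)[OF F G p]] by auto
    qed
    also have "\<dots> = g s \<otimes>\<^bsub>R\<^esub> g t"
      unfolding s t g[OF F xs] g[OF G ys] by (rule evaluate_mult[OF K M R f F xs G ys, symmetric])
    finally show "g (?m s t) = g s \<otimes>\<^bsub>R\<^esub> g t" .
  qed
  have op: "g (?P u) = P (g u)" if u: "u \<in> carrier ?Sh" for u
  proof (rule linear_maps_agree[OF Shm gen RM linear_maps_compose[OF operator_linear[OF K wt M] gl]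
        linear_maps_compose[OF gl R.operator_linear] _ u])
    fix s assume "s \<in> decs K M"
    then obtain F xs where s: "s = dec K M F xs" and F: "F \<in> ladder_free_forests"
      and xs: "xs \<in> tuples M (leaves F - 1)"
      unfolding decs_def[OF K wt M] by blast
    have ne: "F \<noteq> []" using F by (simp add: ladder_free_forests_iff)
    have "g (?P s) = ?ev [Node F] xs"
      unfolding s operator_dec[OF K wt M F xs]
      by (rule g[OF graft_ladder_free[OF F]]) (use xs ne in \<open>simp add: tree_leaves_Node\<close>)
    also have "\<dots> = P (?ev F xs)"
      using xs by (intro evaluate_graft[OF K M R f ne]) (simp add: tuples_def)
    finally show "g (?P s) = P (g s)" unfolding s g[OF F xs] .
  qed
  have emb: "g (ShNC0_embed K M a) = f a" if "a \<in> carrier M" for a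
    unfolding ShNC0_embed_eq[OF K wt M]
    using that by (subst g) (simp_all add: bullets_ladder_free tuples_def tree_leaves_Node evaluate_def
        forest_word.simps tail_word.simps)
  show ?thesis
    using gl mult op emb
    by (intro exI[of _ g]) (simp add: rota_baxter_homs_def ShNC0_simps[OF K wt M] linear_maps_ShNC0[OF K wt M])
qed

text \<open>
  A decorated ladder-free forest is a graft, the image of an element of \<open>M\<close>, or a product of two
  forests with fewer vertices: a leading \<open>bullet\<close> is split off together with the first decoration as
  the factor \<open>[bullet, bullet]\<close>, and any other leading tree \<open>T\<close> as the factor \<open>[T]\<close>, leaving
  \<open>bullet\<close> in its place.  So a homomorphism is determined by its values on \<open>M\<close>.
\<close>

lemma hom_dec:
  assumes g: "g \<in> homs"
    and emb: "\<And>a. a \<in> carrier M \<Longrightarrow> g (ShNC0_embed K M a) = f a"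
  shows "\<lbrakk>F \<in> ladder_free_forests; xs \<in> tuples M (leaves F - 1)\<rbrakk> \<Longrightarrow> g (dec K M F xs) = evaluate R P f F xs"
proof (induction "fvertices F" arbitrary: F xs rule: less_induct)
  case less
  let ?ev = "evaluate R P f" and ?Sh = "ShNC0_module K M" and ?P = "ShNC0_operator K M"
  let ?m = "ShNC0_mult K wt M" and ?d = "dec K M"
  have gm: "\<And>u v. \<lbrakk>u \<in> carrier ?Sh; v \<in> carrier ?Sh\<rbrakk> \<Longrightarrow> g (?m u v) = g u \<otimes>\<^bsub>R\<^esub> g v"
    and gP: "\<And>u. u \<in> carrier ?Sh \<Longrightarrow> g (?P u) = P (g u)"
    using g by (auto simp: rota_baxter_homs_def ShNC0_simps[OF K wt M])
  note dc = dec_closed[OF K wt M]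
  have split: "g (?d F (us @ vs)) = ?ev F (us @ vs)"
    if prod: "forest_prod G H = {#(0, F)#}"
      and G: "G \<in> ladder_free_forests" "us \<in> tuples M (leaves G - 1)" "g (?d G us) = ?ev G us"
      and H: "H \<in> ladder_free_forests" "vs \<in> tuples M (leaves H - 1)" "g (?d H vs) = ?ev H vs"
    for G H us vs
  proof -
    have F: "F \<in> ladder_free_forests" "leaves F - 1 = (leaves G - 1) + (leaves H - 1)"
      using forest_prod_in[OF G(1) H(1), of "(0, F)"] by (simp_all add: prod)
    have t: "us @ vs \<in> tuples M (leaves F - 1)" unfolding F(2) by (rule append_tuples[OF M G(2) H(2)])
    have "?m (?d G us) (?d H vs) = ?d F (us @ vs)"
      unfolding mult_dec[OF K wt M G(1,2) H(1,2)] prod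
      by (rule wsum_single[OF Sh_module[OF K wt M] wt]) (rule dc[OF F(1) t])
    moreover have "?ev G us \<otimes>\<^bsub>R\<^esub> ?ev H vs = ?ev F (us @ vs)"
      unfolding evaluate_mult[OF K M R f G(1,2) H(1,2)] prod
      by (rule wsum_single[OF R.module_axioms wt]) (rule evaluate_closed[OF K M R f t])
    ultimately show ?thesis using gm[OF dc[OF G(1,2)] dc[OF H(1,2)]] G(3) H(3) by simp
  qed
  have two: "g (?d [bullet, bullet] [a]) = ?ev [bullet, bullet] [a]" if "a \<in> carrier M" for a
    using emb[OF that]
    by (simp add: ShNC0_embed_eq[OF K wt M] evaluate_def forest_word.simps tail_word.simps tree_leaves_Node)
  obtain T G where F: "F = T # G" using less.prems by (cases F) (auto simp: ladder_free_forests_iff)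
  have len: "length xs = leaves F - 1" "set xs \<subseteq> carrier M" using less.prems by (auto simp: tuples_def)
  consider (graft) "G = []" | (bullets) "T = bullet" "G = [bullet]"
    | (bullet) "T = bullet" "G \<noteq> []" "G \<noteq> [bullet]" | (tree) "T \<noteq> bullet" "G \<noteq> []" by blast
  then show ?case
  proof cases
    case graft
    obtain A where T: "T = Node A" by (cases T)
    have A: "A \<noteq> []" "A \<in> ladder_free_forests"
      using less.prems by (auto simp: F T graft ladder_free_forests_iff ladder_free_Node)
    have xs: "xs \<in> tuples M (leaves A - 1)"
      using less.prems A by (simp add: F T graft tree_leaves_Node)
    have "g (?d F xs) = P (g (?d A xs))"
      using gP[OF dc[OF A(2) xs]] by (simp add: operator_dec[OF K wt M A(2) xs] F T graft)
    also have "g (?d A xs) = ?ev A xs"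
      by (rule less.hyps[OF _ A(2) xs]) (simp add: F T graft)
    also have "P (?ev A xs) = ?ev F xs"
      using xs by (simp add: evaluate_graft[OF K M R f A(1)] F T graft tuples_def)
    finally show ?thesis .
  next
    case bullets
    then obtain a where "xs = [a]" "a \<in> carrier M"
      using len by (cases xs) (auto simp: F tree_leaves_Node)
    then show ?thesis using two bullets by (simp add: F)
  next
    case bullet
    have G: "G \<in> ladder_free_forests"
      using less.prems bullet by (auto simp: F ladder_free_forests_iff)
    have "0 < leaves G" using bullet leaves_pos by blast
    then obtain a ys where xs: "xs = [a] @ ys" "a \<in> carrier M" "ys \<in> tuples M (leaves G - 1)"
      using len bullet by (cases xs) (auto simp: F tree_leaves_Node tuples_def)
    have "forest_prod [bullet, bullet] G = {#(0, F)#}"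
      using bullet forest_prod_snoc_Cons[of "[bullet]" bullet] by (cases G) (simp_all add: F)
    then show ?thesis
      unfolding xs(1)
      by (rule split) (use xs G bullet two in
          \<open>simp_all add: bullets_ladder_free tuples_def tree_leaves_Node less.hyps F\<close>)
  next
    case tree
    have lf: "[T] \<in> ladder_free_forests" "bullet # G \<in> ladder_free_forests"
      using less.prems tree by (auto simp: F ladder_free_forests_iff)
    obtain us vs where xs: "xs = us @ vs" "length us = tree_leaves T - 1" "length vs = leaves G"
      using len(1) unfolding F by (rule forest_word_split)
    have us: "us \<in> tuples M (leaves [T] - 1)" and vs: "vs \<in> tuples M (leaves (bullet # G) - 1)"
      using xs len by (auto simp: tuples_def tree_leaves_Node)
    have v: "0 < vertices U" for U by (cases U) simp
    obtain U G' where "G = U # G'" using tree by (cases G) auto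
    then have vG: "0 < fvertices G" using v[of U] by simp
    obtain U' A where "T = Node (U' # A)" using tree by (metis list.exhaust ptree.exhaust)
    then have "1 < vertices T" using v[of U'] by simp
    then have "g (?d (bullet # G) vs) = ?ev (bullet # G) vs"
      by (intro less.hyps lf vs) (simp add: F)
    moreover have "g (?d [T] us) = ?ev [T] us"
      using vG by (intro less.hyps lf us) (simp add: F)
    moreover have "forest_prod [T] (bullet # G) = {#(0, F)#}" by (simp add: F)
    ultimately show ?thesis
      unfolding xs(1) using lf us vs by (intro split)
  qed
qed

lemma unique_hom:
  "\<exists>!g. g \<in> homs \<and>
    g \<in> extensional (carrier (ShNC0 K wt M)) \<and> (\<forall>a\<in>carrier M. g (ShNC0_embed K M a) = f a)"
proof (rule ex_ex1I)
  let ?Sh = "ShNC0_module K M"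
  note sh = ShNC0_simps[OF K wt M] linear_maps_ShNC0[OF K wt M]
  obtain g where g: "g \<in> homs"
    "\<forall>a\<in>carrier M. g (ShNC0_embed K M a) = f a" using exists_hom by blast
  let ?g = "restrict g (carrier ?Sh)"
  interpret Sh: module K ?Sh by (rule Sh_module[OF K wt M])
  have "?g \<in> homs"
    using g(1) mult_closed[OF K wt M] linear_maps_closed[OF operator_linear[OF K wt M]]
      linear_maps_cong[OF Sh_module[OF K wt M], of g R ?g]
    by (simp add: rota_baxter_homs_def sh)
  moreover have "\<forall>a\<in>carrier M. ?g (ShNC0_embed K M a) = f a"
    using g(2) linear_maps_closed[OF ShNC0_embed_linear[OF K wt M]] by simp
  ultimately show "\<exists>g. g \<in> homs \<and>
    g \<in> extensional (carrier (ShNC0 K wt M)) \<and> (\<forall>a\<in>carrier M. g (ShNC0_embed K M a) = f a)"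
    unfolding sh by (intro exI[of _ ?g]) simp
next
  let ?Sh = "ShNC0_module K M"
  note sh = ShNC0_simps[OF K wt M] linear_maps_ShNC0[OF K wt M]
  fix g h
  assume g: "g \<in> homs \<and>
      g \<in> extensional (carrier (ShNC0 K wt M)) \<and> (\<forall>a\<in>carrier M. g (ShNC0_embed K M a) = f a)"
    and h: "h \<in> homs \<and>
      h \<in> extensional (carrier (ShNC0 K wt M)) \<and> (\<forall>a\<in>carrier M. h (ShNC0_embed K M a) = f a)"
  have gl: "g \<in> linear_maps K ?Sh R" and hl: "h \<in> linear_maps K ?Sh R"
    using g h by (auto simp: rota_baxter_homs_def sh)
  have "g u = h u" if u: "u \<in> carrier ?Sh" for u
  proof (rule linear_maps_agree[OF Sh_module[OF K wt M] Sh_generates[OF K wt M] R.module_axioms gl hl _ u])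
    fix s assume "s \<in> decs K M"
    then show "g s = h s"
      unfolding decs_def[OF K wt M] using hom_dec[of g] hom_dec[of h] g h by auto
  qed
  then show "g = h"
    using g h unfolding sh by (intro extensionalityI[of g "carrier ?Sh"]) auto
qed

end

theorem theorem3p6:
  fixes K :: "('k, 'c) ring_scheme"
    and M :: "('k, 'm, 'd) module_scheme"
    and wt :: 'k
  assumes "cring K" and "wt \<in> carrier K" and "module K M"
  shows "nonunital_algebra K (ShNC0 K wt M) \<and>
    nonunital_rota_baxter K (ShNC0 K wt M) wt (ShNC0_operator K M) \<and>
    ShNC0_embed K M \<in> linear_maps K M (ShNC0 K wt M) \<and>
    (\<forall>(R :: ('k, 'r, 'e) module_scheme) P f.
      nonunital_rota_baxter K R wt P \<and> f \<in> linear_maps K M R \<longrightarrow>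
      (\<exists>!g. g \<in> rota_baxter_homs K (ShNC0 K wt M) (ShNC0_operator K M) R P \<and>
            g \<in> extensional (carrier (ShNC0 K wt M)) \<and>
            (\<forall>a\<in>carrier M. g (ShNC0_embed K M a) = f a)))"
proof (intro conjI allI impI)
  show "nonunital_algebra K (ShNC0 K wt M)" by (rule ShNC0_nonunital_algebra[OF assms])
  show "nonunital_rota_baxter K (ShNC0 K wt M) wt (ShNC0_operator K M)"
    by (rule ShNC0_rota_baxter[OF assms])
  show "ShNC0_embed K M \<in> linear_maps K M (ShNC0 K wt M)"
    unfolding linear_maps_ShNC0[OF assms] by (rule ShNC0_embed_linear[OF assms])
qed (elim conjE, rule unique_hom[OF assms])

end
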